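(* Let $k\ge 2$, and let $S$ be a singular surface in $\mathbb{R}^3$ parameterized by a smooth map-germ $f\colon(\mathbb{R}^2,\mathbf{0})\to(\mathbb{R}^3,\mathbf{0})$ that is $\mathcal{A}$-equivalent to $H_k$. Let $\mathbf{w}_0\in S^2$, let $H$ be the family of height functions on $S$ (as a germ at $(\mathbf{0},\mathbf{w}_0)$) and let $h_{\mathbf{w}_0}$ be the height function on $S$ along $\mathbf{w}_0$. Then: \begin{enumerate} \item $h_{\mathbf{w}_0}$ has an $A_1$-singularity at $(0,0)$ if and only if $\mathbf{w}_0$ is in the normal plane but $\mathbf{w}_0$ is not the principal normal direction. When this is the case, $H$ is an $\mathcal{R}^+$-versal unfolding of $h_{\mathbf{w}_0}$. \item $h_{\mathbf{w}_0}$ has an $A_2$-singularity at $(0,0)$ if and only if $\mathbf{w}_0$ is the principal normal direction and the singular point $f(\mathbf{0})$ of $S$ is not an inflection point. When this is the case, $H$ is not an $\mathcal{R}^+$-versal unfolding of $h_{\mathbf{w}_0}$. \item $h_{\mathbf{w}_0}$ does not have an $A_{\ge 3}$-singularity at $(0,0)$. \item $h_{\mathbf{w}_0}$ has a $D_4$- or more degenerate singularity at $(0,0)$ if and only if $\mathbf{w}_0$ is the principal normal direction and the singular point $f(\mathbf{0})$ of $S$ is an inflection point. When this is the case, $H$ is not an $\mathcal{R}^+$-versal unfolding of $h_{\mathbf{w}_0}$. \end{enumerate}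
   Context: **$\mathcal{A}$-equivalence and $H_k$.** Smooth map-germs $f,g\colon(\mathbb{R}^2,\mathbf{0})\to(\mathbb{R}^3,\mathbf{0})$ are $\mathcal{A}$-equivalent if $g=\Phi\circ f\circ\phi^{-1}$ for diffeomorphism germs $\phi$ of $(\mathbb{R}^2,\mathbf{0})$ and $\Phi$ of $(\mathbb{R}^3,\mathbf{0})$. For $k\ge2$, $H_k$ denotes the class of the germ $(x,y)\mapsto(x,\,xy+y^{3k-1},\,y^3)$. Such germs have corank 1 at $\mathbf{0}$ and 2-jet $\mathcal{A}$-equivalent to $(u,uv,0)$. **Geometry at the singular point.** The tangent line is the image of $df_{\mathbf{0}}$ (a line). The normal plane is the plane through $f(\mathbf{0})$ perpendicular to the tangent line. A null vector is a non-zero $\eta\in T_{\mathbf{0}}\mathbb{R}^2$ with $df_{\mathbf{0}}(\eta)=0$. For $\xi\in T_{\mathbf{0}}\mathbb{R}^2$ such that $\{\xi,\eta\}$ is linearly independent, the principal plane is the plane through $f(\mathbf{0})$ spanned by $\xi f(\mathbf{0})$ and $\xi\eta f(\mathbf{0})$ ($\zeta g$ is the directional derivative of $g$ along $\zeta$); it does not depend on choices. The principal normal vector is a unit normal vector to the principal plane at $f(\mathbf{0})$, determined up to sign; "$\mathbf{w}_0$ is the principal normal direction" means $\mathbf{w}_0$ is $\pm$ this vector. **Inflection point.** Write the orthogonal projection of $f$ onto the normal plane as $(u,v)\mapsto(p(u,v),q(u,v))$. The group $\mathrm{GL}(2,\mathbb{R})\times\mathrm{GL}(2,\mathbb{R})$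 acts on the pair of quadratic forms $(j^2p,j^2q)$ by linear changes in source and target. The singular point is called hyperbolic, elliptic, parabolic, inflection, degenerate inflection if the orbit of $(j^2p,j^2q)$ is that of $(x^2,y^2)$; $(xy,x^2-y^2)$; $(x^2,xy)$; $(x^2\pm y^2,0)$; $(x^2,0)$ or $(0,0)$, respectively. **Height functions.** $S^2$ is the unit sphere in $\mathbb{R}^3$; $H\colon(\mathbb{R}^2\times S^2,(\mathbf{0},\mathbf{w}_0))\to\mathbb{R}$, $H(u,v,\mathbf{w})=\langle f(u,v),\mathbf{w}\rangle$, and $h_{\mathbf{w}}(u,v)=H(u,v,\mathbf{w})$ is the height function along $\mathbf{w}$. **Singularity types.** Function-germs $f,g\colon(\mathbb{R}^2,\mathbf{0})\to(\mathbb{R},0)$ are $\mathcal{K}$-equivalent if $g=\lambda\cdot(f\circ\phi^{-1})$ with $\phi$ a diffeomorphism germ of $(\mathbb{R}^2,\mathbf{0})$ and $\lambda$ a smooth function-germ with $\lambda(\mathbf{0})\neq0$. A germ has an $A_k$-singularity ($k\ge1$) if it is $\mathcal{K}$-equivalent to $x^2\pm y^{k+1}$, and a $D_k$-singularity ($k\ge4$) if it is $\mathcal{K}$-equivalent to $x^2y\pm y^{k-1}$. "$A_{\ge m}$-singularity" means a singular germ with Hessian of rank 1 that is not $A_j$ for any $j<m$. "$D_4$- or more degenerate singularity" means a singular germ whose Hessian vanishes. **Versality.** $\mathcal{R}^+$-versality of unfoldings is in the usual sense (every unfolding of the germ is induced from the given one, up to parameter-dependent changes of source coordinates and addition of functions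 of the parameters). *)

theory Defs
  imports "HOL-Analysis.Analysis" "HOL-Analysis.Finite_Function_Topology"
begin

text \<open>
  Map-germs are represented by total functions; only their behaviour near the base point matters,
  and equality of germs is equality on a neighbourhood (\<open>\<forall>\<^sub>F x in nhds a. _\<close>).
\<close>

subsection \<open>Smooth germs\<close>

definition dir_deriv :: "'a::real_normed_vector \<Rightarrow> ('a \<Rightarrow> 'b::real_normed_vector) \<Rightarrow> 'a \<Rightarrow> 'b"
  where "dir_deriv v f = (\<lambda>x. frechet_derivative f (at x) v)"

text \<open>
  On a finite-dimensional domain the next predicate is the class \<open>C\<^sup>k\<close> on the open set \<open>S\<close>.
\<close>

fun Ck_on :: "nat \<Rightarrow> 'a::real_normed_vector set \<Rightarrow> ('a \<Rightarrow> 'b::real_normed_vector) \<Rightarrow> bool"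
  where
    "Ck_on 0 S f = continuous_on S f"
  | "Ck_on (Suc k) S f = ((\<forall>x\<in>S. f differentiable (at x)) \<and> (\<forall>v. Ck_on k S (dir_deriv v f)))"

definition smooth_at :: "('a::real_normed_vector \<Rightarrow> 'b::real_normed_vector) \<Rightarrow> 'a \<Rightarrow> bool"
  where "smooth_at f a \<longleftrightarrow> (\<exists>U. open U \<and> a \<in> U \<and> (\<forall>k. Ck_on k U f))"

definition inverse_diffeo_germs :: "('a::euclidean_space \<Rightarrow> 'a) \<Rightarrow> ('a \<Rightarrow> 'a) \<Rightarrow> bool"
  where "inverse_diffeo_germs \<phi> \<psi> \<longleftrightarrow>
    smooth_at \<phi> 0 \<and> smooth_at \<psi> 0 \<and> \<phi> 0 = 0 \<and> \<psi> 0 = 0 \<and>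
    (\<forall>\<^sub>F x in nhds 0. \<psi> (\<phi> x) = x) \<and> (\<forall>\<^sub>F x in nhds 0. \<phi> (\<psi> x) = x)"

definition diffeo_germ :: "('a::euclidean_space \<Rightarrow> 'a) \<Rightarrow> bool"
  where "diffeo_germ \<phi> \<longleftrightarrow> (\<exists>\<psi>. inverse_diffeo_germs \<phi> \<psi>)"

definition A_equivalent :: "(real^2 \<Rightarrow> real^3) \<Rightarrow> (real^2 \<Rightarrow> real^3) \<Rightarrow> bool"
  where "A_equivalent f g \<longleftrightarrow>
    (\<exists>\<phi> \<phi>' \<Phi>. inverse_diffeo_germs \<phi> \<phi>' \<and> diffeo_germ \<Phi> \<and>
      (\<forall>\<^sub>F x in nhds 0. g x = \<Phi> (f (\<phi>' x))))"

definition H_germ :: "nat \<Rightarrow> real^2 \<Rightarrow> real^3"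
  where "H_germ k z = (let x = z $ 1; y = z $ 2 in vector [x, x * y + y ^ (3 * k - 1), y ^ 3])"

subsection \<open>Geometry at the singular point\<close>

definition tangent_line :: "(real^2 \<Rightarrow> real^3) \<Rightarrow> (real^3) set"
  where "tangent_line f = range (frechet_derivative f (at 0))"

definition normal_plane :: "(real^2 \<Rightarrow> real^3) \<Rightarrow> (real^3) set"
  where "normal_plane f = {p. \<forall>v\<in>tangent_line f. (p - f 0) \<bullet> v = 0}"

definition null_vector :: "(real^2 \<Rightarrow> real^3) \<Rightarrow> real^2 \<Rightarrow> bool"
  where "null_vector f \<eta> \<longleftrightarrow> \<eta> \<noteq> 0 \<and> frechet_derivative f (at 0) \<eta> = 0"

text \<open>
  Both vectors are extended to constant vector fields. Another extension of \<open>\<eta>\<close> changes the second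
  spanning vector by an element of the tangent line, which is spanned by the first one.
\<close>

definition principal_plane :: "(real^2 \<Rightarrow> real^3) \<Rightarrow> real^2 \<Rightarrow> real^2 \<Rightarrow> (real^3) set"
  where "principal_plane f \<xi> \<eta> =
    (\<lambda>v. f 0 + v) ` span {dir_deriv \<xi> f 0, dir_deriv \<xi> (dir_deriv \<eta> f) 0}"

definition principal_normal :: "(real^2 \<Rightarrow> real^3) \<Rightarrow> real^3 \<Rightarrow> bool"
  where "principal_normal f w \<longleftrightarrow> norm w = 1 \<and>
    (\<exists>\<xi> \<eta>. null_vector f \<eta> \<and> \<xi> \<noteq> \<eta> \<and> independent {\<xi>, \<eta>} \<and>
      (\<forall>p\<in>principal_plane f \<xi> \<eta>. (p - f 0) \<bullet> w = 0))"

definition jet2 :: "('a::real_normed_vector \<Rightarrow> real) \<Rightarrow> 'a \<Rightarrow> real"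
  where "jet2 g x = g 0 + dir_deriv x g 0 + dir_deriv x (dir_deriv x g) 0 / 2"

text \<open>A pair of functions on the plane is encoded as a single map into \<open>real^2\<close>.\<close>

definition gl2_orbit :: "(real^2 \<Rightarrow> real^2) \<Rightarrow> (real^2 \<Rightarrow> real^2) set"
  where "gl2_orbit Q =
    {\<lambda>x. B *v Q (A *v x) | A B :: real^2^2. invertible A \<and> invertible B}"

text \<open>
  The orthogonal projection of \<open>f\<close> onto the normal plane is \<open>f 0 + p *\<^sub>R e\<^sub>1 + q *\<^sub>R e\<^sub>2\<close>, where
  \<open>p\<close> and \<open>q\<close> are the coordinates with respect to an orthonormal frame of that plane; a change of
  frame acts on the target by an orthogonal matrix and so does not affect the orbit.
\<close>

definition inflection_point :: "(real^2 \<Rightarrow> real^3) \<Rightarrow> bool"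
  where "inflection_point f \<longleftrightarrow>
    (\<exists>e\<^sub>1 e\<^sub>2. norm e\<^sub>1 = 1 \<and> norm e\<^sub>2 = 1 \<and> e\<^sub>1 \<bullet> e\<^sub>2 = 0 \<and>
      f 0 + e\<^sub>1 \<in> normal_plane f \<and> f 0 + e\<^sub>2 \<in> normal_plane f \<and>
      (let p = (\<lambda>x. (f x - f 0) \<bullet> e\<^sub>1);
           q = (\<lambda>x. (f x - f 0) \<bullet> e\<^sub>2);
           Q = (\<lambda>x. vector [jet2 p x, jet2 q x])
       in gl2_orbit Q = gl2_orbit (\<lambda>x. vector [(x $ 1)\<^sup>2 + (x $ 2)\<^sup>2, 0]) \<or>
          gl2_orbit Q = gl2_orbit (\<lambda>x. vector [(x $ 1)\<^sup>2 - (x $ 2)\<^sup>2, 0])))"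

subsection \<open>Height functions and their singularities\<close>

definition height :: "(real^2 \<Rightarrow> real^3) \<Rightarrow> real^2 \<Rightarrow> real^3 \<Rightarrow> real"
  where "height f x w = f x \<bullet> w"

definition K_equivalent :: "(real^2 \<Rightarrow> real) \<Rightarrow> (real^2 \<Rightarrow> real) \<Rightarrow> bool"
  where "K_equivalent f g \<longleftrightarrow>
    (\<exists>\<phi> \<phi>' l. inverse_diffeo_germs \<phi> \<phi>' \<and> smooth_at l 0 \<and> l 0 \<noteq> 0 \<and>
      (\<forall>\<^sub>F x in nhds 0. g x = l x * f (\<phi>' x)))"

definition A_singularity :: "nat \<Rightarrow> (real^2 \<Rightarrow> real) \<Rightarrow> bool"
  where "A_singularity k h \<longleftrightarrow> k \<ge> 1 \<and>
    (K_equivalent h (\<lambda>x. (x $ 1)\<^sup>2 + (x $ 2) ^ (k + 1)) \<or>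
     K_equivalent h (\<lambda>x. (x $ 1)\<^sup>2 - (x $ 2) ^ (k + 1)))"

definition singular_germ :: "(real^2 \<Rightarrow> real) \<Rightarrow> bool"
  where "singular_germ h \<longleftrightarrow> (h has_derivative (\<lambda>_. 0)) (at 0)"

definition hessian :: "(real^2 \<Rightarrow> real) \<Rightarrow> real^2^2"
  where "hessian h = (\<chi> i j. dir_deriv (axis i 1) (dir_deriv (axis j 1) h) 0)"

definition A_ge_singularity :: "nat \<Rightarrow> (real^2 \<Rightarrow> real) \<Rightarrow> bool"
  where "A_ge_singularity m h \<longleftrightarrow>
    singular_germ h \<and> rank (hessian h) = 1 \<and> (\<forall>j<m. \<not> A_singularity j h)"

definition D4_or_worse :: "(real^2 \<Rightarrow> real) \<Rightarrow> bool"
  where "D4_or_worse h \<longleftrightarrow> singular_germ h \<and> hessian h = 0"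

subsection \<open>Versal unfoldings\<close>

text \<open>
  Unfoldings with any number \<open>s\<close> of parameters have to be quantified over inside one definition.
  The normed space \<open>nat \<Rightarrow>\<^sub>0 real\<close> of finitely supported sequences contains every \<open>\<real>\<^sup>s\<close>
  (the sequences supported on \<open>{..<s}\<close>), and a map on \<open>\<real>\<^sup>s\<close> is identified with the map on
  \<open>nat \<Rightarrow>\<^sub>0 real\<close> that reads off the first \<open>s\<close> coordinates. Smoothness and equality of germs at 0
  then mean the same on both sides.
\<close>

type_synonym params = "nat \<Rightarrow>\<^sub>0 real"

definition depends_on_first :: "nat \<Rightarrow> (params \<Rightarrow> 'b) \<Rightarrow> bool"
  where "depends_on_first s F \<longleftrightarrow>
    (\<forall>t t'. (\<forall>i<s. Poly_Mapping.lookup t i = Poly_Mapping.lookup t' i) \<longrightarrow> F t = F t')"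

definition unfolding_of :: "nat \<Rightarrow> ('a::euclidean_space \<Rightarrow> real) \<Rightarrow> ('a \<Rightarrow> params \<Rightarrow> real) \<Rightarrow> bool"
  where "unfolding_of s h G \<longleftrightarrow>
    depends_on_first s (\<lambda>t x. G x t) \<and> smooth_at (\<lambda>(x, t). G x t) (0, 0) \<and>
    (\<forall>\<^sub>F x in nhds 0. G x 0 = h x)"

text \<open>
  The family \<open>F\<close> has as its parameter space a submanifold \<open>P\<close> of a Euclidean space, with base point
  \<open>p\<^sub>0\<close>, and is given by a formula that is smooth on a neighbourhood in the ambient space. A smooth
  map into \<open>P\<close> is a smooth map into the ambient space with values in \<open>P\<close>.
\<close>

definition R_plus_versal ::
  "'p::euclidean_space set \<Rightarrow> 'p \<Rightarrow> ('a::euclidean_space \<Rightarrow> real) \<Rightarrow> ('a \<Rightarrow> 'p \<Rightarrow> real) \<Rightarrow> bool"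
  where "R_plus_versal P p\<^sub>0 h F \<longleftrightarrow>
    p\<^sub>0 \<in> P \<and> smooth_at (\<lambda>(x, p). F x p) (0, p\<^sub>0) \<and> (\<forall>\<^sub>F x in nhds 0. F x p\<^sub>0 = h x) \<and>
    (\<forall>s G. unfolding_of s h G \<longrightarrow>
      (\<exists>(\<phi> :: 'a \<Rightarrow> params \<Rightarrow> 'a) (\<psi> :: params \<Rightarrow> 'p) (c :: params \<Rightarrow> real).
        depends_on_first s (\<lambda>t x. \<phi> x t) \<and> depends_on_first s \<psi> \<and> depends_on_first s c \<and>
        smooth_at (\<lambda>(x, t). \<phi> x t) (0, 0) \<and> smooth_at \<psi> 0 \<and> smooth_at c 0 \<and>
        (\<forall>\<^sub>F x in nhds 0. \<phi> x 0 = x) \<and>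
        \<psi> 0 = p\<^sub>0 \<and> (\<forall>\<^sub>F t in nhds 0. \<psi> t \<in> P) \<and>
        (\<forall>\<^sub>F (x, t) in nhds (0, 0). G x t = F (\<phi> x t) (\<psi> t) + c t)))"

end

theory Submission
  imports Defs
begin

text \<open>
  Write \<open>f = \<Psi> \<circ> H \<circ> \<phi>\<close> with diffeomorphism germs \<open>\<phi>\<close>, \<open>\<Psi>\<close> and \<open>H (x, y) = (x, xy + y^n, y^3)\<close>,
  where \<open>n = 3 k - 1\<close>. For a vector \<open>w\<close> the height function in the source coordinates of \<open>H\<close> is
  \<open>\<gamma> (H (x, y))\<close> with \<open>\<gamma> z = \<Psi> z \<bullet> w\<close>. Everything is governed by the four numbers
  \<open>slope i w = \<gamma>_i (0)\<close> for \<open>i = 1, 2, 3\<close> and \<open>curv w = \<gamma>_11 (0)\<close>: the linear part is \<open>slope 1 w * x\<close>, and when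
  it vanishes the quadratic part is \<open>curv w / 2 * x^2 + slope 2 w * xy\<close>. Hence \<open>w\<close> lies in the normal
  plane iff \<open>slope 1 w = 0\<close>, it is a principal normal iff moreover \<open>slope 2 w = 0\<close>
  (\<open>principal_normal_iff\<close>), and for a principal normal \<open>w\<close> the singular point is an inflection point iff
  \<open>curv w = 0\<close>, since then the two quadratic forms of the projection span only a line of hyperbolic
  forms, whereas otherwise they span \<open>x^2\<close> and \<open>xy\<close> (\<open>inflection_point_iff\<close>).

  The Hessian up to a nonzero factor and a linear change is an invariant of contact equivalence
  (\<open>K_equivalent_hessian\<close>), which gives the necessity of all conditions. For sufficiency, if
  \<open>slope 2 w \<noteq> 0\<close> the Hessian is nondegenerate and the Morse lemma applies. If
  \<open>slope 1 w = slope 2 w = 0\<close> then \<open>slope 3 w \<noteq> 0\<close> because \<open>\<Psi>\<close> is a diffeomorphism; if also \<open>curv w \<noteq> 0\<close>,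
  splitting off a square in \<open>x\<close> leaves a function of \<open>y\<close> with cubic leading term
  \<open>slope 3 w * y^3\<close>, hence a cusp \<open>A_2\<close> (\<open>A2_singularityI\<close>). So a Hessian of rank 1 always means
  \<open>A_2\<close>, and a vanishing Hessian is the remaining case.

  A nondegenerate critical point is stable: by the Morse lemma with parameters every unfolding of
  the height function differs from the trivial one by a family of coordinate changes and a function
  of the parameters, so already the constant map into the sphere induces it
  (\<open>morse_height_versal\<close>). If \<open>w\<close> is a principal normal, the null direction \<open>\<eta>\<close> of \<open>f\<close> is also in the
  kernel of the Hessian of the height function. Then no unfolding induced from the height functions can move the
  derivative along \<open>\<eta>\<close> at the origin to first order, while \<open>h x + t * (x \<bullet> \<eta>)\<close> does
  (\<open>degenerate_height_not_versal\<close>).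

  The analytic tools are all for functions \<open>g (z, p)\<close> of one real variable \<open>z\<close> and a parameter \<open>p\<close> in an
  arbitrary normed space: inversion in \<open>z\<close> (\<open>local_inverse_first\<close>), division by \<open>z\<close>
  (\<open>hadamard_factor\<close>), and \<open>g (z, p) = \<plusminus> Y (z, p)^2 + c p\<close> near a point where \<open>g_z = 0 \<noteq> g_zz\<close>
  (\<open>split_off_square\<close>). Applied once they give the cusp and applied twice the Morse lemma with
  parameters; the coordinate changes are triangular, so that inversion in one variable suffices to
  invert them.
\<close>

section \<open>Smooth real functions of finite type\<close>

text \<open>
  The parameters of an unfolding live in an infinite-dimensional, incomplete space, on which iterated
  directional derivatives do not control the total derivative. All functions that occur depend on
  finitely many linear coordinates, and their derivatives have the form
  \<open>\<Sum> l_i v * d_i x\<close> with finitely many fixed bounded functionals \<open>l_i\<close>. Requiring this form at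
  each order, as \<open>ftCk\<close> does, makes the usual calculus, including differentiation under the integral sign, available
  on every normed space.
\<close>
inductive_set covector_fields :: "('a::real_normed_vector \<Rightarrow> real) set \<Rightarrow> ('a \<Rightarrow> 'a \<Rightarrow> real) set"
  for C :: "('a \<Rightarrow> real) set"
  where
    zero: "(\<lambda>x v. 0) \<in> covector_fields C"
  | plus: "bounded_linear l \<Longrightarrow> d \<in> C \<Longrightarrow> w \<in> covector_fields C
      \<Longrightarrow> (\<lambda>x v. l v * d x + w x v) \<in> covector_fields C"

primrec ftCk :: "nat \<Rightarrow> 'a::real_normed_vector set \<Rightarrow> ('a \<Rightarrow> real) \<Rightarrow> bool"
  where
    "ftCk 0 S f = continuous_on S f"
  | "ftCk (Suc k) S f =
      (\<exists>w \<in> covector_fields {d. ftCk k S d}. \<forall>x\<in>S. (f has_derivative w x) (at x))"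

lemma ftCk_SucI:
  assumes "w \<in> covector_fields {d. ftCk k S d}" "\<And>x. x \<in> S \<Longrightarrow> (f has_derivative w x) (at x)"
  shows "ftCk (Suc k) S f"
  unfolding ftCk.simps using assms by blast

lemma covector_fields_mono:
  assumes "w \<in> covector_fields C" "C \<subseteq> D"
  shows "w \<in> covector_fields D"
  using assms(1) by induct (use assms(2) in \<open>auto intro: covector_fields.intros\<close>)

lemma covector_fields_add:
  assumes "w1 \<in> covector_fields C" "w2 \<in> covector_fields C"
  shows "(\<lambda>x v. w1 x v + w2 x v) \<in> covector_fields C"
  using assms(1)
proof induct
  case (plus l d w)
  have "(\<lambda>x v. l v * d x + (w x v + w2 x v)) \<in> covector_fields C"
    by (intro covector_fields.plus plus)
  then show ?case by (simp add: add.assoc)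
qed (use assms(2) in simp)

lemma covector_fields_scale:
  assumes "w \<in> covector_fields C" "\<And>d. d \<in> C \<Longrightarrow> (\<lambda>x. r x * d x) \<in> D"
  shows "(\<lambda>x v. r x * w x v) \<in> covector_fields D"
  using assms(1)
proof induct
  case zero
  show ?case using covector_fields.zero by simp
next
  case (plus l d w)
  have "(\<lambda>x v. l v * (r x * d x) + r x * w x v) \<in> covector_fields D"
    by (intro covector_fields.plus plus assms)
  then show ?case by (simp add: algebra_simps)
qed

lemma covector_fields_single:
  assumes "bounded_linear l" "d \<in> C"
  shows "(\<lambda>x v. l v * d x) \<in> covector_fields C"
  using covector_fields.plus[OF assms covector_fields.zero] by simp

lemma covector_fields_sum:
  assumes "finite I" "\<And>i. i \<in> I \<Longrightarrow> w i \<in> covector_fields C"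
  shows "(\<lambda>x v. \<Sum>i\<in>I. w i x v) \<in> covector_fields C"
  using assms by (induct I) (auto intro: covector_fields_add covector_fields.zero)

lemma covector_fields_bounded_linear:
  assumes "w \<in> covector_fields C"
  shows "bounded_linear (w x)"
  using assms
proof induct
  case (plus l d w)
  show ?case
    using plus bounded_linear_add bounded_linear_compose[OF bounded_linear_mult_left]
    by blast
qed simp

lemma ftCk_mono: "ftCk k S f \<Longrightarrow> T \<subseteq> S \<Longrightarrow> ftCk k T f"
proof (induct k arbitrary: f)
  case 0
  then show ?case using continuous_on_subset by auto
next
  case (Suc k)
  then have "{d. ftCk k S d} \<subseteq> {d. ftCk k T d}" by auto
  moreover from Suc.prems(1) obtain w where "w \<in> covector_fields {d. ftCk k S d}"
    "\<And>x. x \<in> S \<Longrightarrow> (f has_derivative w x) (at x)" unfolding ftCk.simps by blast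
  ultimately show ?case using Suc.prems(2)
    by (intro ftCk_SucI[of w]) (auto intro: covector_fields_mono)
qed

lemma ftCk_Suc_imp_differentiable: "ftCk (Suc k) S f \<Longrightarrow> x \<in> S \<Longrightarrow> f differentiable (at x)"
  by (auto simp: differentiable_def)

lemma ftCk_SucD: "ftCk (Suc k) S f \<Longrightarrow> ftCk k S f"
proof (induct k arbitrary: f)
  case 0
  then have "\<forall>x\<in>S. isCont f x"
    by (auto intro: has_derivative_continuous)
  then show ?case by (simp add: continuous_at_imp_continuous_on)
next
  case (Suc k)
  then have "{d. ftCk (Suc k) S d} \<subseteq> {d. ftCk k S d}" by blast
  moreover from Suc.prems(1) obtain w where "w \<in> covector_fields {d. ftCk (Suc k) S d}"
    "\<And>x. x \<in> S \<Longrightarrow> (f has_derivative w x) (at x)" unfolding ftCk.simps by blast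
  ultimately show ?case
    by (intro ftCk_SucI[of w]) (auto intro: covector_fields_mono)
qed

declare ftCk.simps(2) [simp del]

lemma ftCk_imp_continuous_on: "ftCk k S f \<Longrightarrow> continuous_on S f"
proof (induct k)
  case (Suc k)
  then show ?case using ftCk_SucD by blast
qed simp

lemma ftCk_cong:
  assumes "open S" "ftCk k S f" "\<And>x. x \<in> S \<Longrightarrow> f x = g x"
  shows "ftCk k S g"
proof (cases k)
  case 0
  then show ?thesis using assms continuous_on_cong by force
next
  case (Suc j)
  from assms(2)[unfolded Suc] obtain w where w: "w \<in> covector_fields {d. ftCk j S d}"
    "\<And>x. x \<in> S \<Longrightarrow> (f has_derivative w x) (at x)" unfolding ftCk.simps by blast
  have "(g has_derivative w x) (at x)" if "x \<in> S" for x
    by (rule has_derivative_transform_within_open[OF w(2)[OF that] assms(1) that]) (rule assms(3))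
  with w(1) show ?thesis unfolding Suc by (rule ftCk_SucI)
qed

lemma ftCk_const: "ftCk k S (\<lambda>x. c)"
proof (cases k)
  case (Suc j)
  show ?thesis unfolding Suc by (rule ftCk_SucI[OF covector_fields.zero]) simp
qed simp

lemma ftCk_bounded_linear:
  assumes "bounded_linear l"
  shows "ftCk k S l"
proof (cases k)
  case 0
  then show ?thesis using assms by (simp add: linear_continuous_on)
next
  case (Suc j)
  have "(\<lambda>x v. l v * 1) \<in> covector_fields {d. ftCk j S d}"
    by (intro covector_fields_single assms) (simp add: ftCk_const)
  moreover have "\<forall>x\<in>S. (l has_derivative (\<lambda>v. l v * 1)) (at x)"
    using assms bounded_linear_imp_has_derivative by auto
  ultimately show ?thesis unfolding Suc by (intro ftCk_SucI) auto
qed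

lemma ftCk_add: "ftCk k S f \<Longrightarrow> ftCk k S g \<Longrightarrow> ftCk k S (\<lambda>x. f x + g x)"
proof (cases k)
  case 0
  assume "ftCk k S f" "ftCk k S g"
  then show ?thesis using 0 by (auto intro: continuous_intros)
next
  case (Suc j)
  assume "ftCk k S f" "ftCk k S g"
  then obtain w1 w2 where
    "w1 \<in> covector_fields {d. ftCk j S d}" "\<And>x. x \<in> S \<Longrightarrow> (f has_derivative w1 x) (at x)"
    "w2 \<in> covector_fields {d. ftCk j S d}" "\<And>x. x \<in> S \<Longrightarrow> (g has_derivative w2 x) (at x)"
    unfolding Suc ftCk.simps by blast
  then show ?thesis unfolding Suc
    by (intro ftCk_SucI[of "\<lambda>x v. w1 x v + w2 x v"] covector_fields_add)
      (auto intro!: has_derivative_add)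
qed

lemma ftCk_mult: "ftCk k S f \<Longrightarrow> ftCk k S g \<Longrightarrow> ftCk k S (\<lambda>x. f x * g x)"
proof (induct k arbitrary: f g)
  case 0
  then show ?case by (auto intro: continuous_intros)
next
  case (Suc k)
  then obtain w1 w2 where w:
    "w1 \<in> covector_fields {d. ftCk k S d}" "\<And>x. x \<in> S \<Longrightarrow> (f has_derivative w1 x) (at x)"
    "w2 \<in> covector_fields {d. ftCk k S d}" "\<And>x. x \<in> S \<Longrightarrow> (g has_derivative w2 x) (at x)"
    unfolding ftCk.simps by blast
  have fg: "ftCk k S f" "ftCk k S g" using Suc.prems ftCk_SucD by auto
  have "(\<lambda>x v. f x * w2 x v + g x * w1 x v) \<in> covector_fields {d. ftCk k S d}"
    using fg by (intro covector_fields_add covector_fields_scale[OF w(1)] covector_fields_scale[OF w(3)])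
      (auto intro: Suc.hyps)
  moreover have "((\<lambda>x. f x * g x) has_derivative (\<lambda>v. f x * w2 x v + g x * w1 x v)) (at x)"
    if "x \<in> S" for x
    using has_derivative_mult[OF w(2)[OF that] w(4)[OF that]] by (simp add: mult.commute)
  ultimately show ?case by (rule ftCk_SucI)
qed

lemma ftCk_scale: "ftCk k S f \<Longrightarrow> ftCk k S (\<lambda>x. c * f x)"
  by (intro ftCk_mult ftCk_const)

lemma ftCk_uminus: "ftCk k S f \<Longrightarrow> ftCk k S (\<lambda>x. - f x)"
  using ftCk_scale[of k S f "-1"] by simp

lemma ftCk_diff: "ftCk k S f \<Longrightarrow> ftCk k S g \<Longrightarrow> ftCk k S (\<lambda>x. f x - g x)"
  using ftCk_add[OF _ ftCk_uminus] by simp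

lemma ftCk_sum: "finite I \<Longrightarrow> (\<And>i. i \<in> I \<Longrightarrow> ftCk k S (f i)) \<Longrightarrow> ftCk k S (\<lambda>x. \<Sum>i\<in>I. f i x)"
  by (induct I rule: finite_induct) (auto intro: ftCk_add ftCk_const)

lemma ftCk_power: "ftCk k S f \<Longrightarrow> ftCk k S (\<lambda>x. f x ^ n)"
  by (induct n) (auto intro: ftCk_mult ftCk_const)

text \<open>
  The derivative is \<open>a * f powr (a - 1)\<close> times that of \<open>f\<close>, so an induction over the order for all
  exponents at once covers square roots, cube roots and inverses.
\<close>
lemma ftCk_powr:
  "ftCk k S f \<Longrightarrow> (\<And>x. x \<in> S \<Longrightarrow> f x > 0) \<Longrightarrow> ftCk k S (\<lambda>x. f x powr a)"
proof (induct k arbitrary: a)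
  case 0
  then have "\<forall>x\<in>S. f x \<noteq> 0" by fastforce
  with 0 show ?case by (auto intro!: continuous_on_powr continuous_on_const)
next
  case (Suc k)
  from Suc.prems(1) obtain w where w: "w \<in> covector_fields {d. ftCk k S d}"
    "\<And>x. x \<in> S \<Longrightarrow> (f has_derivative w x) (at x)"
    unfolding ftCk.simps by blast 
  have "ftCk k S (\<lambda>x. a * f x powr (a - 1))"
    using Suc ftCk_SucD by (intro ftCk_scale) blast
  then have "(\<lambda>x v. (a * f x powr (a - 1)) * w x v) \<in> covector_fields {d. ftCk k S d}"
    by (intro covector_fields_scale[OF w(1)]) (auto intro: ftCk_mult)
  moreover have "((\<lambda>x. f x powr a) has_derivative (\<lambda>v. (a * f x powr (a - 1)) * w x v)) (at x)"
    if "x \<in> S" for x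
  proof -
    have "((\<lambda>y. y powr a) has_real_derivative a * f x powr (a - 1)) (at (f x))"
      using Suc.prems(2)[OF that] by (intro has_real_derivative_powr)
    then have "((\<lambda>y. y powr a) has_derivative (*) (a * f x powr (a - 1))) (at (f x))"
      by (simp add: has_field_derivative_def)
    from has_derivative_compose[OF w(2)[OF that] this] show ?thesis .
  qed
  ultimately show ?case by (rule ftCk_SucI)
qed

text \<open>
  The hypothesis on \<open>g\<close> concerns only its compositions with functionals. In this way \<open>g\<close> may have
  components such as the projection to the parameter space, whose derivative has infinite rank.
\<close>
lemma ftCk_compose:
  fixes g :: "'a::real_normed_vector \<Rightarrow> 'b::real_normed_vector"
  assumes "ftCk k S f" "\<forall>a\<in>T. g differentiable (at a)"
    "\<And>l. bounded_linear l \<Longrightarrow> ftCk k T (\<lambda>a. l (g a))" "g ` T \<subseteq> S"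
  shows "ftCk k T (\<lambda>a. f (g a))"
  using assms(1,3)
proof (induct k arbitrary: f)
  case 0
  have "continuous_on T g"
    using assms(2) by (simp add: continuous_at_imp_continuous_on differentiable_imp_continuous_within)
  then show ?case using 0 assms(4) continuous_on_compose2 by auto
next
  case (Suc k)
  let ?C = "{d. ftCk k S d}" and ?D = "{d. ftCk k T d}"
  let ?g' = "\<lambda>a. frechet_derivative g (at a)"
  have g': "(g has_derivative ?g' a) (at a)" if "a \<in> T" for a
    using assms(2) that frechet_derivative_works by blast
  have lg: "ftCk k T (\<lambda>a. l (g a))" if "bounded_linear l" for l
    using Suc.prems(2)[OF that] ftCk_SucD by blast
  from Suc.prems(1) obtain w where w: "w \<in> covector_fields ?C"
    "\<And>x. x \<in> S \<Longrightarrow> (f has_derivative w x) (at x)" unfolding ftCk.simps by blast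
  from w(1) have exW: "\<exists>W\<in>covector_fields ?D. \<forall>a\<in>T. \<forall>v. W a v = w (g a) (?g' a v)"
  proof induct
    case zero
    then show ?case by (intro bexI[OF _ covector_fields.zero]) simp
  next
    case (plus l d w)
    from plus obtain W where W: "W \<in> covector_fields ?D"
      "\<And>a v. a\<in>T \<Longrightarrow> W a v = w (g a) (?g' a v)" by blast
    from Suc.prems(2)[OF plus(1)] obtain V where V: "V \<in> covector_fields ?D"
      "\<And>a. a \<in> T \<Longrightarrow> ((\<lambda>a. l (g a)) has_derivative V a) (at a)" unfolding ftCk.simps by blast
    have V': "V a = (\<lambda>v. l (?g' a v))" if "a \<in> T" for a
      using has_derivative_unique[OF V(2)[OF that]
          bounded_linear.has_derivative[OF plus(1) g'[OF that]]] by simp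
    have "ftCk k T (\<lambda>a. d (g a))"
    proof (rule Suc.hyps)
      show "ftCk k S d" using plus(2) by simp
    qed (rule lg)
    then have "(\<lambda>a v. d (g a) * V a v + W a v) \<in> covector_fields ?D"
      by (intro covector_fields_add covector_fields_scale[OF V(1)] W(1)) (simp add: ftCk_mult)
    moreover have "\<forall>a\<in>T. \<forall>v. d (g a) * V a v + W a v
        = l (?g' a v) * d (g a) + w (g a) (?g' a v)"
      using V' W(2) by simp
    ultimately show ?case
      by (intro bexI[of _ "\<lambda>a v. d (g a) * V a v + W a v"]) simp_all
  qed
  from exW obtain W where W: "W \<in> covector_fields ?D"
      "\<And>a v. a\<in>T \<Longrightarrow> W a v = w (g a) (?g' a v)" by blast
  have "((\<lambda>a. f (g a)) has_derivative W a) (at a)" if "a \<in> T" for a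
  proof -
    have "W a = (\<lambda>v. w (g a) (?g' a v))" using W(2)[OF that] by auto
    moreover have "g a \<in> S" using assms(4) that by auto
    ultimately show ?thesis
      using has_derivative_compose[OF g'[OF that] w(2)] by simp
  qed
  with W(1) show ?case by (rule ftCk_SucI)
qed

lemma ftCk_dir_deriv:
  assumes "open S" "ftCk (Suc k) S f"
  shows "ftCk k S (dir_deriv v f)"
proof -
  from assms obtain w where w: "w \<in> covector_fields {d. ftCk k S d}"
    "\<And>x. x \<in> S \<Longrightarrow> (f has_derivative w x) (at x)" unfolding ftCk.simps by blast
  from w(1) have "ftCk k S (\<lambda>x. w x v)"
    by induct (auto intro: ftCk_const ftCk_add ftCk_scale)
  moreover have "w x v = dir_deriv v f x" if "x \<in> S" for x
    using frechet_derivative_at[OF w(2)[OF that]] by (simp add: dir_deriv_def)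
  ultimately show ?thesis using ftCk_cong[OF assms(1)] by blast
qed

lemma dir_derivI: "(f has_derivative f') (at x) \<Longrightarrow> dir_deriv v f x = f' v"
  using frechet_derivative_at by (fastforce simp: dir_deriv_def)

definition smooth_germ :: "('a::real_normed_vector \<Rightarrow> real) \<Rightarrow> 'a \<Rightarrow> bool"
  where "smooth_germ f a \<longleftrightarrow> (\<exists>U. open U \<and> a \<in> U \<and> (\<forall>k. ftCk k U f))"

text \<open>
  Smoothness tested by functionals, as needed for \<open>ftCk_compose\<close>; differentiability is added because
  such a test does not imply it in infinite dimension.
\<close>
definition smooth_map_germ ::
    "('a::real_normed_vector \<Rightarrow> 'b::real_normed_vector) \<Rightarrow> 'a \<Rightarrow> bool"
  where "smooth_map_germ g a \<longleftrightarrow> (\<exists>U. open U \<and> a \<in> U \<and> (\<forall>x\<in>U. g differentiable (at x)) \<and>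
    (\<forall>l k. bounded_linear l \<longrightarrow> ftCk k U (\<lambda>x. l (g x))))"

lemma smooth_germI: "open U \<Longrightarrow> a \<in> U \<Longrightarrow> (\<And>k. ftCk k U f) \<Longrightarrow> smooth_germ f a"
  unfolding smooth_germ_def by blast

lemma smooth_germE:
  assumes "smooth_germ f a"
  obtains U where "open U" "a \<in> U" "\<And>k. ftCk k U f"
  using assms unfolding smooth_germ_def by auto

lemma smooth_map_germE:
  assumes "smooth_map_germ g a"
  obtains U where "open U" "a \<in> U" "\<And>x. x \<in> U \<Longrightarrow> g differentiable (at x)"
    "\<And>l k. bounded_linear l \<Longrightarrow> ftCk k U (\<lambda>x. l (g x))"
  using assms unfolding smooth_map_germ_def by auto

lemma ftCk_Int1: "ftCk k S f \<Longrightarrow> ftCk k (S \<inter> T) f"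
  by (rule ftCk_mono) auto

lemma ftCk_Int2: "ftCk k T f \<Longrightarrow> ftCk k (S \<inter> T) f"
  by (rule ftCk_mono) auto

lemma smooth_germ_ball:
  assumes "smooth_germ f a"
  obtains r where "r > 0" "\<And>k. ftCk k (ball a r) f"
  using assms unfolding smooth_germ_def by (metis ftCk_mono open_contains_ball)

lemma smooth_germ_2:
  assumes "smooth_germ f a" "smooth_germ g a"
  obtains U where "open U" "a \<in> U" "\<And>k. ftCk k U f" "\<And>k. ftCk k U g"
proof -
  from assms obtain U V where "open U" "a \<in> U" "\<And>k. ftCk k U f" "open V" "a \<in> V" "\<And>k. ftCk k V g"
    unfolding smooth_germ_def by blast
  then show ?thesis by (intro that[of "U \<inter> V"]) (auto intro: ftCk_Int1 ftCk_Int2)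
qed

lemma smooth_germ_const: "smooth_germ (\<lambda>x. c) a"
  by (rule smooth_germI[OF open_UNIV]) (simp_all add: ftCk_const)

lemma smooth_germ_bounded_linear: "bounded_linear l \<Longrightarrow> smooth_germ l a"
  by (rule smooth_germI[OF open_UNIV]) (simp_all add: ftCk_bounded_linear)

lemma smooth_germ_add:
  "smooth_germ f a \<Longrightarrow> smooth_germ g a \<Longrightarrow> smooth_germ (\<lambda>x. f x + g x) a"
  by (erule (1) smooth_germ_2, erule (1) smooth_germI) (simp add: ftCk_add)

lemma smooth_germ_mult:
  "smooth_germ f a \<Longrightarrow> smooth_germ g a \<Longrightarrow> smooth_germ (\<lambda>x. f x * g x) a"
  by (erule (1) smooth_germ_2, erule (1) smooth_germI) (simp add: ftCk_mult)

lemma smooth_germ_diff: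
  "smooth_germ f a \<Longrightarrow> smooth_germ g a \<Longrightarrow> smooth_germ (\<lambda>x. f x - g x) a"
  by (erule (1) smooth_germ_2, erule (1) smooth_germI) (simp add: ftCk_diff)

lemma smooth_germ_uminus: "smooth_germ f a \<Longrightarrow> smooth_germ (\<lambda>x. - f x) a"
  unfolding smooth_germ_def using ftCk_uminus by blast

lemma smooth_germ_power: "smooth_germ f a \<Longrightarrow> smooth_germ (\<lambda>x. f x ^ n) a"
  unfolding smooth_germ_def using ftCk_power by blast

lemma smooth_germ_sum:
  "finite I \<Longrightarrow> (\<And>i. i \<in> I \<Longrightarrow> smooth_germ (f i) a) \<Longrightarrow> smooth_germ (\<lambda>x. \<Sum>i\<in>I. f i x) a"
  by (induct I rule: finite_induct) (auto intro: smooth_germ_add smooth_germ_const)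

lemma smooth_germ_continuous: "smooth_germ f a \<Longrightarrow> isCont f a"
  unfolding smooth_germ_def using ftCk_imp_continuous_on continuous_on_eq_continuous_at by metis

lemma smooth_germ_differentiable: "smooth_germ f a \<Longrightarrow> f differentiable (at a)"
  unfolding smooth_germ_def using ftCk_Suc_imp_differentiable by blast

lemma smooth_germ_has_derivative:
  "smooth_germ f a \<Longrightarrow> (f has_derivative (\<lambda>v. dir_deriv v f a)) (at a)"
  using smooth_germ_differentiable frechet_derivative_works by (fastforce simp: dir_deriv_def)

lemma smooth_germ_eventually: "smooth_germ f a \<Longrightarrow> \<forall>\<^sub>F x in nhds a. smooth_germ f x"
  unfolding smooth_germ_def eventually_nhds by blast

lemma smooth_germ_cong:
  assumes "\<forall>\<^sub>F x in nhds a. f x = g x" "smooth_germ f a"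
  shows "smooth_germ g a"
proof -
  from assms obtain U V where *: "open U" "a \<in> U" "\<And>k. ftCk k U f"
    "open V" "a \<in> V" "\<And>x. x \<in> V \<Longrightarrow> f x = g x"
    unfolding smooth_germ_def eventually_nhds by blast
  then have "ftCk k (U \<inter> V) g" for k
    by (intro ftCk_cong[of _ k f g]) (auto intro: ftCk_Int1 ftCk_Int2)
  with * show ?thesis by (intro smooth_germI[of "U \<inter> V"]) auto
qed

lemma smooth_germ_powr:
  assumes "smooth_germ f a" "f a > 0"
  shows "smooth_germ (\<lambda>x. f x powr c) a"
proof -
  from assms obtain U where U: "open U" "a \<in> U" "\<And>k. ftCk k U f" unfolding smooth_germ_def by blast
  define V where "V = U \<inter> f -` {0<..}"
  have "continuous_on U f" using U(3)[of 0] by simp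
  then have "open V" unfolding V_def by (rule continuous_open_preimage) (use U in auto)
  then show ?thesis using U assms(2)
    by (intro smooth_germI[of V] ftCk_powr) (auto simp: V_def intro: ftCk_Int1)
qed

lemma smooth_germ_dir_deriv: "smooth_germ f a \<Longrightarrow> smooth_germ (dir_deriv v f) a"
  unfolding smooth_germ_def using ftCk_dir_deriv by blast

lemma smooth_map_germ_imp_germ:
  "smooth_map_germ g a \<Longrightarrow> bounded_linear l \<Longrightarrow> smooth_germ (\<lambda>x. l (g x)) a"
  unfolding smooth_map_germ_def smooth_germ_def by blast

lemma smooth_map_germ_differentiable: "smooth_map_germ g a \<Longrightarrow> g differentiable (at a)"
  unfolding smooth_map_germ_def by blast

lemma smooth_map_germ_eventually:
  assumes "smooth_map_germ f a"
  shows "\<forall>\<^sub>F x in nhds a. smooth_map_germ f x"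
proof -
  from assms obtain U where U: "open U" "a \<in> U" and *: "(\<forall>x\<in>U. f differentiable (at x)) \<and>
    (\<forall>l k. bounded_linear l \<longrightarrow> ftCk k U (\<lambda>x. l (f x)))"
    unfolding smooth_map_germ_def by auto
  from * have "smooth_map_germ f x" if "x \<in> U" for x
    unfolding smooth_map_germ_def using U(1) that by (intro exI[of _ U]) simp
  with U show ?thesis unfolding eventually_nhds by auto
qed

lemma smooth_map_germ_has_derivative:
  "smooth_map_germ f a \<Longrightarrow> (f has_derivative (\<lambda>v. dir_deriv v f a)) (at a)"
  using smooth_map_germ_differentiable frechet_derivative_works by (fastforce simp: dir_deriv_def)

lemma smooth_map_germ_continuous: "smooth_map_germ f a \<Longrightarrow> isCont f a"
  using smooth_map_germ_differentiable differentiable_imp_continuous_within by blast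

lemma smooth_map_germ_bounded_linear: "bounded_linear g \<Longrightarrow> smooth_map_germ g a"
  unfolding smooth_map_germ_def
  by (intro exI[of _ UNIV])
    (auto intro: ftCk_bounded_linear bounded_linear_compose bounded_linear_imp_differentiable)

lemma smooth_map_germ_const: "smooth_map_germ (\<lambda>x. c) a"
  unfolding smooth_map_germ_def by (intro exI[of _ UNIV]) (auto intro: ftCk_const)

lemma smooth_germ_compose:
  fixes g :: "'a::real_normed_vector \<Rightarrow> 'b::real_normed_vector"
  assumes "smooth_germ f (g a)" "smooth_map_germ g a"
  shows "smooth_germ (\<lambda>x. f (g x)) a"
proof -
  obtain T where T: "open T" "a \<in> T" "\<And>x. x\<in>T \<Longrightarrow> g differentiable (at x)"
    "\<And>l k. bounded_linear l \<Longrightarrow> ftCk k T (\<lambda>x. l (g x))"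
    using smooth_map_germE[OF assms(2)] by metis
  obtain S where S: "open S" "g a \<in> S" "\<And>k. ftCk k S f" using smooth_germE[OF assms(1)] by metis
  note * = S T(1-4)
  define V where "V = T \<inter> g -` S"
  have "continuous_on T g"
    using *(6) by (simp add: continuous_at_imp_continuous_on differentiable_imp_continuous_within)
  then have "open V" unfolding V_def by (rule continuous_open_preimage) (use * in auto)
  moreover have "ftCk k V (\<lambda>x. f (g x))" for k
    by (rule ftCk_compose[of k S]) (use * in \<open>auto simp: V_def intro: ftCk_Int1\<close>)
  ultimately show ?thesis using * by (intro smooth_germI[of V]) (auto simp: V_def)
qed

lemma smooth_map_germ_compose:
  fixes g :: "'a::real_normed_vector \<Rightarrow> 'b::real_normed_vector"
  assumes "smooth_map_germ f (g a)" "smooth_map_germ g a"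
  shows "smooth_map_germ (\<lambda>x. f (g x)) a"
proof -
  obtain T where T: "open T" "a \<in> T" "\<And>x. x\<in>T \<Longrightarrow> g differentiable (at x)"
    "\<And>l k. bounded_linear l \<Longrightarrow> ftCk k T (\<lambda>x. l (g x))"
    using smooth_map_germE[OF assms(2)] by metis
  obtain S where S: "open S" "g a \<in> S" "\<And>x. x\<in>S \<Longrightarrow> f differentiable (at x)"
    "\<And>l k. bounded_linear l \<Longrightarrow> ftCk k S (\<lambda>x. l (f x))"
    using smooth_map_germE[OF assms(1)] by metis
  note * = S(1-2) T S(3-4)
  define V where "V = T \<inter> g -` S"
  have "continuous_on T g"
    using *(5) by (simp add: continuous_at_imp_continuous_on differentiable_imp_continuous_within)
  then have "open V" unfolding V_def by (rule continuous_open_preimage) (use * in auto)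
  moreover have "ftCk k V (\<lambda>x. l (f (g x)))" if "bounded_linear l" for k l
    by (rule ftCk_compose[of k S "\<lambda>x. l (f x)"]) (use * that in \<open>auto simp: V_def intro: ftCk_Int1\<close>)
  moreover have "(\<lambda>x. f (g x)) differentiable (at x)" if "x \<in> V" for x
    using differentiable_chain_at[OF *(5) *(7), of x] that by (simp add: V_def o_def)
  ultimately show ?thesis using * unfolding smooth_map_germ_def
    by (intro exI[of _ V]) (auto simp: V_def)
qed

lemma smooth_map_germ_euclideanI:
  fixes g :: "'a::real_normed_vector \<Rightarrow> 'b::euclidean_space"
  assumes "\<And>b. b \<in> Basis \<Longrightarrow> smooth_germ (\<lambda>x. g x \<bullet> b) a"
  shows "smooth_map_germ g a"
proof -
  from assms obtain U where U: "\<And>b. b \<in> Basis \<Longrightarrow> open (U b) \<and> a \<in> U b \<and> (\<forall>k. ftCk k (U b) (\<lambda>x. g x \<bullet> b))"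
    unfolding smooth_germ_def by metis
  define V where "V = (\<Inter>b\<in>Basis. U b)"
  have V: "open V" "a \<in> V" using U by (auto simp: V_def)
  have C: "ftCk k V (\<lambda>x. g x \<bullet> b)" if "b \<in> Basis" for k b
    using U[OF that] that by (intro ftCk_mono[of k "U b" _ V]) (auto simp: V_def)
  have "ftCk k V (\<lambda>x. l (g x))" if "bounded_linear l" for k l
  proof -
    have "l (g x) = (\<Sum>b\<in>Basis. l b * (g x \<bullet> b))" for x
    proof -
      have "l (g x) = l (\<Sum>b\<in>Basis. (g x \<bullet> b) *\<^sub>R b)" by (simp add: euclidean_representation)
      also have "\<dots> = (\<Sum>b\<in>Basis. l b * (g x \<bullet> b))"
        using bounded_linear.linear[OF that]
        by (simp add: linear_sum linear_cmul mult.commute)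
      finally show ?thesis .
    qed
    then show ?thesis by (simp add: ftCk_sum ftCk_scale C)
  qed
  moreover have "g differentiable (at x)" if "x \<in> V" for x
    using differentiable_componentwise_within[of g x UNIV] ftCk_Suc_imp_differentiable[OF C that] by simp
  ultimately show ?thesis using V unfolding smooth_map_germ_def by auto
qed

lemma smooth_map_germ_realI: "smooth_germ f a \<Longrightarrow> smooth_map_germ f a"
  by (intro smooth_map_germ_euclideanI) simp

lemma smooth_map_germ_cartI:
  fixes g :: "'a::real_normed_vector \<Rightarrow> real^'n"
  assumes "\<And>i. smooth_germ (\<lambda>x. g x $ i) a"
  shows "smooth_map_germ g a"
  using assms by (intro smooth_map_germ_euclideanI) (auto simp: Basis_vec_def inner_axis)

lemma smooth_map_germ_Pair:
  assumes "smooth_map_germ f a" "smooth_map_germ g a"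
  shows "smooth_map_germ (\<lambda>x. (f x, g x)) a"
proof -
  obtain T where T: "open T" "a \<in> T" "\<And>x. x\<in>T \<Longrightarrow> g differentiable (at x)"
    "\<And>l k. bounded_linear l \<Longrightarrow> ftCk k T (\<lambda>x. l (g x))"
    using smooth_map_germE[OF assms(2)] by metis
  obtain S where S: "open S" "a \<in> S" "\<And>x. x\<in>S \<Longrightarrow> f differentiable (at x)"
    "\<And>l k. bounded_linear l \<Longrightarrow> ftCk k S (\<lambda>x. l (f x))"
    using smooth_map_germE[OF assms(1)] by metis
  note * = S(1-2) T S(3-4)
  have "ftCk k (S \<inter> T) (\<lambda>x. l (f x, g x))" if l: "bounded_linear l" for l :: "_ \<Rightarrow> real" and k
  proof -
    have 1: "bounded_linear (\<lambda>x. l (x, 0))" "bounded_linear (\<lambda>x. l (0, x))"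
      by (intro bounded_linear_compose[OF l] bounded_linear_Pair
          bounded_linear_ident bounded_linear_zero)+
    have "l (f x, g x) = l (f x, 0) + l (0, g x)" for x
      using linear_add[OF bounded_linear.linear[OF l], of "(f x, 0)" "(0, g x)"] by simp
    then show ?thesis using ftCk_mono[OF *(8)[OF 1(1)]] ftCk_mono[OF *(6)[OF 1(2)]]
      by (simp add: ftCk_add)
  qed
  moreover have "(\<lambda>x. (f x, g x)) differentiable (at x)" if "x \<in> S \<inter> T" for x
    using *(5)[of x] *(7)[of x] that unfolding differentiable_def by (blast intro: has_derivative_Pair)
  ultimately show ?thesis unfolding smooth_map_germ_def
    by (intro exI[of _ "S \<inter> T"]) (auto simp: *)
qed

section \<open>Comparison with the classes C^k\<close>

lemma Ck_on_cong:
  assumes "open S" "Ck_on k S f" "\<And>x. x \<in> S \<Longrightarrow> f x = g x"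
  shows "Ck_on k S g"
  using assms(2,3)
proof (induct k arbitrary: f g)
  case 0
  then show ?case using continuous_on_cong[of S S f g] by simp
next
  case (Suc k)
  have der: "(g has_derivative f') (at x)" if "x \<in> S" "(f has_derivative f') (at x)" for x f'
    by (rule has_derivative_transform_within_open[OF that(2) assms(1) that(1)]) (rule Suc.prems(2))
  have gdiff: "g differentiable (at x)" if "x \<in> S" for x
  proof -
    from Suc.prems(1) that obtain D where "(f has_derivative D) (at x)"
      by (auto simp: differentiable_def)
    from der[OF that this] show ?thesis by (auto simp: differentiable_def)
  qed
  have eq: "dir_deriv v f x = dir_deriv v g x" if "x \<in> S" for v x
  proof -
    have "f differentiable (at x)" using Suc.prems(1) that by simp
    then have "(f has_derivative frechet_derivative f (at x)) (at x)"
      using frechet_derivative_works by blast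
    from dir_derivI[OF this] dir_derivI[OF der[OF that this]] show ?thesis by simp
  qed
  have "Ck_on k S (dir_deriv v g)" for v
    by (rule Suc.hyps[of "dir_deriv v f"]) (use Suc.prems(1) eq in simp_all)
  then show ?case using gdiff by simp
qed

text \<open>
  The components suffice for a finite-dimensional target; the domain is arbitrary, so this also applies to
  maps of the unfolding parameters.
\<close>
lemma ftCk_imp_Ck_on:
  fixes f :: "'a::real_normed_vector \<Rightarrow> 'b::euclidean_space"
  assumes "open S" "\<And>b. b \<in> Basis \<Longrightarrow> ftCk k S (\<lambda>x. f x \<bullet> b)"
  shows "Ck_on k S f"
  using assms(2)
proof (induct k arbitrary: f)
  case 0
  then show ?case using continuous_on_componentwise by auto
next
  case (Suc k)
  have d: "f differentiable (at x)" if "x \<in> S" for x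
    using differentiable_componentwise_within[of f x UNIV] Suc.prems ftCk_Suc_imp_differentiable that
    by blast
  have "Ck_on k S (dir_deriv v f)" for v
  proof (rule Suc.hyps)
    fix b :: 'b assume b: "b \<in> Basis"
    have "dir_deriv v (\<lambda>x. f x \<bullet> b) x = dir_deriv v f x \<bullet> b" if "x \<in> S" for x
    proof -
      have "(f has_derivative frechet_derivative f (at x)) (at x)"
        using d[OF that] frechet_derivative_works by blast
      from dir_derivI[OF has_derivative_inner_left[OF this]] show ?thesis
        by (simp add: dir_deriv_def)
    qed
    then show "ftCk k S (\<lambda>x. dir_deriv v f x \<bullet> b)"
      by (rule ftCk_cong[OF assms(1) ftCk_dir_deriv[OF assms(1) Suc.prems[OF b]]])
  qed
  with d show ?case by simp
qed

lemma smooth_map_germ_imp_smooth_at: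
  fixes f :: "'a::real_normed_vector \<Rightarrow> 'b::euclidean_space"
  assumes "smooth_map_germ f a"
  shows "smooth_at f a"
proof -
  obtain U where *: "open U" "a \<in> U" "\<And>l k. bounded_linear l \<Longrightarrow> ftCk k U (\<lambda>x. l (f x))"
    using smooth_map_germE[OF assms] by metis
  then have "Ck_on k U f" for k
    by (intro ftCk_imp_Ck_on) (auto intro: bounded_linear_inner_left)
  with * show ?thesis unfolding smooth_at_def by blast
qed

lemma Ck_on_inner:
  fixes f :: "'a::real_normed_vector \<Rightarrow> 'b::euclidean_space"
  assumes "open S" "Ck_on k S f"
  shows "Ck_on k S (\<lambda>x. f x \<bullet> c)"
  using assms(2)
proof (induct k arbitrary: f)
  case 0
  then show ?case by (auto intro: continuous_intros)
next
  case (Suc k)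
  have der: "(f has_derivative frechet_derivative f (at x)) (at x)" if "x \<in> S" for x
    using that Suc.prems frechet_derivative_works by auto
  note der' = has_derivative_inner_left[OF der, of _ c]
  have "Ck_on k S (dir_deriv v (\<lambda>x. f x \<bullet> c))" for v
  proof (rule Ck_on_cong[OF assms(1)])
    show "Ck_on k S (\<lambda>x. dir_deriv v f x \<bullet> c)" using Suc by simp
    show "dir_deriv v f x \<bullet> c = dir_deriv v (\<lambda>x. f x \<bullet> c) x" if "x \<in> S" for x
      using dir_derivI[OF der'[OF that]] by (simp add: dir_deriv_def)
  qed
  with der' show ?case unfolding Ck_on.simps differentiable_def by blast
qed

lemma frechet_derivative_translation_invariant:
  fixes f :: "'a::real_normed_vector \<Rightarrow> 'b::real_normed_vector"
  assumes "\<And>y. f (y + c) = f y"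
  shows "frechet_derivative f (at (a + c)) = frechet_derivative f (at a)"
proof -
  have 1: "(f has_derivative f') (at a)" if "(f has_derivative f') (at (a + c))" for f' a
  proof -
    have "((\<lambda>y. y + c) has_derivative (\<lambda>v. v)) (at a)" by (auto intro!: derivative_eq_intros)
    from has_derivative_compose[OF this that] show ?thesis using assms by simp
  qed
  have 2: "(f has_derivative f') (at (a + c))" if "(f has_derivative f') (at a)" for f'
  proof -
    have inv: "f (y - c) = f y" for y using assms[of "y - c"] by simp
    have "((\<lambda>y. y - c) has_derivative (\<lambda>v. v)) (at (a + c))" by (auto intro!: derivative_eq_intros)
    moreover have "(f has_derivative f') (at ((a + c) - c))" using that by simp
    ultimately have "((\<lambda>y. f (y - c)) has_derivative f') (at (a + c))"
      by (rule has_derivative_compose)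
    then show ?thesis using inv by simp
  qed
  from 1 2 have "(\<lambda>f'. (f has_derivative f') (at (a + c))) = (\<lambda>f'. (f has_derivative f') (at a))"
    by blast
  then show ?thesis unfolding frechet_derivative_def by simp
qed

text \<open>
  If \<open>f\<close> factors through the finitely many coordinates \<open>l i\<close> then its derivative kills their common
  kernel, so it equals \<open>\<Sum> l i v * dir_deriv (b i) f x\<close> for a dual family \<open>b\<close>. The coefficients again
  factor through the \<open>l i\<close>, because \<open>f\<close> is invariant under translations by the common kernel.
\<close>
lemma Ck_on_imp_ftCk:
  fixes f :: "'a::real_normed_vector \<Rightarrow> real" and l :: "'i \<Rightarrow> 'a \<Rightarrow> real"
  assumes "open S" "finite I" and l: "\<And>i. i \<in> I \<Longrightarrow> bounded_linear (l i)"
    and dual: "\<And>i j. i \<in> I \<Longrightarrow> j \<in> I \<Longrightarrow> l i (b j) = (if i = j then 1 else 0)"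
    and "Ck_on k S f" "\<And>x y. (\<And>i. i \<in> I \<Longrightarrow> l i x = l i y) \<Longrightarrow> f x = f y"
  shows "ftCk k S f"
  using assms(5,6)
proof (induct k arbitrary: f)
  case (Suc k)
  have lin: "linear (l i)" if "i \<in> I" for i using l[OF that] bounded_linear.linear by blast
  have inv: "f (y + c) = f y" if "\<And>i. i \<in> I \<Longrightarrow> l i c = 0" for y c
    using that linear_add[OF lin] by (intro Suc.prems(2)) simp
  have der: "(f has_derivative frechet_derivative f (at x)) (at x)" if "x \<in> S" for x
    using that Suc.prems(1) frechet_derivative_works by auto
  have ker: "frechet_derivative f (at x) u = 0" if "x \<in> S" "\<And>i. i \<in> I \<Longrightarrow> l i u = 0" for x u
  proof -
    have "((\<lambda>h. x + h *\<^sub>R u) has_derivative (\<lambda>h. h *\<^sub>R u)) (at (0::real))"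
      by (auto intro!: derivative_eq_intros)
    moreover have "(f has_derivative frechet_derivative f (at x)) (at (x + 0 *\<^sub>R u))"
      using der[OF that(1)] by simp
    ultimately have "((\<lambda>h. f (x + h *\<^sub>R u)) has_derivative (\<lambda>h. frechet_derivative f (at x) (h *\<^sub>R u)))
        (at (0::real))" by (rule has_derivative_compose)
    moreover have "f (x + h *\<^sub>R u) = f x" for h
      using that(2) linear_cmul[OF lin] by (intro inv) simp
    ultimately have "((\<lambda>h. f x) has_derivative (\<lambda>h. frechet_derivative f (at x) (h *\<^sub>R u)))
        (at (0::real))" by simp
    from fun_cong[OF has_derivative_unique[OF this has_derivative_const], of 1]
    show ?thesis by simp
  qed
  have D: "frechet_derivative f (at x) = (\<lambda>v. \<Sum>i\<in>I. l i v * dir_deriv (b i) f x)" if "x \<in> S" for x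
  proof
    fix v
    let ?p = "\<Sum>j\<in>I. l j v *\<^sub>R b j"
    interpret D: linear "frechet_derivative f (at x)"
      using der[OF that] has_derivative_linear by blast
    have "l i (v - ?p) = 0" if "i \<in> I" for i
    proof -
      have "l i ?p = (\<Sum>j\<in>I. l j v * (if i = j then 1 else 0))"
        using dual[OF that] by (simp add: linear_sum[OF lin[OF that]] linear_cmul[OF lin[OF that]])
      also have "\<dots> = l i v" using that assms(2) by (simp add: if_distrib cong: if_cong)
      finally show ?thesis by (simp add: linear_diff[OF lin[OF that]])
    qed
    then have "frechet_derivative f (at x) (v - ?p) = 0" using ker[OF that] by blast
    then have "frechet_derivative f (at x) v = frechet_derivative f (at x) ?p" by (simp add: D.diff)
    also have "\<dots> = (\<Sum>i\<in>I. l i v * dir_deriv (b i) f x)"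
      by (simp add: D.sum D.scale dir_deriv_def)
    finally show "frechet_derivative f (at x) v = (\<Sum>i\<in>I. l i v * dir_deriv (b i) f x)" .
  qed
  have "ftCk k S (dir_deriv v f)" for v
  proof (rule Suc.hyps)
    show "Ck_on k S (dir_deriv v f)" using Suc.prems(1) by simp
    show "dir_deriv v f x = dir_deriv v f y" if "\<And>i. i \<in> I \<Longrightarrow> l i x = l i y" for x y
    proof -
      have "frechet_derivative f (at (x + (y - x))) = frechet_derivative f (at x)"
        using that by (intro frechet_derivative_translation_invariant inv)
          (simp add: linear_diff[OF lin])
      then show ?thesis by (simp add: dir_deriv_def)
    qed
  qed
  then have "(\<lambda>x v. \<Sum>i\<in>I. l i v * dir_deriv (b i) f x) \<in> covector_fields {d. ftCk k S d}"
    by (intro covector_fields_sum covector_fields_single assms l) auto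
  moreover have "(f has_derivative (\<lambda>v. \<Sum>i\<in>I. l i v * dir_deriv (b i) f x)) (at x)" if "x \<in> S" for x
    using der[OF that] D[OF that] by simp
  ultimately show ?case by (rule ftCk_SucI)
next
  case 0
  from 0(1) show ?case by simp
qed

lemma smooth_at_imp_smooth_map_germ:
  fixes f :: "'a::euclidean_space \<Rightarrow> 'b::euclidean_space"
  assumes "smooth_at f a"
  shows "smooth_map_germ f a"
proof (rule smooth_map_germ_euclideanI)
  fix b :: 'b
  from assms obtain U where U: "open U" "a \<in> U" "\<And>k. Ck_on k U f" unfolding smooth_at_def by blast
  have "ftCk k U (\<lambda>x. f x \<bullet> b)" for k
  proof (rule Ck_on_imp_ftCk[where I = Basis and l = "\<lambda>i x. x \<bullet> i" and b = "\<lambda>i. i"])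
    show "Ck_on k U (\<lambda>x. f x \<bullet> b)" by (rule Ck_on_inner) (use U in auto)
    show "f x \<bullet> b = f y \<bullet> b" if "\<And>i. i \<in> Basis \<Longrightarrow> x \<bullet> i = y \<bullet> i" for x y
      using euclidean_eqI[of x y] that by simp
  qed (auto simp: U inner_Basis bounded_linear_inner_left)
  with U show "smooth_germ (\<lambda>x. f x \<bullet> b) a" by (intro smooth_germI)
qed

lemma norm_lookup_le:
  fixes t :: "'i \<Rightarrow>\<^sub>0 real"
  shows "\<bar>Poly_Mapping.lookup t i\<bar> \<le> norm t"
proof (cases "i \<in> Poly_Mapping.keys t")
  case True
  then show ?thesis
    using member_le_sum[of i "Poly_Mapping.keys t" "\<lambda>n. \<bar>Poly_Mapping.lookup t n\<bar>"]
    by (simp add: norm_poly_mapping_def dist_poly_mapping_def)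
qed (simp add: in_keys_iff)

lemma lookup_scaleR: "Poly_Mapping.lookup (r *\<^sub>R (t :: 'i \<Rightarrow>\<^sub>0 real)) i = r * Poly_Mapping.lookup t i"
proof -
  have "finite {i. r *\<^sub>R Poly_Mapping.lookup t i \<noteq> 0}"
    by (rule finite_subset[OF _ finite_keys[of t]]) (auto simp: in_keys_iff)
  then show ?thesis by (simp add: scaleR_poly_mapping_def Abs_poly_mapping_inverse)
qed

lemma bounded_linear_lookup: "bounded_linear (\<lambda>t :: 'i \<Rightarrow>\<^sub>0 real. Poly_Mapping.lookup t i)"
  by (rule bounded_linear_intro[of _ 1]) (simp_all add: lookup_add lookup_scaleR norm_lookup_le)

text \<open>
  A family with \<open>s\<close> parameters factors through a basis of the space variables and the first \<open>s\<close>
  coordinates of the parameter.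
\<close>
lemma smooth_at_imp_smooth_germ_params:
  fixes G :: "'a::euclidean_space \<times> params \<Rightarrow> real"
  assumes "smooth_at G a" "depends_on_first s (\<lambda>t x. G (x, t))"
  shows "smooth_germ G a"
proof -
  from assms obtain U where U: "open U" "a \<in> U" "\<And>k. Ck_on k U G" unfolding smooth_at_def by blast
  define I where "I = (Basis :: 'a set) <+> {..<s}"
  define l :: "'a + nat \<Rightarrow> 'a \<times> params \<Rightarrow> real"
    where "l i = (case i of Inl b \<Rightarrow> (\<lambda>x. fst x \<bullet> b) | Inr n \<Rightarrow> (\<lambda>x. Poly_Mapping.lookup (snd x) n))" for i
  define b :: "'a + nat \<Rightarrow> 'a \<times> params"
    where "b i = (case i of Inl b \<Rightarrow> (b, 0) | Inr n \<Rightarrow> (0, Poly_Mapping.single n 1))" for i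
  have "ftCk k U G" for k
  proof (rule Ck_on_imp_ftCk[where I = I and l = l and b = b])
    show "finite I" by (simp add: I_def)
    show "bounded_linear (l i)" for i
      by (auto simp: l_def split: sum.split
          intro!: bounded_linear_compose[OF bounded_linear_inner_left bounded_linear_fst]
            bounded_linear_compose[OF bounded_linear_lookup bounded_linear_snd])
    show "l i (b j) = (if i = j then 1 else 0)" if "i \<in> I" "j \<in> I" for i j
      using that by (auto simp: l_def b_def I_def inner_Basis lookup_single when_def split: sum.splits)
    show "G x = G y" if "\<And>i. i \<in> I \<Longrightarrow> l i x = l i y" for x y
    proof -
      have "fst x = fst y"
      proof (rule euclidean_eqI)
        fix c :: 'a assume "c \<in> Basis"
        then show "fst x \<bullet> c = fst y \<bullet> c" using that[of "Inl c"] by (simp add: I_def l_def InlI)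
      qed
      moreover have "\<forall>i<s. Poly_Mapping.lookup (snd x) i = Poly_Mapping.lookup (snd y) i"
      proof (intro allI impI)
        fix n assume "n < s"
        then show "Poly_Mapping.lookup (snd x) n = Poly_Mapping.lookup (snd y) n"
          using that[of "Inr n"] by (simp add: I_def l_def InrI)
      qed
      ultimately show ?thesis
        using assms(2) unfolding depends_on_first_def by (metis prod.collapse)
    qed
  qed (use U in auto)
  with U show ?thesis by (intro smooth_germI)
qed

section \<open>Inverting a function of one real variable with parameters\<close>

lemma covector_fields_pullback:
  assumes "w \<in> covector_fields C" "bounded_linear m" "\<And>d. d \<in> C \<Longrightarrow> (\<lambda>a. d (g a)) \<in> D"
  shows "(\<lambda>a v. w (g a) (m v)) \<in> covector_fields D"
  using assms(1)
proof induct
  case zero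
  show ?case by (rule covector_fields.zero)
next
  case (plus l d w)
  show ?case
    by (rule covector_fields.plus[OF bounded_linear_compose[OF plus(1) assms(2)] assms(3)[OF plus(2)] plus(4)])
qed

lemma bounded_linear_Pair0:
  "bounded_linear (\<lambda>v. (v, 0))" "bounded_linear (\<lambda>v. (0, v))"
  by (intro bounded_linear_Pair bounded_linear_ident bounded_linear_zero)+

lemma has_derivative_fst_line:
  assumes "(F has_derivative F') (at (z, p))"
  shows "((\<lambda>z. F (z, p)) has_real_derivative F' (1, 0)) (at (z::real))"
proof -
  have "((\<lambda>z. (z, p)) has_derivative (\<lambda>v. (v, 0))) (at z)"
    by (auto intro!: derivative_eq_intros)
  from has_derivative_compose[OF this assms]
  have "((\<lambda>z. F (z, p)) has_derivative (\<lambda>v. F' (v, 0))) (at z)" .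
  moreover have "(\<lambda>v. F' (v, 0)) = (*) (F' (1, 0))"
  proof
    show "F' (v, 0) = F' (1, 0) * v" for v
      using linear_cmul[OF has_derivative_linear[OF assms], of v "(1, 0)"] by simp
  qed
  ultimately show ?thesis unfolding has_field_derivative_def by simp
qed

text \<open>
  For fixed \<open>p\<close> the function \<open>F (_, p)\<close> is strictly increasing on a common interval, so \<open>Q (u, p)\<close> exists
  by the intermediate value theorem and is unique, and monotonicity gives its continuity. The map
  \<open>(u, p) \<mapsto> (Q (u, p), p)\<close> inverts \<open>(z, p) \<mapsto> (F (z, p), p)\<close>, which yields the derivative of \<open>Q\<close>. It is an
  expression in \<open>Q\<close> and the derivative of \<open>F\<close>, so one more order of smoothness is gained at each step. Only
  the order of the real line is used, so \<open>p\<close> may range over any normed space.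
\<close>
lemma local_inverse_first_pos:
  fixes F :: "real \<times> 'p::real_normed_vector \<Rightarrow> real"
  assumes sm: "smooth_germ F (0, 0)" and F0: "F (0, 0) = 0" and pos: "dir_deriv (1, 0) F (0, 0) > 0"
  obtains Q :: "real \<times> 'p \<Rightarrow> real" where "smooth_germ Q (0, 0)" "Q (0, 0) = 0"
    "\<forall>\<^sub>F x in nhds (0, 0). F (Q x, snd x) = fst x"
    "\<forall>\<^sub>F x in nhds (0, 0). Q (F x, snd x) = fst x"
proof -
  let ?Fz = "dir_deriv (1, 0) F"
  obtain r1 where r1: "r1 > 0" "\<And>k. ftCk k (ball (0, 0) r1) F"
    using smooth_germ_ball[OF sm] by metis
  have "isCont ?Fz (0, 0)" by (intro smooth_germ_continuous smooth_germ_dir_deriv sm)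
  then have "\<forall>\<^sub>F x in nhds (0, 0). ?Fz x > 0"
    unfolding isCont_def tendsto_at_iff_tendsto_nhds by (rule order_tendstoD(1)) (rule pos)
  then obtain r2 where r2: "r2 > 0" "\<And>x. x \<in> ball (0, 0) r2 \<Longrightarrow> ?Fz x > 0"
    unfolding eventually_nhds_metric by (metis dist_commute mem_ball)
  define r where "r = min r1 r2"
  define a where "a = r / 2"
  have a: "a > 0" "r > 0" using r1 r2 by (auto simp: a_def r_def)
  define B where "B = ball (0 :: real \<times> 'p) r"
  have F: "ftCk k B F" for k
    by (rule ftCk_mono[OF r1(2)]) (auto simp: B_def r_def zero_prod_def)
  have Fz: "?Fz x > 0" if "x \<in> B" for x
    using r2(2)[of x] that by (auto simp: B_def r_def zero_prod_def)
  have B: "(z, p) \<in> B" if "\<bar>z\<bar> \<le> a" "norm p < a" for z p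
    unfolding B_def mem_ball_0 using norm_Pair_le[of z p] that by (simp add: a_def)
  have "open B" by (simp add: B_def)
  have F': "(F has_derivative (\<lambda>v. dir_deriv v F x)) (at x)" if "x \<in> B" for x
    by (rule smooth_germ_has_derivative[OF smooth_germI[OF \<open>open B\<close> that F]])
  have contF: "isCont F x" if "x \<in> B" for x using F'[OF that] has_derivative_continuous by blast
  have mono: "F (z1, p) < F (z2, p)" if "norm p < a" "-a \<le> z1" "z1 < z2" "z2 \<le> a" for z1 z2 p
  proof (rule DERIV_pos_imp_increasing[OF that(3)])
    fix x assume x: "z1 \<le> x" "x \<le> z2"
    then have "(x, p) \<in> B" using that by (intro B) auto
    from has_derivative_fst_line[OF F'[OF this]] Fz[OF this]
    show "\<exists>y. ((\<lambda>z. F (z, p)) has_real_derivative y) (at x) \<and> 0 < y" by blast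
  qed
  have contp: "isCont (\<lambda>x. F (z, snd x)) y" if "\<bar>z\<bar> \<le> a" "norm (snd y) < a" for z and y :: "real \<times> 'p"
    by (rule isCont_o2[where f = "\<lambda>x. (z, snd x)" and g = F])
      (use contF[OF B[OF that]] in \<open>auto intro!: continuous_intros\<close>)
  \<comment> \<open>The pairs \<open>(u, p)\<close> for which \<open>u\<close> lies strictly between the values of \<open>F (_, p)\<close> at the ends of the interval.\<close>
  define T where "T = {x :: real \<times> 'p. norm (snd x) < a \<and> F (-a, snd x) < fst x \<and> fst x < F (a, snd x)}"
  have "open T"
  proof -
    define N where "N = {x :: real \<times> 'p. norm (snd x) < a}"
    have oN: "open N" unfolding N_def by (intro open_Collect_less continuous_intros)
    have c: "continuous_on N (\<lambda>x. F (z, snd x))" if "\<bar>z\<bar> \<le> a" for z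
      using contp[OF that] by (simp add: continuous_at_imp_continuous_on N_def)
    have "open (N \<inter> (\<lambda>x. fst x - F (-a, snd x)) -` {0<..})"
      by (intro continuous_open_preimage oN continuous_intros c) (use a in auto)
    moreover have "open (N \<inter> (\<lambda>x. F (a, snd x) - fst x) -` {0<..})"
      by (intro continuous_open_preimage oN continuous_intros c) (use a in auto)
    ultimately have "open ((N \<inter> (\<lambda>x. fst x - F (-a, snd x)) -` {0<..}) \<inter>
        (N \<inter> (\<lambda>x. F (a, snd x) - fst x) -` {0<..}))" by (rule open_Int)
    also have "\<dots> = T" by (auto simp: T_def N_def)
    finally show ?thesis .
  qed
  have T0: "(0, 0) \<in> T"
    using mono[of 0 "-a" 0] mono[of 0 0 a] a by (simp add: T_def F0)
  have "\<exists>z. -a < z \<and> z < a \<and> F (z, snd x) = fst x" if x: "x \<in> T" for x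
  proof -
    have n: "norm (snd x) < a" "F (-a, snd x) < fst x" "fst x < F (a, snd x)"
      using x by (auto simp: T_def)
    have "isCont (\<lambda>z. F (z, snd x)) z" if "\<bar>z\<bar> \<le> a" for z
      using contF[OF B[OF that n(1)]] by (intro isCont_o2[of z "\<lambda>z. (z, snd x)" F]) (auto intro!: continuous_intros)
    then have "\<exists>z\<ge>-a. z \<le> a \<and> F (z, snd x) = fst x"
      using n a by (intro IVT) auto
    then show ?thesis using n by (metis less_le not_less)
  qed
  then obtain Q where Q: "\<And>x. x \<in> T \<Longrightarrow> -a < Q x \<and> Q x < a \<and> F (Q x, snd x) = fst x" by metis
  have TN: "norm (snd x) < a" if "x \<in> T" for x using that by (simp add: T_def)
  have QB: "(Q x, snd x) \<in> B" if "x \<in> T" for x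
    using Q[OF that] TN[OF that] by (intro B) auto
  have uniq: "z = z'" if "F (z, p) = F (z', p)" "norm p < a" "\<bar>z\<bar> \<le> a" "\<bar>z'\<bar> \<le> a" for z z' p
  proof (rule ccontr)
    assume "z \<noteq> z'"
    then consider "z < z'" | "z' < z" by linarith
    then show False
    proof cases
      case 1
      then show ?thesis using mono[OF that(2) _ 1] that by (simp add: abs_le_iff)
    next
      case 2
      then show ?thesis using mono[OF that(2) _ 2] that by (simp add: abs_le_iff)
    qed
  qed
  have QF: "Q (F (z, p), p) = z" if "\<bar>z\<bar> < a" "norm p < a" for z p
  proof -
    have "(F (z, p), p) \<in> T" using that mono[of p "-a" z] mono[of p z a] by (auto simp: T_def)
    from Q[OF this] have "-a < Q (F (z, p), p)" "Q (F (z, p), p) < a" "F (Q (F (z, p), p), p) = F (z, p)"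
      by auto
    then show ?thesis using uniq[OF _ that(2), of "Q (F (z, p), p)" z] that(1) by (auto simp: abs_le_iff abs_less_iff)
  qed
  have contQ: "isCont Q x" if "x \<in> T" for x
    unfolding isCont_def
  proof (rule order_tendstoI)
    have evT: "\<forall>\<^sub>F y in at x. y \<in> T"
      using \<open>open T\<close> that by (rule eventually_at_in_open')
    fix b
    {
      assume "b < Q x"
      define b' where "b' = max b (-a)"
      have b': "\<bar>b'\<bar> \<le> a" "b' \<le> a" "-a \<le> b'" "b' < Q x" using Q[OF that] \<open>b < Q x\<close> by (auto simp: b'_def)
      have "F (b', snd x) < fst x" using mono[of "snd x" b' "Q x"] Q[OF that] TN[OF that] b' by auto
      moreover have "isCont (\<lambda>y. fst y - F (b', snd y)) x"
        by (intro continuous_intros contp b'(1) TN that)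
      ultimately have "\<forall>\<^sub>F y in at x. fst y - F (b', snd y) > 0"
        unfolding isCont_def by (intro order_tendstoD(1)) auto
      with evT show "\<forall>\<^sub>F y in at x. b < Q y"
      proof eventually_elim
        case (elim y)
        have "b' < Q y"
        proof (rule ccontr)
          assume "\<not> b' < Q y"
          then have "Q y < b' \<or> Q y = b'" by auto
          then show False using mono[of "snd y" "Q y" b'] Q[OF elim(1)] TN[OF elim(1)] b' elim(2) by auto
        qed
        then show ?case by (simp add: b'_def)
      qed
    next
      assume "b > Q x"
      define b' where "b' = min b a"
      have b': "\<bar>b'\<bar> \<le> a" "b' \<le> a" "-a \<le> b'" "b' > Q x" using Q[OF that] \<open>b > Q x\<close> by (auto simp: b'_def)
      have "F (b', snd x) > fst x" using mono[of "snd x" "Q x" b'] Q[OF that] TN[OF that] b' by auto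
      moreover have "isCont (\<lambda>y. F (b', snd y) - fst y) x"
        by (intro continuous_intros contp b'(1) TN that)
      ultimately have "\<forall>\<^sub>F y in at x. F (b', snd y) - fst y > 0"
        unfolding isCont_def by (intro order_tendstoD(1)) auto
      with evT show "\<forall>\<^sub>F y in at x. Q y < b"
      proof eventually_elim
        case (elim y)
        have "b' > Q y"
        proof (rule ccontr)
          assume "\<not> b' > Q y"
          then have "Q y > b' \<or> Q y = b'" by auto
          then show False using mono[of "snd y" b' "Q y"] Q[OF elim(1)] TN[OF elim(1)] b' elim(2) by auto
        qed
        then show ?case by (simp add: b'_def)
      qed
    }
  qed
  have derQ: "(Q has_derivative
      (\<lambda>v. inverse (?Fz (Q x, snd x)) * (fst v - dir_deriv (0, snd v) F (Q x, snd x)))) (at x)"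
    if x: "x \<in> T" for x
  proof -
    let ?y = "(Q x, snd x)"
    note y = QB[OF x]
    have lin: "linear (\<lambda>v. dir_deriv v F ?y)" using F'[OF y] has_derivative_linear by blast
    have "((\<lambda>x. (F x, snd x)) has_derivative (\<lambda>v. (dir_deriv v F ?y, snd v))) (at ?y)"
      using F'[OF y] by (auto intro!: derivative_eq_intros)
    moreover have "bounded_linear (\<lambda>v :: real \<times> 'p. (inverse (?Fz ?y) * (fst v - dir_deriv (0, snd v) F ?y), snd v))"
    proof -
      have "bounded_linear (\<lambda>v. dir_deriv v F ?y)" using F'[OF y] has_derivative_bounded_linear by blast
      from bounded_linear_compose[OF this bounded_linear_compose[OF bounded_linear_Pair0(2) bounded_linear_snd]]
      show ?thesis
        by (intro bounded_linear_Pair bounded_linear_snd bounded_linear_const_mult bounded_linear_sub bounded_linear_fst) simp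
    qed
    moreover have "(\<lambda>v. (inverse (?Fz ?y) * (fst v - dir_deriv (0, snd v) F ?y), snd v)) \<circ>
        (\<lambda>v. (dir_deriv v F ?y, snd v)) = id"
    proof
      fix v :: "real \<times> 'p"
      have "dir_deriv v F ?y = dir_deriv (fst v, 0) F ?y + dir_deriv (0, snd v) F ?y"
        using linear_add[OF lin, of "(fst v, 0)" "(0, snd v)"] by simp
      moreover have "dir_deriv (fst v, 0) F ?y = fst v * ?Fz ?y"
        using linear_cmul[OF lin, of "fst v" "(1, 0)"] by simp
      ultimately show "((\<lambda>v. (inverse (?Fz ?y) * (fst v - dir_deriv (0, snd v) F ?y), snd v)) \<circ>
        (\<lambda>v. (dir_deriv v F ?y, snd v))) v = id v"
        using Fz[OF y] by (simp add: prod_eq_iff)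
    qed
    moreover have "isCont (\<lambda>x. (Q x, snd x)) x" by (intro continuous_intros contQ x)
    ultimately have "((\<lambda>x. (Q x, snd x)) has_derivative
        (\<lambda>v. (inverse (?Fz ?y) * (fst v - dir_deriv (0, snd v) F ?y), snd v))) (at x)"
      by (rule has_derivative_inverse_basic[OF _ _ _ _ \<open>open T\<close> x]) (use Q in auto)
    from has_derivative_fst[OF this] show ?thesis by simp
  qed
  have "ftCk k T Q" for k
  proof (induct k)
    case 0
    then show ?case using contQ by (simp add: continuous_at_imp_continuous_on)
  next
    case (Suc k)
    have dg: "\<forall>x\<in>T. (\<lambda>x. (Q x, snd x)) differentiable (at x)"
      unfolding differentiable_def
      using has_derivative_Pair[OF derQ has_derivative_snd[OF has_derivative_ident]] by blast
    have comp: "ftCk k T (\<lambda>x. d (Q x, snd x))" if "ftCk k B d" for d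
    proof (rule ftCk_compose[OF that dg])
      show "ftCk k T (\<lambda>x. l (Q x, snd x))" if l: "bounded_linear l" for l :: "_ \<Rightarrow> real"
      proof -
        have "l (Q x, snd x) = l (1, 0) * Q x + l (0, snd x)" for x
          using linear_add[OF bounded_linear.linear[OF l], of "(Q x, 0)" "(0, snd x)"]
            linear_cmul[OF bounded_linear.linear[OF l], of "Q x" "(1, 0)"] by simp
        moreover have "ftCk k T (\<lambda>x. l (1, 0) * Q x + l (0, snd x))"
          by (intro ftCk_add ftCk_scale Suc ftCk_bounded_linear
              bounded_linear_compose[OF l] bounded_linear_compose[OF bounded_linear_Pair0(2)] bounded_linear_snd)
        ultimately show ?thesis by simp
      qed
    qed (use QB in auto)
    obtain w where w: "w \<in> covector_fields {d. ftCk k B d}"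
      "\<And>x. x \<in> B \<Longrightarrow> (F has_derivative w x) (at x)"
      using F[of "Suc k"] unfolding ftCk.simps by auto
    let ?D = "{d. ftCk k T d}"
    let ?W = "\<lambda>x v. inverse (?Fz (Q x, snd x)) * (fst v * 1 + (-1) * w (Q x, snd x) (0, snd v))"
    have "ftCk k T (\<lambda>x. ?Fz (Q x, snd x) powr (-1))"
      by (intro ftCk_powr comp ftCk_dir_deriv F \<open>open B\<close>) (use Fz QB in auto)
    then have inv: "ftCk k T (\<lambda>x. inverse (?Fz (Q x, snd x)))"
      by (rule ftCk_cong[OF \<open>open T\<close>]) (use Fz[OF QB] in \<open>simp add: powr_minus less_imp_le\<close>)
    have "(\<lambda>x v. w (Q x, snd x) (0, snd v)) \<in> covector_fields ?D"
      by (rule covector_fields_pullback[OF w(1) bounded_linear_compose[OF bounded_linear_Pair0(2) bounded_linear_snd]])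
        (use comp in auto)
    then have "(\<lambda>x v. (-1) * w (Q x, snd x) (0, snd v)) \<in> covector_fields ?D"
      by (rule covector_fields_scale) (use ftCk_scale in blast)
    moreover have "(\<lambda>x v :: real \<times> 'p. fst v * 1) \<in> covector_fields ?D"
      by (rule covector_fields_single) (auto simp: ftCk_const bounded_linear_fst)
    ultimately have "(\<lambda>x v. fst v * 1 + (-1) * w (Q x, snd x) (0, snd v)) \<in> covector_fields ?D"
      by (rule covector_fields_add[rotated])
    then have "?W \<in> covector_fields ?D"
      by (rule covector_fields_scale) (use inv ftCk_mult in blast)
    moreover have "(Q has_derivative ?W x) (at x)" if "x \<in> T" for x
    proof -
      have "w (Q x, snd x) v = dir_deriv v F (Q x, snd x)" for v
        using dir_derivI[OF w(2)[OF QB[OF that]]] by simp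
      then show ?thesis using derQ[OF that] by simp
    qed
    ultimately show ?case by (rule ftCk_SucI)
  qed
  then have smQ: "smooth_germ Q (0, 0)" using \<open>open T\<close> T0 by (intro smooth_germI)
  moreover have "Q (0, 0) = 0" using QF[of 0 0] a F0 by simp
  moreover have "\<forall>\<^sub>F x in nhds (0, 0). F (Q x, snd x) = fst x"
    using Q \<open>open T\<close> T0 unfolding eventually_nhds by blast
  moreover have "\<forall>\<^sub>F x in nhds (0, 0). Q (F x, snd x) = fst x"
  proof -
    have "open {x :: real \<times> 'p. \<bar>fst x\<bar> < a \<and> norm (snd x) < a}"
      by (intro open_Collect_conj open_Collect_less continuous_intros)
    moreover have "Q (F x, snd x) = fst x" if "\<bar>fst x\<bar> < a" "norm (snd x) < a" for x
      using QF[OF that] by simp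
    ultimately show ?thesis unfolding eventually_nhds using a(1)
      by (intro exI[of _ "{x :: real \<times> 'p. \<bar>fst x\<bar> < a \<and> norm (snd x) < a}"]) auto
  qed
  ultimately show ?thesis by (rule that)
qed

section \<open>Hadamard's lemma with parameters\<close>

abbreviation shrink :: "real \<Rightarrow> real \<times> 'p::real_normed_vector \<Rightarrow> real \<times> 'p"
  where "shrink s x \<equiv> (s * fst x, snd x)"

text \<open>
  The remainder in Hadamard's lemma is the moment of order 0 of a partial derivative. Higher moments occur
  because each derivative in the direction of the first variable brings out another factor \<open>s\<close>.
\<close>
definition moment :: "nat \<Rightarrow> (real \<times> 'p::real_normed_vector \<Rightarrow> real) \<Rightarrow> real \<times> 'p \<Rightarrow> real"
  where "moment m F x = integral {0..1} (\<lambda>s. s ^ m * F (shrink s x))"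

lemma norm_shrink_le: "s \<in> {0..1} \<Longrightarrow> norm (shrink s x) \<le> norm x"
proof -
  assume s: "s \<in> {0..1}"
  have "(s * fst x)\<^sup>2 \<le> (fst x)\<^sup>2"
    using s by (simp add: power_mult_distrib mult_left_le_one_le power_le_one)
  then have "sqrt ((s * fst x)\<^sup>2 + (norm (snd x))\<^sup>2) \<le> sqrt ((fst x)\<^sup>2 + (norm (snd x))\<^sup>2)"
    by simp
  then show ?thesis by (simp add: norm_prod_def)
qed

lemma shrink_ball: "x \<in> ball 0 r \<Longrightarrow> s \<in> {0..1} \<Longrightarrow> shrink s x \<in> ball 0 r"
  using norm_shrink_le[of s x] unfolding mem_ball_0 by linarith

lemma continuous_shrink:
  assumes "continuous_on (ball 0 r) d"
  shows "continuous_on (ball (0 :: real \<times> 'p::real_normed_vector) r \<times> {0..1::real}) (\<lambda>(x, s). d (shrink s x))"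
  unfolding split_beta
  by (rule continuous_on_compose2[OF assms]) (auto intro!: continuous_intros shrink_ball)

lemma has_integral_moment:
  assumes "continuous_on (ball 0 r) d" "x \<in> ball 0 r"
  shows "((\<lambda>s. s ^ m * d (shrink s x)) has_integral moment m d x) {0..1}"
proof -
  have "continuous_on {0..1::real} (\<lambda>s. d (shrink s x))"
    by (rule continuous_on_compose2[OF assms(1)]) (use shrink_ball[OF assms(2)] in \<open>auto intro!: continuous_intros\<close>)
  then have "(\<lambda>s. s ^ m * d (shrink s x)) integrable_on {0..1}"
    by (intro integrable_continuous_real continuous_intros)
  then show ?thesis unfolding moment_def by (rule integrable_integral)
qed

text \<open>
  Because \<open>l (s * z, v) = s * l (z, 0) + l (0, v)\<close>, integrating a covector field along the segments
  yields a covector field whose coefficients are moments of order \<open>m + 1\<close> and \<open>m\<close>.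
\<close>
lemma covector_fields_has_integral_moment:
  fixes w :: "real \<times> 'p::real_normed_vector \<Rightarrow> real \<times> 'p \<Rightarrow> real"
  assumes "w \<in> covector_fields C" "\<And>d. d \<in> C \<Longrightarrow> continuous_on (ball 0 r) d"
    and CD: "\<And>d m. d \<in> C \<Longrightarrow> moment m d \<in> D"
  shows "\<exists>W\<in>covector_fields D. \<forall>x\<in>ball 0 r. \<forall>v.
      ((\<lambda>s. s ^ m * w (shrink s x) (shrink s v)) has_integral W x v) {0..1}"
  using assms(1)
proof induct
  case zero
  have "\<forall>x\<in>ball 0 r. \<forall>v. ((\<lambda>s::real. s ^ m * 0) has_integral 0) {0..1}" by simp
  then show ?case by (rule bexI[OF _ covector_fields.zero])
next
  case (plus l d w)
  from plus(4) obtain W where W: "W \<in> covector_fields D" "\<And>x v. x\<in>ball 0 r \<Longrightarrow>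
      ((\<lambda>s. s ^ m * w (shrink s x) (shrink s v)) has_integral W x v) {0..1}" by blast
  have lin: "linear l" using plus(1) bounded_linear.linear by blast
  let ?W = "\<lambda>x v. l (fst v, 0) * moment (Suc m) d x + (l (0, snd v) * moment m d x + W x v)"
  have "?W \<in> covector_fields D"
    using W(1) CD[OF plus(2)]
    by (intro covector_fields.plus bounded_linear_compose[OF plus(1)]
        bounded_linear_compose[OF bounded_linear_Pair0(1)] bounded_linear_compose[OF bounded_linear_Pair0(2)]
        bounded_linear_fst bounded_linear_snd)
  moreover have "\<forall>x\<in>ball 0 r. \<forall>v.
      ((\<lambda>s. s ^ m * (l (shrink s v) * d (shrink s x) + w (shrink s x) (shrink s v))) has_integral ?W x v) {0..1}"
  proof (intro ballI allI)
    fix x v :: "real \<times> 'p" assume x: "x \<in> ball 0 r"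
    note c = assms(2)[OF plus(2)]
    have "((\<lambda>s. l (fst v, 0) * (s ^ Suc m * d (shrink s x)) + (l (0, snd v) * (s ^ m * d (shrink s x))
        + s ^ m * w (shrink s x) (shrink s v))) has_integral ?W x v) {0..1}"
      by (intro has_integral_add has_integral_mult_right has_integral_moment[OF c x] W x)
    moreover have "l (shrink s v) = s * l (fst v, 0) + l (0, snd v)" for s
      using linear_add[OF lin, of "(s * fst v, 0)" "(0, snd v)"] linear_cmul[OF lin, of s "(fst v, 0)"] by simp
    ultimately show "((\<lambda>s. s ^ m * (l (shrink s v) * d (shrink s x) + w (shrink s x) (shrink s v)))
        has_integral ?W x v) {0..1}" by (simp add: algebra_simps)
  qed
  ultimately show ?case by (intro bexI[of _ ?W]) auto
qed

text \<open>
  A covector field with continuous coefficients is continuous in operator norm, uniformly along the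
  segment of the points \<open>shrink s x0\<close>, by compactness of the unit interval.
\<close>
lemma covector_fields_uniformly_continuous:
  fixes w :: "real \<times> 'p::real_normed_vector \<Rightarrow> real \<times> 'p \<Rightarrow> real"
  assumes "w \<in> covector_fields C" "\<And>d. d \<in> C \<Longrightarrow> continuous_on (ball 0 r) d" "x0 \<in> ball 0 r"
  shows "\<forall>e>0. \<exists>X. open X \<and> x0 \<in> X \<and> (\<forall>x\<in>X \<inter> ball 0 r. \<forall>s\<in>{0..1}. \<forall>v.
      \<bar>w (shrink s x) v - w (shrink s x0) v\<bar> \<le> e * norm v)"
  using assms(1)
proof induct
  case zero
  show ?case by (intro allI impI exI[of _ UNIV]) auto
next
  case (plus l d w)
  show ?case
  proof (intro allI impI)
    fix e :: real assume e: "e > 0"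
    obtain K where K: "K > 0" "\<And>v. \<bar>l v\<bar> \<le> norm v * K"
      using bounded_linear.pos_bounded[OF plus(1)] by auto
    have "e / 2 > 0" "e / 2 / K > 0" using e K by auto
    from plus(4)[rule_format, OF this(1)] obtain X where X: "open X" "x0 \<in> X"
      "\<And>x s v. x\<in>X \<inter> ball 0 r \<Longrightarrow> s\<in>{0..1} \<Longrightarrow> \<bar>w (shrink s x) v - w (shrink s x0) v\<bar> \<le> e / 2 * norm v"
      by blast
    obtain Y where Y: "open Y" "x0 \<in> Y"
      "\<And>x s. x\<in>Y \<inter> ball 0 r \<Longrightarrow> s\<in>{0..1} \<Longrightarrow> \<bar>d (shrink s x) - d (shrink s x0)\<bar> \<le> e / 2 / K"
      using continuous_on_prod_compactE[OF continuous_shrink[OF assms(2)[OF plus(2)]] compact_Icc assms(3) \<open>e / 2 / K > 0\<close>]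
      unfolding split_beta fst_conv snd_conv dist_real_def by metis
    have "\<bar>l v * d (shrink s x) + w (shrink s x) v - (l v * d (shrink s x0) + w (shrink s x0) v)\<bar> \<le> e * norm v"
      if "x \<in> X \<inter> Y \<inter> ball 0 r" "s \<in> {0..1}" for x s v
    proof -
      have "\<bar>l v\<bar> * \<bar>d (shrink s x) - d (shrink s x0)\<bar> \<le> (norm v * K) * (e / 2 / K)"
        using K Y(3)[of x s] that by (intro mult_mono) auto
      also have "\<dots> = e / 2 * norm v" using K(1) by simp
      finally have "\<bar>l v * d (shrink s x) - l v * d (shrink s x0)\<bar> \<le> e / 2 * norm v"
        by (simp add: abs_mult flip: right_diff_distrib)
      moreover have "\<bar>w (shrink s x) v - w (shrink s x0) v\<bar> \<le> e / 2 * norm v"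
        using X(3)[of x s v] that by auto
      moreover have "e / 2 * norm v + e / 2 * norm v = e * norm v" by simp
      ultimately show ?thesis by linarith
    qed
    then show "\<exists>X. open X \<and> x0 \<in> X \<and> (\<forall>x\<in>X \<inter> ball 0 r. \<forall>s\<in>{0..1}. \<forall>v.
      \<bar>l v * d (shrink s x) + w (shrink s x) v - (l v * d (shrink s x0) + w (shrink s x0) v)\<bar> \<le> e * norm v)"
      using X Y by (intro exI[of _ "X \<inter> Y"] conjI open_Int ballI allI) auto
  qed
qed

lemma bounded_linear_shrink: "bounded_linear (shrink s)"
  by (intro bounded_linear_Pair bounded_linear_snd bounded_linear_const_mult bounded_linear_fst)

text \<open>
  Differentiation under the integral sign: the mean value inequality is applied for each \<open>s\<close>, and the
  uniform continuity of the covector field along the segment bounds all the remainders at once.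
\<close>
lemma ftCk_moment:
  fixes F :: "real \<times> 'p::real_normed_vector \<Rightarrow> real"
  assumes "ftCk k (ball 0 r) F"
  shows "ftCk k (ball 0 r) (moment m F)"
  using assms
proof (induct k arbitrary: F m)
  case 0
  then have "continuous_on (ball (0 :: real \<times> 'p) r \<times> {0..1::real}) (\<lambda>(x, s). s ^ m * F (shrink s x))"
    using continuous_shrink[of r F] unfolding split_beta by (auto intro!: continuous_intros)
  then have "continuous_on (ball 0 r) (\<lambda>x. integral (cbox 0 1) (\<lambda>s. s ^ m * F (shrink s x)))"
    by (intro integral_continuous_on_param) simp
  then show ?case by (simp add: moment_def[abs_def])
next
  case (Suc k)
  let ?B = "ball (0 :: real \<times> 'p) r"
  obtain w where w: "w \<in> covector_fields {d. ftCk k ?B d}"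
    "\<And>x. x \<in> ?B \<Longrightarrow> (F has_derivative w x) (at x)"
    using Suc.prems unfolding ftCk.simps by auto
  have cF: "continuous_on ?B F" by (rule ftCk_imp_continuous_on[OF Suc.prems])
  have cont: "continuous_on ?B d" if "d \<in> {d. ftCk k ?B d}" for d
    using that ftCk_imp_continuous_on by auto
  have "\<exists>W\<in>covector_fields {d. ftCk k ?B d}. \<forall>x\<in>?B. \<forall>v.
      ((\<lambda>s. s ^ m * w (shrink s x) (shrink s v)) has_integral W x v) {0..1}"
    by (rule covector_fields_has_integral_moment[OF w(1) cont]) (use Suc.hyps in simp_all)
  then obtain W where W: "W \<in> covector_fields {d. ftCk k ?B d}" "\<And>x v. x \<in> ?B \<Longrightarrow>
      ((\<lambda>s. s ^ m * w (shrink s x) (shrink s v)) has_integral W x v) {0..1}" by blast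
  have "(moment m F has_derivative W x) (at x)" if x: "x \<in> ?B" for x
    unfolding has_derivative_at_alt
  proof (intro conjI allI impI)
    show "bounded_linear (W x)" by (rule covector_fields_bounded_linear[OF W(1)])
    fix e :: real assume e: "e > 0"
    from covector_fields_uniformly_continuous[OF w(1) cont x] e
    obtain X where X: "open X" "x \<in> X" "\<And>y s v. y \<in> X \<inter> ?B \<Longrightarrow> s \<in> {0..1} \<Longrightarrow>
        \<bar>w (shrink s y) v - w (shrink s x) v\<bar> \<le> e * norm v" by metis
    have "open (X \<inter> ?B)" "x \<in> X \<inter> ?B" using X x by auto
    then obtain \<delta> where \<delta>: "\<delta> > 0" "ball x \<delta> \<subseteq> X \<inter> ?B" using open_contains_ball by metis
    have "norm (moment m F y - moment m F x - W x (y - x)) \<le> e * norm (y - x)" if y: "norm (y - x) < \<delta>" for y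
    proof -
      have yb: "y \<in> ball x \<delta>" using y by (simp add: dist_norm norm_minus_commute)
      then have yB: "y \<in> ?B" using \<delta> by blast
      let ?R = "\<lambda>s. s ^ m * F (shrink s y) - s ^ m * F (shrink s x) - s ^ m * w (shrink s x) (shrink s (y - x))"
      have "(?R has_integral (moment m F y - moment m F x - W x (y - x))) {0..1}"
        by (intro has_integral_diff has_integral_moment[OF cF] yB x W)
      moreover have "norm (?R s) \<le> e * norm (y - x)" if s: "s \<in> {0..1}" for s
      proof -
        let ?g' = "\<lambda>y v. w (shrink s y) (shrink s v)"
        have "norm (F (shrink s y) - F (shrink s x) - ?g' x (y - x)) \<le> norm (y - x) * e"
        proof (rule differentiable_bound_linearization[where S = "ball x \<delta>" and f = "\<lambda>y. F (shrink s y)" and f' = ?g'])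
          show "x + t *\<^sub>R (y - x) \<in> ball x \<delta>" if "t \<in> {0..1}" for t
          proof -
            have "\<bar>t\<bar> * norm (y - x) \<le> norm (y - x)" using that by (simp add: mult_left_le_one_le)
            then show ?thesis using y by (simp add: dist_norm)
          qed
          fix z assume "z \<in> ball x \<delta>"
          then have z: "z \<in> X \<inter> ?B" using \<delta> by blast
          have "((\<lambda>y. F (shrink s y)) has_derivative ?g' z) (at z)"
            using has_derivative_compose[OF bounded_linear_imp_has_derivative[OF bounded_linear_shrink]
                w(2)[OF shrink_ball[OF _ s]]] z by blast
          then show "((\<lambda>y. F (shrink s y)) has_derivative ?g' z) (at z within ball x \<delta>)"
            by (rule has_derivative_at_withinI)
          show "onorm (?g' z - ?g' x) \<le> e"
          proof (rule onorm_bound)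
            fix v
            have "\<bar>w (shrink s z) (shrink s v) - w (shrink s x) (shrink s v)\<bar> \<le> e * norm (shrink s v)"
              by (rule X(3)[OF z s])
            also have "\<dots> \<le> e * norm v" using e norm_shrink_le[OF s] by simp
            finally show "norm ((?g' z - ?g' x) v) \<le> e * norm v" by simp
          qed (use e in simp)
        qed (use \<delta> in auto)
        moreover have "norm (?R s) = s ^ m * norm (F (shrink s y) - F (shrink s x) - ?g' x (y - x))"
        proof -
          have "?R s = s ^ m * (F (shrink s y) - F (shrink s x) - ?g' x (y - x))"
            by (simp add: algebra_simps)
          then show ?thesis using s by (simp add: abs_mult)
        qed
        moreover have "s ^ m \<le> 1" "0 \<le> s ^ m" using s by (auto simp: power_le_one)
        ultimately show ?thesis
          by (metis (no_types, lifting) mult.commute mult_left_le_one_le norm_ge_zero order_trans)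
      qed
      ultimately have "norm (moment m F y - moment m F x - W x (y - x)) \<le> (e * norm (y - x)) * measure lborel {0..1::real}"
        using e by (intro has_integral_bound_real[of _ "{}" ?R]) auto
      then show ?thesis by simp
    qed
    with \<delta>(1) show "\<exists>d>0. \<forall>y. norm (y - x) < d \<longrightarrow>
        norm (moment m F y - moment m F x - W x (y - x)) \<le> e * norm (y - x)" by blast
  qed
  with W(1) show ?case by (rule ftCk_SucI)
qed

text \<open>
  \<open>F (z, p) = F (z, p) - F (0, p)\<close> is the integral of \<open>z * F_z (s z, p)\<close> over \<open>0 \<le> s \<le> 1\<close>.
\<close>
lemma hadamard_factor:
  fixes F :: "real \<times> 'p::real_normed_vector \<Rightarrow> real"
  assumes sm: "smooth_germ F (0, 0)" and F0: "\<forall>\<^sub>F p in nhds 0. F (0, p) = 0"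
  obtains K where "smooth_germ K (0, 0)" "\<forall>\<^sub>F x in nhds (0, 0). F x = fst x * K x"
proof -
  from smooth_germ_ball[OF sm] obtain r where r: "r > 0" "\<And>k. ftCk k (ball 0 r) F"
    unfolding zero_prod_def by metis
  let ?Fz = "dir_deriv (1, 0) F"
  have Fz: "ftCk k (ball 0 r) ?Fz" for k
    by (rule ftCk_dir_deriv) (use r in auto)
  define K where "K = moment 0 ?Fz"
  have smK: "smooth_germ K 0" unfolding K_def
    by (rule smooth_germI[OF open_ball _ ftCk_moment[OF Fz]]) (use r in simp)
  have eq: "F x - F (0, snd x) = fst x * K x" if x: "x \<in> ball 0 r" for x
  proof -
    have "((\<lambda>s. fst x * ?Fz (shrink s x)) has_integral (F (shrink 1 x) - F (shrink 0 x))) {0..1}"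
    proof (rule fundamental_theorem_of_calculus)
      fix s :: real assume s: "s \<in> {0..1}"
      have "smooth_germ F (shrink s x)"
        by (rule smooth_germI[of "ball 0 r"]) (use r shrink_ball[OF x s] in auto)
      from has_derivative_fst_line[OF smooth_germ_has_derivative[OF this]]
      have "((\<lambda>z. F (z, snd x)) has_real_derivative ?Fz (shrink s x)) (at (s * fst x))" .
      moreover have "((\<lambda>s. s * fst x) has_real_derivative fst x) (at s)"
        by (auto intro!: derivative_eq_intros)
      ultimately have "((\<lambda>s. F (shrink s x)) has_real_derivative ?Fz (shrink s x) * fst x) (at s)"
        by (rule DERIV_chain2)
      then show "((\<lambda>s. F (shrink s x)) has_vector_derivative fst x * ?Fz (shrink s x)) (at s within {0..1})"
        by (simp add: has_real_derivative_iff_has_vector_derivative mult.commute has_vector_derivative_at_within)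
    qed simp
    moreover have "((\<lambda>s. fst x * ?Fz (shrink s x)) has_integral fst x * K x) {0..1}"
      using has_integral_mult_right[OF has_integral_moment[OF ftCk_imp_continuous_on[OF Fz] x, of 0], of "fst x"]
      by (simp add: K_def)
    ultimately have "F (shrink 1 x) - F (shrink 0 x) = fst x * K x" by (rule has_integral_unique)
    then show ?thesis by simp
  qed
  have ev1: "\<forall>\<^sub>F x :: real \<times> 'p in nhds 0. F (0, snd x) = 0"
  proof -
    have "filterlim snd (nhds 0) (nhds (0 :: real \<times> 'p))"
      using isCont_snd[OF continuous_ident, of "0 :: real \<times> 'p"]
      unfolding isCont_def tendsto_at_iff_tendsto_nhds by simp
    from eventually_compose_filterlim[OF F0 this] show ?thesis .
  qed
  have ev2: "\<forall>\<^sub>F x in nhds (0 :: real \<times> 'p). x \<in> ball 0 r"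
    using r(1) by (intro eventually_nhds_in_open) auto
  from ev1 ev2 have "\<forall>\<^sub>F x in nhds 0. F x = fst x * K x"
  proof eventually_elim
    case (elim x)
    then show ?case using eq[of x] by simp
  qed
  with smK show ?thesis using that[of K] by (simp add: zero_prod_def)
qed

section \<open>Splitting off a square\<close>

lemma dir_deriv_cong:
  assumes "\<forall>\<^sub>F x in nhds a. f x = g x" "smooth_germ f a"
  shows "dir_deriv v f a = dir_deriv v g a"
proof -
  from assms(1) obtain U where U: "open U" "a \<in> U" "\<And>x. x \<in> U \<Longrightarrow> f x = g x"
    unfolding eventually_nhds by auto
  have "(g has_derivative (\<lambda>v. dir_deriv v f a)) (at a)"
    by (rule has_derivative_transform_within_open[OF smooth_germ_has_derivative[OF assms(2)] U])
  from dir_derivI[OF this] show ?thesis by simp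
qed

lemma dir_deriv_add:
  "smooth_germ f a \<Longrightarrow> smooth_germ g a \<Longrightarrow>
    dir_deriv v (\<lambda>x. f x + g x) a = dir_deriv v f a + dir_deriv v g a"
  by (rule dir_derivI[OF has_derivative_add[OF smooth_germ_has_derivative smooth_germ_has_derivative]])

lemma dir_deriv_mult:
  "smooth_germ f a \<Longrightarrow> smooth_germ g a \<Longrightarrow>
    dir_deriv v (\<lambda>x. f x * g x) a = f a * dir_deriv v g a + dir_deriv v f a * g a"
  by (rule dir_derivI[OF has_derivative_mult[OF smooth_germ_has_derivative smooth_germ_has_derivative]])

lemma dir_deriv_bounded_linear: "bounded_linear l \<Longrightarrow> dir_deriv v l a = l v"
  by (rule dir_derivI[OF bounded_linear_imp_has_derivative])

lemma dir_deriv_const: "dir_deriv v (\<lambda>x. c) a = 0"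
  by (rule dir_derivI) simp

lemma dir_deriv_compose:
  assumes "smooth_germ f (g a)" "smooth_map_germ g a"
  shows "dir_deriv v (\<lambda>x. f (g x)) a = dir_deriv (dir_deriv v g a) f (g a)"
  by (rule dir_derivI[OF has_derivative_compose[OF smooth_map_germ_has_derivative[OF assms(2)]
      smooth_germ_has_derivative[OF assms(1)]]])

lemma linear_dir_deriv: "smooth_germ f a \<Longrightarrow> linear (\<lambda>v. dir_deriv v f a)"
  using smooth_germ_has_derivative has_derivative_linear by blast

lemma dir_deriv_Pair_split:
  fixes f :: "real \<times> 'p::real_normed_vector \<Rightarrow> real"
  assumes "smooth_germ f a"
  shows "dir_deriv (r, w) f a = r * dir_deriv (1, 0) f a + dir_deriv (0, w) f a"
proof -
  have "dir_deriv (r *\<^sub>R (1, 0) + (0, w)) f a = r * dir_deriv (1, 0) f a + dir_deriv (0, w) f a"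
    using linear_add[OF linear_dir_deriv[OF assms], of "r *\<^sub>R (1, 0)" "(0, w)"]
      linear_cmul[OF linear_dir_deriv[OF assms], of r "(1, 0)"] by simp
  then show ?thesis by simp
qed

lemma dir_deriv_Pair:
  assumes "smooth_germ q a"
  shows "dir_deriv w (\<lambda>p. (q p, p)) a = (dir_deriv w q a, w)"
  by (rule dir_derivI[OF has_derivative_Pair[OF smooth_germ_has_derivative[OF assms] has_derivative_ident]])

lemma smooth_map_germ_ident: "smooth_map_germ (\<lambda>x. x) a"
  by (rule smooth_map_germ_bounded_linear[OF bounded_linear_ident])

lemma smooth_map_germ_fst: "smooth_map_germ fst a"
  by (rule smooth_map_germ_bounded_linear[OF bounded_linear_fst])

lemma smooth_map_germ_snd: "smooth_map_germ snd a"
  by (rule smooth_map_germ_bounded_linear[OF bounded_linear_snd])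

lemma smooth_germ_real_ident: "smooth_germ (\<lambda>x::real. x) a"
  by (rule smooth_germ_bounded_linear[OF bounded_linear_ident])

lemma smooth_germ_fst: "smooth_germ (fst :: real \<times> 'p::real_normed_vector \<Rightarrow> real) a"
  by (rule smooth_germ_bounded_linear[OF bounded_linear_fst])

lemma smooth_map_germ_Pair_realI:
  "smooth_germ q a \<Longrightarrow> smooth_map_germ g a \<Longrightarrow> smooth_map_germ (\<lambda>x. (q x, g x)) a" for q :: "_ \<Rightarrow> real"
  by (intro smooth_map_germ_Pair smooth_map_germ_realI)

lemma eventually_nhds_compose:
  assumes "\<forall>\<^sub>F y in nhds (g a). P y" "isCont g a"
  shows "\<forall>\<^sub>F x in nhds a. P (g x)"
proof -
  have "filterlim g (nhds (g a)) (nhds a)"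
    using assms(2) unfolding isCont_def tendsto_at_iff_tendsto_nhds .
  from eventually_compose_filterlim[OF assms(1) this] show ?thesis .
qed

lemma eventually_nhds_pos: "smooth_germ f a \<Longrightarrow> f a > c \<Longrightarrow> \<forall>\<^sub>F x in nhds a. f x > c"
  by (rule eventually_nhds_compose[of "\<lambda>y. y > c"])
    (auto simp: smooth_germ_continuous eventually_nhds intro: exI[of _ "{c<..}"])

lemma local_inverse_first:
  fixes F :: "real \<times> 'p::real_normed_vector \<Rightarrow> real"
  assumes sm: "smooth_germ F (0, 0)" and F0: "F (0, 0) = 0" and nz: "dir_deriv (1, 0) F (0, 0) \<noteq> 0"
  obtains Q :: "real \<times> 'p \<Rightarrow> real" where "smooth_germ Q (0, 0)" "Q (0, 0) = 0"
    "\<forall>\<^sub>F x in nhds (0, 0). F (Q x, snd x) = fst x"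
    "\<forall>\<^sub>F x in nhds (0, 0). Q (F x, snd x) = fst x"
proof (cases "dir_deriv (1, 0) F (0, 0) > 0")
  case True
  from local_inverse_first_pos[OF sm F0 this that] show ?thesis .
next
  case False
  have "dir_deriv (1, 0) (\<lambda>x. - F x) (0, 0) = - dir_deriv (1, 0) F (0, 0)"
    by (rule dir_derivI[OF has_derivative_minus[OF smooth_germ_has_derivative[OF sm]]])
  then have "dir_deriv (1, 0) (\<lambda>x. - F x) (0, 0) > 0" using False nz by simp
  from local_inverse_first_pos[OF smooth_germ_uminus[OF sm] _ this] F0
  obtain Q where Q: "smooth_germ Q (0, 0)" "Q (0, 0) = 0"
    "\<forall>\<^sub>F x in nhds (0, 0). - F (Q x, snd x) = fst x"
    "\<forall>\<^sub>F x in nhds (0, 0). Q (- F x, snd x) = fst x" by auto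
  let ?m = "\<lambda>x :: real \<times> 'p. (- fst x, snd x)"
  have m: "smooth_map_germ ?m (0, 0)"
    by (intro smooth_map_germ_Pair_realI smooth_germ_uminus smooth_germ_fst smooth_map_germ_snd)
  show ?thesis
  proof (rule that[of "\<lambda>x. Q (?m x)"])
    show "smooth_germ (\<lambda>x. Q (?m x)) (0, 0)"
      by (rule smooth_germ_compose[OF _ m]) (use Q(1) in simp)
    have "\<forall>\<^sub>F x in nhds (0, 0). - F (Q (?m x), snd (?m x)) = fst (?m x)"
      by (rule eventually_nhds_compose[OF _ smooth_map_germ_continuous[OF m]]) (use Q(3) in simp)
    then show "\<forall>\<^sub>F x in nhds (0, 0). F (Q (?m x), snd x) = fst x" by simp
    show "\<forall>\<^sub>F x in nhds (0, 0). Q (?m (F x, snd x)) = fst x" using Q(4) by simp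
  qed (use Q(2) in simp)
qed

text \<open>
  Let \<open>q p\<close> be the critical point of \<open>g (_, p)\<close> near 0 and \<open>c p\<close> its critical value. By Hadamard's lemma,
  used twice, \<open>g (q p + z, p) - c p = z^2 * L (z, p)\<close> with \<open>2 L (0, 0) = g_zz\<close>, so a square root of
  \<open>\<plusminus>L\<close> can be absorbed into \<open>Y\<close>. Differentiating \<open>g_z (q p, p) = 0\<close> and
  \<open>c p = g (q p, p)\<close> gives the last three statements: without a mixed term in the direction \<open>w\<close>, the
  2-jet of \<open>c\<close> in this direction is that of \<open>g\<close>.
\<close>
lemma split_off_square:
  fixes g :: "real \<times> 'p::real_normed_vector \<Rightarrow> real"
  assumes g: "smooth_germ g (0, 0)" and gz0: "dir_deriv (1, 0) g (0, 0) = 0"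
    and gzz: "dir_deriv (1, 0) (dir_deriv (1, 0) g) (0, 0) \<noteq> 0"
  obtains Y :: "real \<times> 'p \<Rightarrow> real" and q c :: "'p \<Rightarrow> real" where
    "smooth_germ Y (0, 0)" "Y (0, 0) = 0" "dir_deriv (1, 0) Y (0, 0) \<noteq> 0"
    "smooth_germ q 0" "q 0 = 0" "smooth_germ c 0" "\<And>p. c p = g (q p, p)"
    "\<forall>\<^sub>F x in nhds (0, 0). g x = sgn (dir_deriv (1, 0) (dir_deriv (1, 0) g) (0, 0)) * (Y x)\<^sup>2 + c (snd x)"
    "\<And>w. dir_deriv w c 0 = dir_deriv (0, w) g (0, 0)"
    "\<And>w. dir_deriv (0, w) (dir_deriv (1, 0) g) (0, 0) = 0 \<Longrightarrow> dir_deriv w q 0 = 0"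
    "\<And>w. dir_deriv (0, w) (dir_deriv (1, 0) g) (0, 0) = 0 \<Longrightarrow>
      dir_deriv w (dir_deriv w c) 0 = dir_deriv (0, w) (dir_deriv (0, w) g) (0, 0)"
proof -
  let ?gz = "dir_deriv (1, 0) g"
  define \<epsilon> where "\<epsilon> = sgn (dir_deriv (1, 0) ?gz (0, 0))"
  have sgz: "smooth_germ ?gz (0, 0)" by (rule smooth_germ_dir_deriv[OF g])
  obtain Q :: "real \<times> 'p \<Rightarrow> real" where Q: "smooth_germ Q (0, 0)" "Q (0, 0) = 0"
    "\<forall>\<^sub>F x in nhds (0, 0). ?gz (Q x, snd x) = fst x"
    "\<forall>\<^sub>F x in nhds (0, 0). Q (?gz x, snd x) = fst x"
    by (rule local_inverse_first[OF sgz gz0 gzz])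
  define q where "q p = Q (0, p)" for p
  have sP0: "smooth_map_germ (\<lambda>p :: 'p. (0 :: real, p)) a" for a
    by (intro smooth_map_germ_Pair_realI smooth_germ_const smooth_map_germ_ident)
  have q: "smooth_germ q 0" "q 0 = 0"
    unfolding q_def using smooth_germ_compose[OF _ sP0] Q by auto
  have sqP: "smooth_map_germ (\<lambda>p. (q p, p)) 0"
    by (intro smooth_map_germ_Pair_realI q smooth_map_germ_ident)
  have gzq: "\<forall>\<^sub>F p in nhds 0. ?gz (q p, p) = 0"
    using eventually_nhds_compose[OF _ smooth_map_germ_continuous[OF sP0], of "\<lambda>x. ?gz (Q x, snd x) = fst x" 0] Q(3)
    by (simp add: q_def)
  define c where "c p = g (q p, p)" for p
  have c: "smooth_germ c 0" unfolding c_def[abs_def]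
    by (rule smooth_germ_compose[OF _ sqP]) (use g q in simp)
  let ?m = "\<lambda>x :: real \<times> 'p. (q (snd x) + fst x, snd x)"
  have sqsnd: "smooth_germ (\<lambda>x :: real \<times> 'p. q (snd x)) (0, 0)"
    by (rule smooth_germ_compose[OF _ smooth_map_germ_snd]) (use q in simp)
  have m: "smooth_map_germ ?m (0, 0)"
    by (intro smooth_map_germ_Pair_realI smooth_germ_add sqsnd smooth_germ_fst smooth_map_germ_snd)
  \<comment> \<open>Translated so that the critical point in the first variable and its value are 0 for every parameter.\<close>
  define k where "k x = g (?m x) - c (snd x)" for x
  have sgm: "smooth_germ (\<lambda>x. g (?m x)) (0, 0)"
    by (rule smooth_germ_compose[OF _ m]) (use g q in simp)
  have scsnd: "smooth_germ (\<lambda>x :: real \<times> 'p. c (snd x)) (0, 0)"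
    by (rule smooth_germ_compose[OF _ smooth_map_germ_snd]) (use c in simp)
  have k: "smooth_germ k (0, 0)" unfolding k_def by (intro smooth_germ_diff sgm scsnd)
  have kz: "\<forall>\<^sub>F x in nhds (0, 0). dir_deriv (1, 0) k x = ?gz (?m x)"
  proof -
    have "\<forall>\<^sub>F x in nhds (0, 0). smooth_germ g (?m x)"
      by (rule eventually_nhds_compose[OF _ smooth_map_germ_continuous[OF m]])
        (use smooth_germ_eventually[OF g] q in simp)
    moreover have "\<forall>\<^sub>F x :: real \<times> 'p in nhds (0, 0). smooth_germ q (snd x)"
      by (rule eventually_nhds_compose[OF _ smooth_map_germ_continuous[OF smooth_map_germ_snd]])
        (use smooth_germ_eventually[OF q(1)] in simp)
    moreover have "\<forall>\<^sub>F x :: real \<times> 'p in nhds (0, 0). smooth_germ c (snd x)"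
      by (rule eventually_nhds_compose[OF _ smooth_map_germ_continuous[OF smooth_map_germ_snd]])
        (use smooth_germ_eventually[OF c(1)] in simp)
    ultimately show ?thesis
    proof eventually_elim
      case (elim x)
      have dq: "((\<lambda>x :: real \<times> 'p. q (snd x)) has_derivative (\<lambda>v. dir_deriv (snd v) q (snd x))) (at x)"
        by (rule has_derivative_compose[OF has_derivative_snd[OF has_derivative_ident] smooth_germ_has_derivative[OF elim(2)]])
      have dc: "((\<lambda>x :: real \<times> 'p. c (snd x)) has_derivative (\<lambda>v. dir_deriv (snd v) c (snd x))) (at x)"
        by (rule has_derivative_compose[OF has_derivative_snd[OF has_derivative_ident] smooth_germ_has_derivative[OF elim(3)]])
      have "(?m has_derivative (\<lambda>v. (dir_deriv (snd v) q (snd x) + fst v, snd v))) (at x)"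
        by (intro has_derivative_Pair has_derivative_add dq has_derivative_fst has_derivative_snd has_derivative_ident)
      from has_derivative_diff[OF has_derivative_compose[OF this smooth_germ_has_derivative[OF elim(1)]] dc]
      have "(k has_derivative (\<lambda>v. dir_deriv (dir_deriv (snd v) q (snd x) + fst v, snd v) g (?m x)
          - dir_deriv (snd v) c (snd x))) (at x)" unfolding k_def .
      from dir_derivI[OF this, of "(1, 0)"] show ?case
        using linear_0[OF linear_dir_deriv[OF elim(2)]] linear_0[OF linear_dir_deriv[OF elim(3)]] by simp
    qed
  qed
  have "\<forall>\<^sub>F p in nhds 0. k (0, p) = 0" by (simp add: k_def c_def)
  then obtain K where K: "smooth_germ K (0, 0)"
    "\<forall>\<^sub>F x in nhds (0, 0). k x = fst x * K x" by (rule hadamard_factor[OF k])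
  have dfst: "dir_deriv (1, 0) fst x = 1" for x :: "real \<times> 'p"
    by (simp add: dir_deriv_bounded_linear[OF bounded_linear_fst])
  have kzK: "\<forall>\<^sub>F x in nhds (0, 0). dir_deriv (1, 0) k x = fst x * dir_deriv (1, 0) K x + K x"
    using iffD2[OF eventually_eventually K(2)]
      smooth_germ_eventually[OF K(1)] smooth_germ_eventually[OF k(1)]
  proof eventually_elim
    case (elim x)
    have "dir_deriv (1, 0) k x = dir_deriv (1, 0) (\<lambda>x. fst x * K x) x"
      by (rule dir_deriv_cong[OF elim(1,3)])
    also have "\<dots> = fst x * dir_deriv (1, 0) K x + dir_deriv (1, 0) fst x * K x"
      by (rule dir_deriv_mult[OF smooth_germ_fst elim(2)])
    finally show ?case by (simp add: dfst)
  qed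
  have "\<forall>\<^sub>F p in nhds 0. K (0, p) = 0"
  proof -
    have at0: "\<forall>\<^sub>F p in nhds 0. P (0, p)" if "\<forall>\<^sub>F x in nhds (0 :: real, 0 :: 'p). P x" for P
      by (rule eventually_nhds_compose[OF _ smooth_map_germ_continuous[OF sP0]]) (rule that)
    from at0[OF kzK] at0[OF kz] gzq show ?thesis by eventually_elim simp
  qed
  then obtain L where L: "smooth_germ L (0, 0)"
    "\<forall>\<^sub>F x in nhds (0, 0). K x = fst x * L x" by (rule hadamard_factor[OF K(1)])
  have L0: "2 * L (0, 0) = dir_deriv (1, 0) ?gz (0, 0)"
  proof -
    have kz': "\<forall>\<^sub>F x in nhds (0, 0). dir_deriv (1, 0) k x = fst x * (dir_deriv (1, 0) K x + L x)"
      using kzK L(2) by eventually_elim (simp add: algebra_simps)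
    have "dir_deriv (1, 0) (dir_deriv (1, 0) k) (0, 0)
        = dir_deriv (1, 0) (\<lambda>x. fst x * (dir_deriv (1, 0) K x + L x)) (0, 0)"
      by (rule dir_deriv_cong[OF kz' smooth_germ_dir_deriv[OF k]])
    also have "\<dots> = dir_deriv (1, 0) K (0, 0) + L (0, 0)"
      by (subst dir_deriv_mult[OF smooth_germ_fst smooth_germ_add[OF smooth_germ_dir_deriv[OF K(1)] L(1)]])
        (simp add: dfst)
    also have "dir_deriv (1, 0) K (0, 0) = dir_deriv (1, 0) (\<lambda>x. fst x * L x) (0, 0)"
      by (rule dir_deriv_cong[OF L(2) K(1)])
    also have "\<dots> = L (0, 0)"
      by (subst dir_deriv_mult[OF smooth_germ_fst L(1)]) (simp add: dfst)
    finally have 1: "dir_deriv (1, 0) (dir_deriv (1, 0) k) (0, 0) = 2 * L (0, 0)" by simp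
    have "dir_deriv (1, 0) (dir_deriv (1, 0) k) (0, 0) = dir_deriv (1, 0) (\<lambda>x. ?gz (?m x)) (0, 0)"
      by (rule dir_deriv_cong[OF kz smooth_germ_dir_deriv[OF k]])
    also have "\<dots> = dir_deriv (1, 0) ?gz (0, 0)"
    proof -
      have "dir_deriv (1, 0) ?m (0, 0) = (1, 0)"
      proof -
        have "((\<lambda>x :: real \<times> 'p. q (snd x)) has_derivative (\<lambda>v. dir_deriv (snd v) q 0)) (at (0, 0))"
          by (rule has_derivative_compose[OF has_derivative_snd[OF has_derivative_ident]])
            (use smooth_germ_has_derivative[OF q(1)] in simp)
        then have "(?m has_derivative (\<lambda>v. (dir_deriv (snd v) q 0 + fst v, snd v))) (at (0, 0))"
          by (intro has_derivative_Pair has_derivative_add has_derivative_fst has_derivative_snd has_derivative_ident)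
        from dir_derivI[OF this] show ?thesis
          using linear_0[OF linear_dir_deriv[OF q(1)]] by simp
      qed
      then show ?thesis using dir_deriv_compose[OF _ m, of ?gz] sgz q by simp
    qed
    finally show ?thesis using 1 by simp
  qed
  have \<epsilon>: "\<epsilon> * \<epsilon> = 1" "\<epsilon> * L (0, 0) > 0"
    using gzz L0 by (auto simp: \<epsilon>_def sgn_if)
  let ?n = "\<lambda>x :: real \<times> 'p. (fst x - q (snd x), snd x)"
  have n: "smooth_map_germ ?n (0, 0)"
    by (intro smooth_map_germ_Pair_realI smooth_germ_diff sqsnd smooth_germ_fst smooth_map_germ_snd)
  \<comment> \<open>The sign \<open>\<epsilon>\<close> makes the base positive, where real powers are smooth.\<close>
  define S where "S x = (\<epsilon> * L (?n x)) powr (1/2)" for x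
  define Y where "Y x = (fst x - q (snd x)) * S x" for x
  have sLn: "smooth_germ (\<lambda>x. \<epsilon> * L (?n x)) (0, 0)"
    by (intro smooth_germ_mult smooth_germ_const smooth_germ_compose[OF _ n]) (use L q in simp)
  have S: "smooth_germ S (0, 0)" unfolding S_def[abs_def]
    by (rule smooth_germ_powr[OF sLn]) (use \<epsilon> q in simp)
  have sfq: "smooth_germ (\<lambda>x :: real \<times> 'p. fst x - q (snd x)) (0, 0)"
    by (intro smooth_germ_diff sqsnd smooth_germ_fst)
  have Y: "smooth_germ Y (0, 0)" unfolding Y_def[abs_def] by (intro smooth_germ_mult sfq S)
  have Y0: "Y (0, 0) = 0" using q by (simp add: Y_def)
  have "dir_deriv (1, 0) Y (0, 0) = S (0, 0)"
  proof -
    have "((\<lambda>x :: real \<times> 'p. q (snd x)) has_derivative (\<lambda>v. dir_deriv (snd v) q 0)) (at (0, 0))"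
      by (rule has_derivative_compose[OF has_derivative_snd[OF has_derivative_ident]])
        (use smooth_germ_has_derivative[OF q(1)] in simp)
    then have "((\<lambda>x :: real \<times> 'p. fst x - q (snd x)) has_derivative (\<lambda>v. fst v - dir_deriv (snd v) q 0)) (at (0, 0))"
      by (intro has_derivative_diff has_derivative_fst has_derivative_ident)
    from dir_derivI[OF this, of "(1, 0)"]
    have "dir_deriv (1, 0) (\<lambda>x :: real \<times> 'p. fst x - q (snd x)) (0, 0) = 1"
      using linear_0[OF linear_dir_deriv[OF q(1)]] by simp
    then show ?thesis unfolding Y_def[abs_def] using q by (simp add: dir_deriv_mult[OF sfq S])
  qed
  then have Y1: "dir_deriv (1, 0) Y (0, 0) \<noteq> 0" using \<epsilon>(2) q by (auto simp: S_def)
  have eq: "\<forall>\<^sub>F x in nhds (0, 0). g x = \<epsilon> * (Y x)\<^sup>2 + c (snd x)"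
  proof -
    have at_n: "\<forall>\<^sub>F x in nhds (0, 0). P (?n x)" if "\<forall>\<^sub>F x in nhds (0, 0). P x" for P
      by (rule eventually_nhds_compose[OF _ smooth_map_germ_continuous[OF n]]) (use that q in simp)
    have "\<forall>\<^sub>F x in nhds (0, 0). \<epsilon> * L (?n x) > 0"
      by (rule eventually_nhds_pos[OF sLn]) (use \<epsilon> q in simp)
    with at_n[OF K(2)] at_n[OF L(2)] show ?thesis
    proof eventually_elim
      case (elim x)
      have "(S x)\<^sup>2 = \<epsilon> * L (?n x)"
        using elim(3) unfolding S_def
        by (metis less_imp_le powr_half_sqrt real_sqrt_pow2)
      then have "\<epsilon> * (Y x)\<^sup>2 = (\<epsilon> * \<epsilon>) * (fst x - q (snd x))\<^sup>2 * L (?n x)"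
        unfolding Y_def by (simp add: power_mult_distrib)
      also have "\<dots> = k (?n x)" using elim(1,2) \<epsilon>(1) by (simp add: power2_eq_square)
      also have "\<dots> = g x - c (snd x)" by (simp add: k_def)
      finally show ?case by simp
    qed
  qed
  have dqP: "dir_deriv w (\<lambda>p. (q p, p)) p = (dir_deriv w q p, w)" if "smooth_germ q p" for w p
    by (rule dir_deriv_Pair[OF that])
  have dc: "\<forall>\<^sub>F p in nhds 0. \<forall>w. dir_deriv w c p = dir_deriv (0, w) g (q p, p)"
  proof -
    have "\<forall>\<^sub>F p in nhds 0. smooth_germ g (q p, p)"
      by (rule eventually_nhds_compose[OF _ smooth_map_germ_continuous[OF sqP]])
        (use smooth_germ_eventually[OF g] q in simp)
    with gzq smooth_germ_eventually[OF q(1)] smooth_map_germ_eventually[OF sqP]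
    show ?thesis
    proof eventually_elim
      case (elim p)
      show ?case
      proof
        fix w
        show "dir_deriv w c p = dir_deriv (0, w) g (q p, p)" unfolding c_def[abs_def]
          using dir_deriv_compose[OF elim(4,3), of w] dqP[OF elim(2), of w]
            dir_deriv_Pair_split[OF elim(4), of "dir_deriv w q p" w] elim(1) by simp
      qed
    qed
  qed
  have dq: "dir_deriv w q 0 = 0" if "dir_deriv (0, w) ?gz (0, 0) = 0" for w
  proof -
    have s: "smooth_germ (\<lambda>p. ?gz (q p, p)) 0"
      by (rule smooth_germ_compose[OF _ sqP]) (use sgz q in simp)
    have "dir_deriv w (\<lambda>p. ?gz (q p, p)) 0 = dir_deriv w (\<lambda>p. 0) 0"
      by (rule dir_deriv_cong[OF gzq s])
    moreover have "dir_deriv w (\<lambda>p. ?gz (q p, p)) 0 = dir_deriv (dir_deriv w q 0, w) ?gz (0, 0)"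
      using dir_deriv_compose[OF _ sqP, of ?gz] sgz q dqP[OF q(1)] by simp
    ultimately have "dir_deriv w q 0 * dir_deriv (1, 0) ?gz (0, 0) = 0"
      using dir_deriv_Pair_split[OF sgz, of "dir_deriv w q 0" w] that by (simp add: dir_deriv_const)
    then show ?thesis using gzz by simp
  qed
  have dcc: "dir_deriv w (dir_deriv w c) 0 = dir_deriv (0, w) (dir_deriv (0, w) g) (0, 0)"
    if "dir_deriv (0, w) ?gz (0, 0) = 0" for w
  proof -
    have "\<forall>\<^sub>F p in nhds 0. dir_deriv w c p = dir_deriv (0, w) g (q p, p)"
      using dc by eventually_elim simp
    from dir_deriv_cong[OF this smooth_germ_dir_deriv[OF c]]
    have "dir_deriv w (dir_deriv w c) 0 = dir_deriv w (\<lambda>p. dir_deriv (0, w) g (q p, p)) 0" .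
    also have "\<dots> = dir_deriv (0, w) (dir_deriv (0, w) g) (0, 0)"
      using dir_deriv_compose[OF _ sqP, of "dir_deriv (0, w) g"] smooth_germ_dir_deriv[OF g] q dqP[OF q(1)]
        dq[OF that] by simp
    finally show ?thesis .
  qed
  have dc0: "dir_deriv w c 0 = dir_deriv (0, w) g (0, 0)" for w
    using eventually_nhds_x_imp_x[OF dc] q by simp
  show ?thesis
    by (rule that[OF Y Y0 Y1 q c c_def eq[unfolded \<epsilon>_def] dc0 dq dcc])
qed

section \<open>Morse families, cubes and normal forms\<close>

lemma Pair_zero_eq_zero: "(0, 0) = 0"
  by (simp add: zero_prod_def)

text \<open>
  With the Hessian in the first two variables diagonal, the function that remains after splitting off the
  first square has the same derivatives of order 1 and 2 in its first variable as \<open>G\<close>, so a second square can be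
  split off.
\<close>
lemma morse_family:
  fixes G :: "real \<times> real \<times> 'p::real_normed_vector \<Rightarrow> real"
  defines "e1 \<equiv> (1, 0, 0)" and "e2 \<equiv> (0, 1, 0)"
  assumes G: "smooth_germ G 0" and "dir_deriv e1 G 0 = 0" "dir_deriv e2 G 0 = 0"
    and G11: "dir_deriv e1 (dir_deriv e1 G) 0 \<noteq> 0"
    and G12: "dir_deriv e2 (dir_deriv e1 G) 0 = 0"
    and G22: "dir_deriv e2 (dir_deriv e2 G) 0 \<noteq> 0"
  obtains Y1 :: "real \<times> real \<times> 'p \<Rightarrow> real" and Y2 :: "real \<times> 'p \<Rightarrow> real" and c :: "'p \<Rightarrow> real" where
    "smooth_germ Y1 0" "Y1 0 = 0" "dir_deriv e1 Y1 0 \<noteq> 0"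
    "smooth_germ Y2 0" "Y2 0 = 0" "dir_deriv (1, 0) Y2 0 \<noteq> 0"
    "smooth_germ c 0" "c 0 = G 0"
    "\<forall>\<^sub>F x in nhds 0. G x = sgn (dir_deriv e1 (dir_deriv e1 G) 0) * (Y1 x)\<^sup>2
      + sgn (dir_deriv e2 (dir_deriv e2 G) 0) * (Y2 (snd x))\<^sup>2 + c (snd (snd x))"
proof -
  note [simp] = Pair_zero_eq_zero
  note hyps = assms(3-)[unfolded e1_def e2_def]
  obtain Y1 q1 c1 where 1:
    "smooth_germ Y1 (0, 0)" "Y1 (0, 0) = 0" "dir_deriv (1, 0) Y1 (0, 0) \<noteq> 0"
    "smooth_germ q1 0" "q1 0 = 0" "smooth_germ c1 0" "\<And>p. c1 p = G (q1 p, p)"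
    "\<forall>\<^sub>F x in nhds (0, 0). G x = sgn (dir_deriv (1, 0) (dir_deriv (1, 0) G) (0, 0)) * (Y1 x)\<^sup>2 + c1 (snd x)"
    "\<And>w. dir_deriv w c1 0 = dir_deriv (0, w) G (0, 0)"
    "\<And>w. dir_deriv (0, w) (dir_deriv (1, 0) G) (0, 0) = 0 \<Longrightarrow> dir_deriv w q1 0 = 0"
    "\<And>w. dir_deriv (0, w) (dir_deriv (1, 0) G) (0, 0) = 0 \<Longrightarrow>
      dir_deriv w (dir_deriv w c1) 0 = dir_deriv (0, w) (dir_deriv (0, w) G) (0, 0)"
    by (rule split_off_square[of G]) (use hyps in simp_all)
  have c11: "dir_deriv (1, 0) (dir_deriv (1, 0) c1) 0 = dir_deriv (0, 1, 0) (dir_deriv (0, 1, 0) G) 0"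
    using 1(11)[of "(1, 0)"] hyps by simp
  obtain Y2 q2 c where 2:
    "smooth_germ Y2 (0, 0)" "Y2 (0, 0) = 0" "dir_deriv (1, 0) Y2 (0, 0) \<noteq> 0"
    "smooth_germ q2 0" "q2 0 = 0" "smooth_germ c 0" "\<And>p. c p = c1 (q2 p, p)"
    "\<forall>\<^sub>F x in nhds (0, 0). c1 x = sgn (dir_deriv (1, 0) (dir_deriv (1, 0) c1) (0, 0)) * (Y2 x)\<^sup>2 + c (snd x)"
    "\<And>w. dir_deriv w c 0 = dir_deriv (0, w) c1 (0, 0)"
    "\<And>w. dir_deriv (0, w) (dir_deriv (1, 0) c1) (0, 0) = 0 \<Longrightarrow> dir_deriv w q2 0 = 0"
    "\<And>w. dir_deriv (0, w) (dir_deriv (1, 0) c1) (0, 0) = 0 \<Longrightarrow>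
      dir_deriv w (dir_deriv w c) 0 = dir_deriv (0, w) (dir_deriv (0, w) c1) (0, 0)"
    by (rule split_off_square[of c1]) (use hyps 1 c11 in simp_all)
  have "\<forall>\<^sub>F x :: real \<times> real \<times> 'p in nhds 0. c1 (snd x) =
      sgn (dir_deriv (1, 0) (dir_deriv (1, 0) c1) (0, 0)) * (Y2 (snd x))\<^sup>2 + c (snd (snd x))"
    by (rule eventually_nhds_compose[OF _ smooth_map_germ_continuous[OF smooth_map_germ_snd]]) (use 2(8) in simp)
  moreover have "\<forall>\<^sub>F x in nhds 0. G x = sgn (dir_deriv (1, 0) (dir_deriv (1, 0) G) 0) * (Y1 x)\<^sup>2 + c1 (snd x)"
    using 1(8) by simp
  ultimately have ev: "\<forall>\<^sub>F x in nhds 0. G x = sgn (dir_deriv e1 (dir_deriv e1 G) 0) * (Y1 x)\<^sup>2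
      + sgn (dir_deriv e2 (dir_deriv e2 G) 0) * (Y2 (snd x))\<^sup>2 + c (snd (snd x))"
    by eventually_elim (simp add: c11 e1_def e2_def)
  have c0: "c 0 = G 0" using 1(5,7) 2(5,7) by simp
  show ?thesis
    by (rule that[OF _ _ _ _ _ _ _ c0 ev]) (use 1(1-3) 2(1-3,6) in \<open>simp_all add: e1_def\<close>)
qed

text \<open>
  The squares \<open>Y1\<close> and \<open>Y2\<close> of the whole family are matched with those of the member with parameter 0: first
  \<open>\<phi>2\<close> is found from the equation for \<open>Y2\<close>, then \<open>\<phi>1\<close> from the one for \<open>Y1\<close>.
\<close>
lemma morse_trivialization:
  fixes G :: "real \<times> real \<times> 'p::real_normed_vector \<Rightarrow> real"
  defines "e1 \<equiv> (1, 0, 0)" and "e2 \<equiv> (0, 1, 0)"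
  assumes G: "smooth_germ G 0" "dir_deriv e1 G 0 = 0" "dir_deriv e2 G 0 = 0"
    "dir_deriv e1 (dir_deriv e1 G) 0 \<noteq> 0" "dir_deriv e2 (dir_deriv e1 G) 0 = 0"
    "dir_deriv e2 (dir_deriv e2 G) 0 \<noteq> 0"
  obtains \<phi>1 :: "real \<times> real \<times> 'p \<Rightarrow> real" and \<phi>2 :: "real \<times> 'p \<Rightarrow> real" and c :: "'p \<Rightarrow> real" where
    "smooth_germ \<phi>1 0" "smooth_germ \<phi>2 0" "\<phi>1 0 = 0" "\<phi>2 0 = 0"
    "\<forall>\<^sub>F x in nhds 0. \<phi>1 (fst x, snd x, 0) = fst x" "\<forall>\<^sub>F y in nhds 0. \<phi>2 (y, 0) = y"
    "smooth_germ c 0"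
    "\<forall>\<^sub>F x in nhds 0. G x = G (\<phi>1 x, \<phi>2 (snd x), 0) + c (snd (snd x))"
proof -
  note [simp] = Pair_zero_eq_zero
  define \<epsilon>1 where "\<epsilon>1 = sgn (dir_deriv e1 (dir_deriv e1 G) 0)"
  define \<epsilon>2 where "\<epsilon>2 = sgn (dir_deriv e2 (dir_deriv e2 G) 0)"
  obtain Y1 Y2 c where Y:
    "smooth_germ Y1 0" "Y1 0 = 0" "dir_deriv e1 Y1 0 \<noteq> 0"
    "smooth_germ Y2 0" "Y2 0 = 0" "dir_deriv (1, 0) Y2 0 \<noteq> 0"
    "smooth_germ c 0" "c 0 = G 0"
    and GY: "\<forall>\<^sub>F x in nhds 0. G x = \<epsilon>1 * (Y1 x)\<^sup>2 + \<epsilon>2 * (Y2 (snd x))\<^sup>2 + c (snd (snd x))"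
    unfolding \<epsilon>1_def \<epsilon>2_def by (rule morse_family[OF G[unfolded e1_def e2_def], folded e1_def e2_def])
  obtain R1 where R1: "smooth_germ R1 (0, 0)" "R1 (0, 0) = 0"
    "\<forall>\<^sub>F x in nhds (0, 0). Y1 (R1 x, snd x) = fst x"
    "\<forall>\<^sub>F x in nhds (0, 0). R1 (Y1 x, snd x) = fst x"
    by (rule local_inverse_first[of Y1]) (use Y in \<open>simp_all add: e1_def\<close>)
  obtain R2 where R2: "smooth_germ R2 (0, 0)" "R2 (0, 0) = 0"
    "\<forall>\<^sub>F x in nhds (0, 0). Y2 (R2 x, snd x) = fst x"
    "\<forall>\<^sub>F x in nhds (0, 0). R2 (Y2 x, snd x) = fst x"
    by (rule local_inverse_first[of Y2]) (use Y in simp_all)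
  define \<phi>2 where "\<phi>2 y = R2 (Y2 y, 0)" for y
  define \<phi>1 where "\<phi>1 x = R1 (Y1 x, \<phi>2 (snd x), 0)" for x
  have m2: "smooth_map_germ (\<lambda>y. (Y2 y, 0 :: 'p)) 0"
    by (intro smooth_map_germ_Pair_realI Y smooth_map_germ_const)
  have s2: "smooth_germ \<phi>2 0" unfolding \<phi>2_def[abs_def]
    by (rule smooth_germ_compose[OF _ m2]) (use R2 Y in simp)
  have z2: "\<phi>2 0 = 0" using R2 Y by (simp add: \<phi>2_def)
  have s2': "smooth_germ (\<lambda>x :: real \<times> real \<times> 'p. \<phi>2 (snd x)) 0"
    by (rule smooth_germ_compose[OF _ smooth_map_germ_snd]) (use s2 in simp)
  have m1: "smooth_map_germ (\<lambda>x. (Y1 x, \<phi>2 (snd x), 0 :: 'p)) 0"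
    by (intro smooth_map_germ_Pair_realI Y s2' smooth_map_germ_const)
  have s1: "smooth_germ \<phi>1 0" unfolding \<phi>1_def[abs_def]
    by (rule smooth_germ_compose[OF _ m1]) (use R1 Y z2 in simp)
  have z1: "\<phi>1 0 = 0" using R1 Y z2 by (simp add: \<phi>1_def)
  have t2: "\<forall>\<^sub>F y in nhds 0. \<phi>2 (y, 0) = y"
  proof -
    have "smooth_map_germ (\<lambda>y::real. (y, 0 :: 'p)) 0"
      by (intro smooth_map_germ_Pair_realI smooth_germ_real_ident smooth_map_germ_const)
    from eventually_nhds_compose[OF _ smooth_map_germ_continuous[OF this], of "\<lambda>x. R2 (Y2 x, snd x) = fst x"] R2(4)
    show ?thesis by (simp add: \<phi>2_def)
  qed
  have t1: "\<forall>\<^sub>F x in nhds 0. \<phi>1 (fst x, snd x, 0) = fst x"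
  proof -
    have "smooth_map_germ (\<lambda>x::real\<times>real. (fst x, snd x, 0 :: 'p)) 0"
      by (intro smooth_map_germ_Pair smooth_map_germ_fst smooth_map_germ_snd smooth_map_germ_const)
    from eventually_nhds_compose[OF _ smooth_map_germ_continuous[OF this], of "\<lambda>x. R1 (Y1 x, snd x) = fst x"] R1(4)
    have "\<forall>\<^sub>F x :: real \<times> real in nhds 0. R1 (Y1 (fst x, snd x, 0), snd x, 0) = fst x" by simp
    moreover have "\<forall>\<^sub>F x :: real \<times> real in nhds 0. \<phi>2 (snd x, 0) = snd x"
      by (rule eventually_nhds_compose[OF _ smooth_map_germ_continuous[OF smooth_map_germ_snd]]) (use t2 in simp)
    ultimately show ?thesis by eventually_elim (simp add: \<phi>1_def)
  qed
  have "\<forall>\<^sub>F x in nhds 0. G x = G (\<phi>1 x, \<phi>2 (snd x), 0) + (c (snd (snd x)) - c 0)"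
  proof -
    have "smooth_map_germ (\<lambda>x. (\<phi>1 x, \<phi>2 (snd x), 0 :: 'p)) 0"
      by (intro smooth_map_germ_Pair_realI s1 s2' smooth_map_germ_const)
    from eventually_nhds_compose[OF _ smooth_map_germ_continuous[OF this],
        of "\<lambda>x. G x = \<epsilon>1 * (Y1 x)\<^sup>2 + \<epsilon>2 * (Y2 (snd x))\<^sup>2 + c (snd (snd x))"] GY z1 z2
    have a: "\<forall>\<^sub>F x in nhds 0. G (\<phi>1 x, \<phi>2 (snd x), 0) =
        \<epsilon>1 * (Y1 (\<phi>1 x, \<phi>2 (snd x), 0))\<^sup>2 + \<epsilon>2 * (Y2 (\<phi>2 (snd x), 0))\<^sup>2 + c 0" by simp
    from eventually_nhds_compose[OF _ smooth_map_germ_continuous[OF m1], of "\<lambda>x. Y1 (R1 x, snd x) = fst x"] R1 Y z2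
    have b: "\<forall>\<^sub>F x in nhds 0. Y1 (\<phi>1 x, \<phi>2 (snd x), 0) = Y1 x" by (simp add: \<phi>1_def)
    have "smooth_map_germ (\<lambda>x :: real \<times> real \<times> 'p. (Y2 (snd x), 0 :: 'p)) 0"
      by (intro smooth_map_germ_Pair_realI smooth_map_germ_const smooth_germ_compose[OF _ smooth_map_germ_snd])
        (use Y in simp)
    from eventually_nhds_compose[OF _ smooth_map_germ_continuous[OF this], of "\<lambda>x. Y2 (R2 x, snd x) = fst x"] R2 Y
    have d: "\<forall>\<^sub>F x :: real \<times> real \<times> 'p in nhds 0. Y2 (\<phi>2 (snd x), 0) = Y2 (snd x)" by (simp add: \<phi>2_def)
    from a b d GY show ?thesis by eventually_elim simp
  qed
  moreover have "smooth_germ (\<lambda>p. c p - c 0) 0" by (intro smooth_germ_diff Y smooth_germ_const)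
  ultimately show ?thesis using that[OF s1 s2 z1 z2 t1 t2] by blast
qed

lemma hadamard_factor_real:
  fixes f :: "real \<Rightarrow> real"
  assumes "smooth_germ f 0" "f 0 = 0"
  obtains k where "smooth_germ k 0" "\<forall>\<^sub>F y in nhds 0. f y = y * k y"
proof -
  have "smooth_germ (\<lambda>x :: real \<times> real. f (fst x)) (0, 0)"
    by (rule smooth_germ_compose[OF _ smooth_map_germ_fst]) (use assms in simp)
  moreover have "\<forall>\<^sub>F p :: real in nhds 0. f (fst (0, p)) = 0" using assms by simp
  ultimately obtain K where K: "smooth_germ K (0, 0)" "\<forall>\<^sub>F x :: real \<times> real in nhds (0, 0). f (fst x) = fst x * K x"
    by (rule hadamard_factor)
  have m: "smooth_map_germ (\<lambda>y::real. (y, 0 :: real)) 0"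
    by (intro smooth_map_germ_Pair_realI smooth_germ_real_ident smooth_map_germ_const)
  show ?thesis
  proof (rule that)
    show "smooth_germ (\<lambda>y. K (y, 0)) 0" by (rule smooth_germ_compose[OF _ m]) (rule K)
    from eventually_nhds_compose[OF _ smooth_map_germ_continuous[OF m], of "\<lambda>x. f (fst x) = fst x * K x"] K(2)
    show "\<forall>\<^sub>F y in nhds 0. f y = y * K (y, 0)" by simp
  qed
qed

lemma cube_root_form:
  fixes c u :: "real \<Rightarrow> real"
  assumes u: "smooth_germ u 0" "u 0 \<noteq> 0" and c: "\<forall>\<^sub>F y in nhds 0. c y = y ^ 3 * u y"
  obtains V where "smooth_germ V 0" "V 0 = 0" "dir_deriv 1 V 0 \<noteq> 0"
    "\<forall>\<^sub>F y in nhds 0. c y = sgn (u 0) * V y ^ 3"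
proof -
  define \<epsilon> where "\<epsilon> = sgn (u 0)"
  have \<epsilon>: "\<epsilon> * \<epsilon> = 1" "\<epsilon> * u 0 > 0" using u(2) by (auto simp: \<epsilon>_def sgn_if)
  define S where "S y = (\<epsilon> * u y) powr (1/3)" for y
  have su: "smooth_germ (\<lambda>y. \<epsilon> * u y) 0" by (intro smooth_germ_mult smooth_germ_const u)
  have S: "smooth_germ S 0" unfolding S_def[abs_def] by (rule smooth_germ_powr[OF su \<epsilon>(2)])
  have S0: "S 0 \<noteq> 0" using \<epsilon>(2) by (auto simp: S_def)
  show ?thesis
  proof (rule that)
    show "smooth_germ (\<lambda>y. y * S y) 0" by (intro smooth_germ_mult smooth_germ_real_ident S)
    show "dir_deriv 1 (\<lambda>y. y * S y) 0 \<noteq> 0"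
      using S0 by (simp add: dir_deriv_mult[OF smooth_germ_real_ident S] dir_deriv_bounded_linear[OF bounded_linear_ident])
    from c eventually_nhds_pos[OF su \<epsilon>(2)]
    show "\<forall>\<^sub>F y in nhds 0. c y = sgn (u 0) * (y * S y) ^ 3"
    proof eventually_elim
      case (elim y)
      have "S y ^ 3 = \<epsilon> * u y"
        using elim(2) powr_powr[of "\<epsilon> * u y" "1/3" 3] by (simp add: S_def)
      then have "\<epsilon> * (y * S y) ^ 3 = (\<epsilon> * \<epsilon>) * (y ^ 3 * u y)" by (simp add: power_mult_distrib)
      then show ?case using elim(1) \<epsilon>(1) by (simp add: \<epsilon>_def)
    qed
  qed simp
qed

lemma inverse_diffeo_germsI:
  assumes "smooth_map_germ \<phi> 0" "smooth_map_germ \<psi> 0" "\<phi> 0 = 0" "\<psi> 0 = 0"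
    "\<forall>\<^sub>F x in nhds 0. \<psi> (\<phi> x) = x" "\<forall>\<^sub>F x in nhds 0. \<phi> (\<psi> x) = x"
  shows "inverse_diffeo_germs \<phi> \<psi>"
  using assms unfolding inverse_diffeo_germs_def by (simp add: smooth_map_germ_imp_smooth_at)

lemma inverse_diffeo_germsD:
  assumes "inverse_diffeo_germs \<phi> \<psi>"
  shows "smooth_map_germ \<phi> 0" "smooth_map_germ \<psi> 0" "\<phi> 0 = 0" "\<psi> 0 = 0"
    "\<forall>\<^sub>F x in nhds 0. \<psi> (\<phi> x) = x" "\<forall>\<^sub>F x in nhds 0. \<phi> (\<psi> x) = x"
  using assms unfolding inverse_diffeo_germs_def by (simp_all add: smooth_at_imp_smooth_map_germ)

lemma inverse_diffeo_germs_sym: "inverse_diffeo_germs \<phi> \<psi> \<Longrightarrow> inverse_diffeo_germs \<psi> \<phi>"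
  unfolding inverse_diffeo_germs_def by blast

lemma inverse_diffeo_germs_compose:
  fixes \<phi>1 :: "'a::euclidean_space \<Rightarrow> 'a"
  assumes 1: "inverse_diffeo_germs \<phi>1 \<psi>1" and 2: "inverse_diffeo_germs \<phi>2 \<psi>2"
  shows "inverse_diffeo_germs (\<lambda>x. \<phi>1 (\<phi>2 x)) (\<lambda>x. \<psi>2 (\<psi>1 x))"
proof -
  note 1 = inverse_diffeo_germsD[OF 1] and 2 = inverse_diffeo_germsD[OF 2]
  have "\<forall>\<^sub>F x in nhds 0. \<psi>1 (\<phi>1 (\<phi>2 x)) = \<phi>2 x"
    by (rule eventually_nhds_compose[OF _ smooth_map_germ_continuous[OF 2(1)]]) (use 1 2 in simp)
  with 2(5) have a: "\<forall>\<^sub>F x in nhds 0. \<psi>2 (\<psi>1 (\<phi>1 (\<phi>2 x))) = x" by eventually_elim simp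
  have "\<forall>\<^sub>F x in nhds 0. \<phi>2 (\<psi>2 (\<psi>1 x)) = \<psi>1 x"
    by (rule eventually_nhds_compose[OF _ smooth_map_germ_continuous[OF 1(2)]]) (use 1 2 in simp)
  with 1(6) have b: "\<forall>\<^sub>F x in nhds 0. \<phi>1 (\<phi>2 (\<psi>2 (\<psi>1 x))) = x" by eventually_elim simp
  have "smooth_map_germ (\<lambda>x. \<phi>1 (\<phi>2 x)) 0"
    by (rule smooth_map_germ_compose[OF _ 2(1)]) (use 1 2 in simp)
  moreover have "smooth_map_germ (\<lambda>x. \<psi>2 (\<psi>1 x)) 0"
    by (rule smooth_map_germ_compose[OF _ 1(2)]) (use 1 2 in simp)
  ultimately show ?thesis
    by (rule inverse_diffeo_germsI[OF _ _ _ _ a b]) (use 1 2 in simp_all)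
qed

lemma bounded_linear_coords: "bounded_linear (\<lambda>x :: real^2. (x $ 1, x $ 2))"
  by (intro bounded_linear_Pair bounded_linear_vec_nth)

lemma smooth_germ_coords:
  "smooth_germ F (a $ 1, a $ 2) \<Longrightarrow> smooth_germ (\<lambda>x :: real^2. F (x $ 1, x $ 2)) a"
  by (rule smooth_germ_compose[OF _ smooth_map_germ_bounded_linear[OF bounded_linear_coords]])

lemma smooth_germ_nth: "smooth_germ f (a $ i) \<Longrightarrow> smooth_germ (\<lambda>x :: real^'n. f (x $ i)) a"
  by (rule smooth_germ_compose[OF _ smooth_map_germ_bounded_linear[OF bounded_linear_vec_nth]])

lemma smooth_map_germ_vector2:
  "smooth_germ f a \<Longrightarrow> smooth_germ g a \<Longrightarrow> smooth_map_germ (\<lambda>x. vector [f x, g x] :: real^2) a"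
proof (rule smooth_map_germ_cartI)
  fix i :: 2
  assume "smooth_germ f a" "smooth_germ g a"
  then show "smooth_germ (\<lambda>x. (vector [f x, g x] :: real^2) $ i) a"
    using exhaust_2[of i] by auto
qed

lemma eventually_coords:
  assumes "\<forall>\<^sub>F x in nhds 0. P x"
  shows "\<forall>\<^sub>F x :: real^2 in nhds 0. P (x $ 1, x $ 2)"
  by (rule eventually_nhds_compose[OF _ smooth_map_germ_continuous[OF smooth_map_germ_bounded_linear[OF bounded_linear_coords]]])
    (use assms in \<open>simp add: zero_prod_def\<close>)

lemma eventually_nth:
  assumes "\<forall>\<^sub>F y in nhds 0. P y"
  shows "\<forall>\<^sub>F x :: real^'n in nhds 0. P (x $ i)"
  by (rule eventually_nhds_compose[OF _ smooth_map_germ_continuous[OF smooth_map_germ_bounded_linear[OF bounded_linear_vec_nth]]])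
    (use assms in simp)

lemma vector2_eq_iff: "(x :: real^2) = y \<longleftrightarrow> x $ 1 = y $ 1 \<and> x $ 2 = y $ 2"
  by (simp add: vec_eq_iff forall_2)

text \<open>
  The second coordinate of the image depends only on \<open>x $ 2\<close>; it is inverted first, and then the
  first coordinate is inverted with \<open>x $ 2\<close> as a parameter.
\<close>
lemma triangular_diffeo:
  assumes Y: "smooth_germ Y 0" "Y 0 = 0" "dir_deriv (1, 0) Y 0 \<noteq> 0"
    and V: "smooth_germ V 0" "V 0 = 0" "dir_deriv 1 V 0 \<noteq> 0"
  obtains N' where "inverse_diffeo_germs (\<lambda>x. vector [Y (x $ 1, x $ 2), V (x $ 2)] :: real^2) N'"
proof -
  note [simp] = Pair_zero_eq_zero
  obtain R1 where R1: "smooth_germ R1 (0, 0)" "R1 (0, 0) = 0"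
    "\<forall>\<^sub>F x in nhds (0, 0). Y (R1 x, snd x) = fst x"
    "\<forall>\<^sub>F x in nhds (0, 0). R1 (Y x, snd x) = fst x"
    by (rule local_inverse_first[of Y]) (use Y in simp_all)
  have dV: "dir_deriv (1, 0) (\<lambda>x :: real \<times> real. V (fst x)) (0, 0) = dir_deriv 1 V 0"
    using dir_deriv_compose[OF _ smooth_map_germ_fst, of V "(0, 0)" "(1, 0)"] V
    by (simp add: dir_deriv_bounded_linear[OF bounded_linear_fst])
  have sV: "smooth_germ (\<lambda>x :: real \<times> real. V (fst x)) (0, 0)"
    by (rule smooth_germ_compose[OF _ smooth_map_germ_fst]) (use V in simp)
  obtain R where R: "smooth_germ R (0, 0)" "R (0, 0) = 0"
    "\<forall>\<^sub>F x :: real \<times> real in nhds (0, 0). V (fst (R x, snd x)) = fst x"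
    "\<forall>\<^sub>F x :: real \<times> real in nhds (0, 0). R (V (fst x), snd x) = fst x"
    by (rule local_inverse_first[OF sV]) (use V dV in simp_all)
  define r where "r y = R (y, 0)" for y
  have m: "smooth_map_germ (\<lambda>y::real. (y, 0 :: real)) 0"
    by (intro smooth_map_germ_Pair_realI smooth_germ_real_ident smooth_map_germ_const)
  have r: "smooth_germ r 0" "r 0 = 0" unfolding r_def[abs_def]
    using smooth_germ_compose[OF _ m] R by auto
  have Vr: "\<forall>\<^sub>F y in nhds 0. V (r y) = y"
    using eventually_nhds_compose[OF _ smooth_map_germ_continuous[OF m], of "\<lambda>x. V (fst (R x, snd x)) = fst x"] R(3)
    by (simp add: r_def)
  have rV: "\<forall>\<^sub>F y in nhds 0. r (V y) = y"
    using eventually_nhds_compose[OF _ smooth_map_germ_continuous[OF m], of "\<lambda>x. R (V (fst x), snd x) = fst x"] R(4)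
    by (simp add: r_def)
  let ?N = "\<lambda>x :: real^2. vector [Y (x $ 1, x $ 2), V (x $ 2)] :: real^2"
  let ?N' = "\<lambda>x :: real^2. vector [R1 (x $ 1, r (x $ 2)), r (x $ 2)] :: real^2"
  have "smooth_germ (\<lambda>x :: real^2. r (x $ 2)) 0" by (rule smooth_germ_nth) (use r in simp)
  then have mr: "smooth_map_germ (\<lambda>x :: real^2. (x $ 1, r (x $ 2))) 0"
    using smooth_germ_bounded_linear[OF bounded_linear_vec_nth]
    by (intro smooth_map_germ_Pair_realI smooth_map_germ_realI)
  have "inverse_diffeo_germs ?N ?N'"
  proof (rule inverse_diffeo_germsI)
    show "smooth_map_germ ?N 0"
      by (intro smooth_map_germ_vector2 smooth_germ_coords[of Y] smooth_germ_nth[of V]) (use Y V in simp_all)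
    show "smooth_map_germ ?N' 0"
      by (intro smooth_map_germ_vector2 smooth_germ_compose[OF _ mr, of R1] smooth_germ_nth[of r]) (use R1 r in simp_all)
    show "?N 0 = 0" "?N' 0 = 0" using Y V R1 r by (simp_all add: vector2_eq_iff)
    have "\<forall>\<^sub>F x :: real^2 in nhds 0. R1 (Y (x $ 1, x $ 2), snd (x $ 1, x $ 2)) = fst (x $ 1, x $ 2)"
      by (rule eventually_coords) (use R1(4) in simp)
    moreover have "\<forall>\<^sub>F x :: real^2 in nhds 0. r (V (x $ 2)) = x $ 2" by (rule eventually_nth[OF rV])
    ultimately show "\<forall>\<^sub>F x in nhds 0. ?N' (?N x) = x"
      by eventually_elim (simp add: vector2_eq_iff)
    from eventually_nhds_compose[OF _ smooth_map_germ_continuous[OF mr], of "\<lambda>x. Y (R1 x, snd x) = fst x"] R1(3) r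
    have "\<forall>\<^sub>F x :: real^2 in nhds 0. Y (R1 (x $ 1, r (x $ 2)), r (x $ 2)) = x $ 1" by simp
    moreover have "\<forall>\<^sub>F x :: real^2 in nhds 0. V (r (x $ 2)) = x $ 2" by (rule eventually_nth[OF Vr])
    ultimately show "\<forall>\<^sub>F x in nhds 0. ?N (?N' x) = x"
      by eventually_elim (simp add: vector2_eq_iff)
  qed
  then show ?thesis by (rule that)
qed

lemma K_equivalent_normal_form:
  fixes h :: "real^2 \<Rightarrow> real"
  assumes \<theta>: "inverse_diffeo_germs \<theta> \<theta>'"
    and Y: "smooth_germ Y 0" "Y 0 = 0" "dir_deriv (1, 0) Y 0 \<noteq> 0"
    and V: "smooth_germ V 0" "V 0 = 0" "dir_deriv 1 V 0 \<noteq> 0"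
    and \<epsilon>: "\<epsilon>1 * \<epsilon>1 = (1::real)"
    and h: "\<forall>\<^sub>F x in nhds 0. h (\<theta> x) = \<epsilon>1 * (Y (x $ 1, x $ 2))\<^sup>2 + \<epsilon>2 * V (x $ 2) ^ m"
  shows "K_equivalent h (\<lambda>x. (x $ 1)\<^sup>2 + \<epsilon>1 * \<epsilon>2 * (x $ 2) ^ m)"
proof -
  let ?N = "\<lambda>x :: real^2. vector [Y (x $ 1, x $ 2), V (x $ 2)] :: real^2"
  obtain N' where N: "inverse_diffeo_germs ?N N'" by (rule triangular_diffeo[OF Y V])
  note N' = inverse_diffeo_germsD[OF N]
  have "inverse_diffeo_germs (\<lambda>x. ?N (\<theta>' x)) (\<lambda>x. \<theta> (N' x))"
    by (rule inverse_diffeo_germs_compose[OF N inverse_diffeo_germs_sym[OF \<theta>]])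
  moreover have "smooth_at (\<lambda>x :: real^2. \<epsilon>1) 0"
    by (rule smooth_map_germ_imp_smooth_at[OF smooth_map_germ_const])
  moreover have "\<epsilon>1 \<noteq> 0" using \<epsilon> by auto
  moreover have "\<forall>\<^sub>F x in nhds 0. (x $ 1)\<^sup>2 + \<epsilon>1 * \<epsilon>2 * (x $ 2) ^ m = \<epsilon>1 * h (\<theta> (N' x))"
  proof -
    have "\<forall>\<^sub>F x in nhds 0. h (\<theta> (N' x)) = \<epsilon>1 * (Y (N' x $ 1, N' x $ 2))\<^sup>2 + \<epsilon>2 * V (N' x $ 2) ^ m"
      by (rule eventually_nhds_compose[OF _ smooth_map_germ_continuous[OF N'(2)]]) (use h N' in simp)
    with N'(6) show ?thesis
    proof eventually_elim
      case (elim x)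
      have "x $ 1 = Y (N' x $ 1, N' x $ 2)" "x $ 2 = V (N' x $ 2)"
        using elim(1) by (metis vector_2(1), metis vector_2(2))
      then show ?case using elim(2) \<epsilon> by (simp add: distrib_left flip: mult.assoc)
    qed
  qed
  ultimately show ?thesis unfolding K_equivalent_def
    by (intro exI[of _ "\<lambda>x. ?N (\<theta>' x)"] exI[of _ "\<lambda>x. \<theta> (N' x)"] exI[of _ "\<lambda>x. \<epsilon>1"]) simp
qed

section \<open>Second derivatives and contact equivalence\<close>

lemma dir_deriv_inner:
  "smooth_map_germ f a \<Longrightarrow> dir_deriv v (\<lambda>x. f x \<bullet> w) a = dir_deriv v f a \<bullet> w"
  by (rule dir_derivI[OF has_derivative_inner_left[OF smooth_map_germ_has_derivative]])

lemma smooth_germ_inner: "smooth_map_germ f a \<Longrightarrow> smooth_germ (\<lambda>x. f x \<bullet> w) a"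
  by (rule smooth_map_germ_imp_germ[OF _ bounded_linear_inner_left])

lemma smooth_map_germ_dir_deriv:
  fixes f :: "'a::real_normed_vector \<Rightarrow> 'b::euclidean_space"
  assumes "smooth_map_germ f a"
  shows "smooth_map_germ (dir_deriv v f) a"
proof (rule smooth_map_germ_euclideanI)
  fix b :: 'b
  have "\<forall>\<^sub>F x in nhds a. dir_deriv v (\<lambda>x. f x \<bullet> b) x = dir_deriv v f x \<bullet> b"
    using smooth_map_germ_eventually[OF assms] by eventually_elim (rule dir_deriv_inner)
  then show "smooth_germ (\<lambda>x. dir_deriv v f x \<bullet> b) a"
    by (rule smooth_germ_cong[OF _ smooth_germ_dir_deriv[OF smooth_germ_inner[OF assms]]])
qed

lemma dir_deriv2_inner:
  fixes f :: "'a::real_normed_vector \<Rightarrow> 'b::euclidean_space"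
  assumes "smooth_map_germ f a"
  shows "dir_deriv u (dir_deriv v (\<lambda>x. f x \<bullet> w)) a = dir_deriv u (dir_deriv v f) a \<bullet> w"
proof -
  have "\<forall>\<^sub>F x in nhds a. dir_deriv v (\<lambda>x. f x \<bullet> w) x = dir_deriv v f x \<bullet> w"
    using smooth_map_germ_eventually[OF assms] by eventually_elim (rule dir_deriv_inner)
  from dir_deriv_cong[OF this smooth_germ_dir_deriv[OF smooth_germ_inner[OF assms]]]
  show ?thesis by (simp add: dir_deriv_inner[OF smooth_map_germ_dir_deriv[OF assms]])
qed

lemma dir_deriv2_cong:
  assumes "\<forall>\<^sub>F x in nhds a. f x = g x" "smooth_germ f a"
  shows "dir_deriv u (dir_deriv v f) a = dir_deriv u (dir_deriv v g) a"
proof -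
  from iffD2[OF eventually_eventually assms(1)] smooth_germ_eventually[OF assms(2)]
  have "\<forall>\<^sub>F x in nhds a. dir_deriv v f x = dir_deriv v g x"
    by eventually_elim (rule dir_deriv_cong)
  then show ?thesis by (rule dir_deriv_cong[OF _ smooth_germ_dir_deriv[OF assms(2)]])
qed

lemma dir_deriv_sum:
  assumes "\<And>i. i \<in> I \<Longrightarrow> smooth_germ (f i) a"
  shows "dir_deriv v (\<lambda>x. \<Sum>i\<in>I. f i x) a = (\<Sum>i\<in>I. dir_deriv v (f i) a)"
  by (rule dir_derivI[OF has_derivative_sum]) (rule smooth_germ_has_derivative[OF assms])

lemma dir_deriv_Basis:
  fixes f :: "'a::euclidean_space \<Rightarrow> real"
  assumes "smooth_germ f a"
  shows "dir_deriv v f a = (\<Sum>b\<in>Basis. (v \<bullet> b) * dir_deriv b f a)"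
proof -
  interpret linear "\<lambda>v. dir_deriv v f a" by (rule linear_dir_deriv[OF assms])
  have "dir_deriv (\<Sum>b\<in>Basis. (v \<bullet> b) *\<^sub>R b) f a = (\<Sum>b\<in>Basis. (v \<bullet> b) * dir_deriv b f a)"
    by (simp add: sum scale)
  then show ?thesis by (simp only: euclidean_representation)
qed

lemma dir_deriv2_Basis:
  fixes f :: "'a::euclidean_space \<Rightarrow> real"
  assumes "smooth_germ f a"
  shows "dir_deriv u (dir_deriv v f) a = (\<Sum>b\<in>Basis. (v \<bullet> b) * dir_deriv u (dir_deriv b f) a)"
proof -
  have "\<forall>\<^sub>F x in nhds a. dir_deriv v f x = (\<Sum>b\<in>Basis. (v \<bullet> b) * dir_deriv b f x)"
    using smooth_germ_eventually[OF assms] by eventually_elim (rule dir_deriv_Basis)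
  from dir_deriv_cong[OF this smooth_germ_dir_deriv[OF assms]]
  show ?thesis
    by (simp add: dir_deriv_sum smooth_germ_mult smooth_germ_const smooth_germ_dir_deriv assms
        dir_deriv_mult dir_deriv_const)
qed

text \<open>
  The term with the second derivative of \<open>g\<close> is multiplied by the derivative of \<open>f\<close>, which vanishes
  at a critical point.
\<close>
lemma dir_deriv2_compose_critical:
  fixes g :: "'a::real_normed_vector \<Rightarrow> 'b::euclidean_space"
  assumes f: "smooth_germ f (g a)" and g: "smooth_map_germ g a" and crit: "\<And>w. dir_deriv w f (g a) = 0"
  shows "dir_deriv u (dir_deriv v (\<lambda>x. f (g x))) a
    = dir_deriv (dir_deriv u g a) (dir_deriv (dir_deriv v g a) f) (g a)"
proof -
  have "\<forall>\<^sub>F x in nhds a. smooth_germ f (g x)"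
    by (rule eventually_nhds_compose[OF smooth_germ_eventually[OF f] smooth_map_germ_continuous[OF g]])
  with smooth_map_germ_eventually[OF g]
  have ev: "\<forall>\<^sub>F x in nhds a. dir_deriv v (\<lambda>x. f (g x)) x
      = (\<Sum>b\<in>Basis. (dir_deriv v g x \<bullet> b) * dir_deriv b f (g x))"
  proof eventually_elim
    case (elim x)
    then show ?case using dir_deriv_compose[OF elim(2,1)] dir_deriv_Basis[OF elim(2)] by metis
  qed
  have s1: "smooth_germ (\<lambda>x. dir_deriv v g x \<bullet> b) a" for b
    by (rule smooth_germ_inner[OF smooth_map_germ_dir_deriv[OF g]])
  have s2: "smooth_germ (\<lambda>x. dir_deriv b f (g x)) a" for b
    by (rule smooth_germ_compose[OF smooth_germ_dir_deriv[OF f] g])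
  have "dir_deriv u (dir_deriv v (\<lambda>x. f (g x))) a
      = dir_deriv u (\<lambda>x. \<Sum>b\<in>Basis. (dir_deriv v g x \<bullet> b) * dir_deriv b f (g x)) a"
    by (rule dir_deriv_cong[OF ev smooth_germ_dir_deriv[OF smooth_germ_compose[OF f g]]])
  also have "\<dots> = (\<Sum>b\<in>Basis. (dir_deriv v g a \<bullet> b) * dir_deriv (dir_deriv u g a) (dir_deriv b f) (g a))"
    by (simp add: dir_deriv_sum smooth_germ_mult s1 s2 dir_deriv_mult crit
        dir_deriv_compose[OF smooth_germ_dir_deriv[OF f] g])
  also have "\<dots> = dir_deriv (dir_deriv u g a) (dir_deriv (dir_deriv v g a) f) (g a)"
    by (rule dir_deriv2_Basis[OF f, symmetric])
  finally show ?thesis .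
qed

lemma dir_deriv2_linear:
  assumes l: "bounded_linear l" and f: "smooth_germ f (l a)"
  shows "dir_deriv u (dir_deriv v (\<lambda>x. f (l x))) a = dir_deriv (l u) (dir_deriv (l v) f) (l a)"
proof -
  note sl = smooth_map_germ_bounded_linear[OF l]
  have "\<forall>\<^sub>F x in nhds a. smooth_germ f (l x)"
    by (rule eventually_nhds_compose[OF smooth_germ_eventually[OF f] smooth_map_germ_continuous[OF sl]])
  then have ev: "\<forall>\<^sub>F x in nhds a. dir_deriv v (\<lambda>x. f (l x)) x = dir_deriv (l v) f (l x)"
    by eventually_elim (simp add: dir_deriv_compose[OF _ sl] dir_deriv_bounded_linear[OF l])
  have "dir_deriv u (dir_deriv v (\<lambda>x. f (l x))) a = dir_deriv u (\<lambda>x. dir_deriv (l v) f (l x)) a"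
    by (rule dir_deriv_cong[OF ev smooth_germ_dir_deriv[OF smooth_germ_compose[OF f sl]]])
  also have "\<dots> = dir_deriv (l u) (dir_deriv (l v) f) (l a)"
    by (simp add: dir_deriv_compose[OF smooth_germ_dir_deriv[OF f] sl] dir_deriv_bounded_linear[OF l])
  finally show ?thesis .
qed

lemma inverse_diffeo_germs_derivative:
  fixes \<phi> :: "'a::euclidean_space \<Rightarrow> 'a"
  assumes "inverse_diffeo_germs \<phi> \<psi>"
  shows "dir_deriv (dir_deriv v \<phi> 0) \<psi> 0 = v"
proof -
  note * = inverse_diffeo_germsD[OF assms]
  have "((\<lambda>x. \<psi> (\<phi> x)) has_derivative (\<lambda>v. dir_deriv (dir_deriv v \<phi> 0) \<psi> 0)) (at 0)"
    by (rule has_derivative_compose[OF smooth_map_germ_has_derivative[OF *(1)]])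
      (use smooth_map_germ_has_derivative[OF *(2)] * in simp)
  moreover have "((\<lambda>x. \<psi> (\<phi> x)) has_derivative (\<lambda>v. v)) (at 0)"
  proof -
    from *(5) obtain U where "open U" "0 \<in> U" "\<And>x. x \<in> U \<Longrightarrow> \<psi> (\<phi> x) = x"
      unfolding eventually_nhds by auto
    from has_derivative_transform_within_open[OF has_derivative_ident this(1,2)] this(3) show ?thesis by simp
  qed
  ultimately show ?thesis using has_derivative_unique by metis
qed

lemma linear_dir_deriv_map: "smooth_map_germ f a \<Longrightarrow> linear (\<lambda>v. dir_deriv v f a)"
  using smooth_map_germ_has_derivative has_derivative_linear by blast

lemma dir_deriv2_mult_critical:
  assumes l: "smooth_germ l a" and m: "smooth_germ m a" "m a = 0" "\<And>v. dir_deriv v m a = 0"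
  shows "dir_deriv u (dir_deriv v (\<lambda>x. l x * m x)) a = l a * dir_deriv u (dir_deriv v m) a"
proof -
  from smooth_germ_eventually[OF l] smooth_germ_eventually[OF m(1)]
  have ev: "\<forall>\<^sub>F x in nhds a. dir_deriv v (\<lambda>x. l x * m x) x = l x * dir_deriv v m x + dir_deriv v l x * m x"
    by eventually_elim (rule dir_deriv_mult)
  have "dir_deriv u (dir_deriv v (\<lambda>x. l x * m x)) a
      = dir_deriv u (\<lambda>x. l x * dir_deriv v m x + dir_deriv v l x * m x) a"
    by (rule dir_deriv_cong[OF ev smooth_germ_dir_deriv[OF smooth_germ_mult[OF l m(1)]]])
  also have "\<dots> = l a * dir_deriv u (dir_deriv v m) a"
    by (simp add: dir_deriv_add dir_deriv_mult smooth_germ_mult smooth_germ_dir_deriv l m)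
  finally show ?thesis .
qed

text \<open>
  For \<open>n = l * (h \<circ> \<phi>')\<close> with \<open>n (0) = 0\<close> and \<open>l (0) \<noteq> 0\<close> also \<open>h (0) = 0\<close>, so derivatives of \<open>l\<close> drop
  out of the 1-jet; then \<open>h\<close> is critical and they drop out of the 2-jet as well.
\<close>
lemma K_equivalent_hessian:
  assumes "K_equivalent h n" and h: "smooth_germ h 0" and n: "n 0 = 0" "\<And>v. dir_deriv v n 0 = 0"
  obtains T :: "real^2 \<Rightarrow> real^2" and T' c where "linear T" "\<And>v. T (T' v) = v" "\<And>v. T' (T v) = v" "c \<noteq> 0"
    "\<And>v. dir_deriv v h 0 = 0"
    "\<And>u v. dir_deriv u (dir_deriv v n) 0 = c * dir_deriv (T u) (dir_deriv (T v) h) 0"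
proof -
  from assms(1) obtain \<phi> \<phi>' l where \<phi>: "inverse_diffeo_germs \<phi> \<phi>'" and l: "smooth_at l 0" "l 0 \<noteq> 0"
    and ev: "\<forall>\<^sub>F x in nhds 0. n x = l x * h (\<phi>' x)"
    unfolding K_equivalent_def by blast
  note * = inverse_diffeo_germsD[OF \<phi>]
  let ?m = "\<lambda>x. h (\<phi>' x)"
  have sl: "smooth_germ l 0"
    using smooth_map_germ_imp_germ[OF smooth_at_imp_smooth_map_germ[OF l(1)] bounded_linear_ident] .
  have sm: "smooth_germ ?m 0" by (rule smooth_germ_compose[OF _ *(2)]) (use h * in simp)
  have m0: "?m 0 = 0" using eventually_nhds_x_imp_x[OF ev] n l by simp
  define T where "T v = dir_deriv v \<phi>' 0" for v
  define T' where "T' v = dir_deriv v \<phi> 0" for v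
  have T: "linear T" "\<And>v. T (T' v) = v" "\<And>v. T' (T v) = v"
    using linear_dir_deriv_map[OF *(2)] inverse_diffeo_germs_derivative[OF \<phi>]
      inverse_diffeo_germs_derivative[OF inverse_diffeo_germs_sym[OF \<phi>]]
    by (simp_all add: T_def[abs_def] T'_def)
  have slm: "smooth_germ (\<lambda>x. l x * ?m x) 0" by (rule smooth_germ_mult[OF sl sm])
  have ev': "\<forall>\<^sub>F x in nhds 0. l x * h (\<phi>' x) = n x" using ev by eventually_elim simp
  have dm: "dir_deriv v ?m 0 = 0" for v
    using dir_deriv_cong[OF ev' slm, of v] dir_deriv_mult[OF sl sm, of v] n m0 l by simp
  have dh: "dir_deriv v h 0 = 0" for v
    using dm[of "T' v"] dir_deriv_compose[OF _ *(2), of h "T' v"] h * T by (simp add: T_def)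
  have "dir_deriv u (dir_deriv v n) 0 = l 0 * dir_deriv (T u) (dir_deriv (T v) h) 0" for u v
  proof -
    have "dir_deriv u (dir_deriv v n) 0 = dir_deriv u (dir_deriv v (\<lambda>x. l x * ?m x)) 0"
      by (rule dir_deriv2_cong[OF ev' slm, symmetric])
    also have "\<dots> = l 0 * dir_deriv u (dir_deriv v ?m) 0"
      by (rule dir_deriv2_mult_critical[OF sl sm m0 dm])
    also have "dir_deriv u (dir_deriv v ?m) 0 = dir_deriv (T u) (dir_deriv (T v) h) 0"
      using dir_deriv2_compose_critical[OF _ *(2), of h u v] h * dh by (simp add: T_def)
    finally show ?thesis .
  qed
  with T dh l(2) show ?thesis by (intro that)
qed

section \<open>Height functions in the coordinates of the normal form\<close>

definition H_map :: "nat \<Rightarrow> real^2 \<Rightarrow> real^3"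
  where "H_map n x = vector [x $ 1, x $ 1 * x $ 2 + (x $ 2) ^ n, (x $ 2) ^ 3]"

lemma smooth_germ_coord: "smooth_germ (\<lambda>x :: real^'n. x $ i) a"
  by (rule smooth_germ_bounded_linear[OF bounded_linear_vec_nth])

lemma smooth_map_germ_vector3:
  "smooth_germ f a \<Longrightarrow> smooth_germ g a \<Longrightarrow> smooth_germ h a \<Longrightarrow> smooth_map_germ (\<lambda>x. vector [f x, g x, h x] :: real^3) a"
proof (rule smooth_map_germ_cartI)
  fix i :: 3
  assume "smooth_germ f a" "smooth_germ g a" "smooth_germ h a"
  then show "smooth_germ (\<lambda>x. (vector [f x, g x, h x] :: real^3) $ i) a"
    using exhaust_3[of i] by auto
qed

lemma smooth_map_germ_H_map: "smooth_map_germ (H_map n) a"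
  unfolding H_map_def[abs_def]
  by (intro smooth_map_germ_vector3 smooth_germ_add smooth_germ_mult smooth_germ_power smooth_germ_coord)

text \<open>
  For \<open>n \<ge> 3\<close> the term \<open>y ^ n\<close> has no influence on second derivatives at 0, and when \<open>slope 2 w = 0\<close> it has
  none on the cubic term; this is all that is needed of \<open>n = 3 k - 1\<close>.
\<close>
locale H_chart =
  fixes f :: "real^2 \<Rightarrow> real^3" and \<phi> \<phi>' :: "real^2 \<Rightarrow> real^2" and \<Psi> \<Psi>' :: "real^3 \<Rightarrow> real^3" and n :: nat
  assumes \<phi>: "inverse_diffeo_germs \<phi> \<phi>'" and \<Psi>: "inverse_diffeo_germs \<Psi> \<Psi>'" and n: "n \<ge> 3"
    and f: "smooth_map_germ f 0" "f 0 = 0"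
    and chart: "\<forall>\<^sub>F x in nhds 0. f (\<phi>' x) = \<Psi> (H_map n x)"
begin

lemmas \<phi>D = inverse_diffeo_germsD[OF \<phi>]
lemmas \<Psi>D = inverse_diffeo_germsD[OF \<Psi>]

definition slope :: "3 \<Rightarrow> real^3 \<Rightarrow> real"
  where "slope i w = dir_deriv (axis i 1) \<Psi> 0 \<bullet> w"

definition curv :: "real^3 \<Rightarrow> real"
  where "curv w = dir_deriv (axis 1 1) (dir_deriv (axis 1 1) \<Psi>) 0 \<bullet> w"

text \<open>
  The derivatives of the source diffeomorphism and of its inverse at 0; \<open>S v\<close> is the tangent vector
  \<open>v\<close> in the coordinates in which \<open>f\<close> becomes \<open>H\<close>.
\<close>
definition S :: "real^2 \<Rightarrow> real^2" where "S v = dir_deriv v \<phi> 0"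
definition T :: "real^2 \<Rightarrow> real^2" where "T v = dir_deriv v \<phi>' 0"

lemma ST: "S (T v) = v" and TS: "T (S v) = v" and linear_S: "linear S" and linear_T: "linear T"
  using linear_dir_deriv_map[OF \<phi>D(2)] linear_dir_deriv_map[OF \<phi>D(1)]
    inverse_diffeo_germs_derivative[OF \<phi>] inverse_diffeo_germs_derivative[OF inverse_diffeo_germs_sym[OF \<phi>]]
  by (simp_all add: T_def[abs_def] S_def[abs_def])

lemma H_map_0: "H_map n 0 = 0"
  using n by (simp add: H_map_def vec_eq_iff forall_3)

lemma smooth_height_chart: "smooth_germ (\<lambda>x. \<Psi> (H_map n x) \<bullet> w) 0"
  by (rule smooth_germ_inner[OF smooth_map_germ_compose[OF _ smooth_map_germ_H_map]])
    (simp add: H_map_0 \<Psi>D)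

lemma has_derivative_H_map:
  "(H_map n has_derivative (\<lambda>v. vector [v $ 1, x $ 1 * v $ 2 + x $ 2 * v $ 1 + n * (x $ 2) ^ (n - 1) * v $ 2,
      3 * (x $ 2)\<^sup>2 * v $ 2])) (at x)"
proof -
  have nth: "((\<lambda>x :: real^2. x $ i) has_derivative (\<lambda>v. v $ i)) (at x)" for i
    by (rule bounded_linear_imp_has_derivative[OF bounded_linear_vec_nth])
  note c1 = nth[of 1]
  have c2: "((\<lambda>x :: real^2. x $ 1 * x $ 2 + (x $ 2) ^ n) has_derivative
      (\<lambda>v. x $ 1 * v $ 2 + x $ 2 * v $ 1 + n * (x $ 2) ^ (n - 1) * v $ 2)) (at x)"
    by (rule has_derivative_eq_rhs[OF has_derivative_add[OF has_derivative_mult[OF nth nth] has_derivative_power[OF nth]]])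
      (auto simp: algebra_simps)
  have c3: "((\<lambda>x :: real^2. (x $ 2) ^ 3) has_derivative (\<lambda>v. 3 * (x $ 2)\<^sup>2 * v $ 2)) (at x)"
    by (rule has_derivative_eq_rhs[OF has_derivative_power[OF nth]]) (auto simp: algebra_simps)
  show ?thesis
  proof (subst has_derivative_componentwise_within, intro ballI)
    fix b :: "real^3" assume "b \<in> Basis"
    then obtain i where "b = axis i 1" by (auto simp: Basis_vec_def)
    moreover have "i = 1 \<or> i = 2 \<or> i = 3" by (rule exhaust_3)
    ultimately show "((\<lambda>x. H_map n x \<bullet> b) has_derivative (\<lambda>v. vector [v $ 1,
        x $ 1 * v $ 2 + x $ 2 * v $ 1 + n * (x $ 2) ^ (n - 1) * v $ 2, 3 * (x $ 2)\<^sup>2 * v $ 2] \<bullet> b)) (at x)"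
      using c1 c2 c3 by (auto simp: H_map_def inner_axis)
  qed
qed

lemma dir_deriv_vector3:
  assumes "smooth_germ g a"
  shows "dir_deriv (vector [x, y, z] :: real^3) g a =
    x * dir_deriv (axis 1 1) g a + y * dir_deriv (axis 2 1) g a + z * dir_deriv (axis 3 1) g a"
proof -
  interpret linear "\<lambda>v. dir_deriv v g a" by (rule linear_dir_deriv[OF assms])
  have "vector [x, y, z] = x *\<^sub>R axis 1 1 + y *\<^sub>R axis 2 1 + z *\<^sub>R (axis 3 1 :: real^3)"
    by (simp add: vec_eq_iff forall_3 axis_def)
  then show ?thesis by (simp add: add scale)
qed

lemma dir_deriv_height_chart:
  "\<forall>\<^sub>F x in nhds 0. \<forall>v. dir_deriv v (\<lambda>x. \<Psi> (H_map n x) \<bullet> w) x =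
    v $ 1 * dir_deriv (axis 1 1) (\<lambda>z. \<Psi> z \<bullet> w) (H_map n x)
    + (x $ 1 * v $ 2 + x $ 2 * v $ 1 + n * (x $ 2) ^ (n - 1) * v $ 2) * dir_deriv (axis 2 1) (\<lambda>z. \<Psi> z \<bullet> w) (H_map n x)
    + (3 * (x $ 2)\<^sup>2 * v $ 2) * dir_deriv (axis 3 1) (\<lambda>z. \<Psi> z \<bullet> w) (H_map n x)"
proof -
  have "\<forall>\<^sub>F x in nhds 0. smooth_germ (\<lambda>z. \<Psi> z \<bullet> w) (H_map n x)"
    by (rule eventually_nhds_compose[OF _ smooth_map_germ_continuous[OF smooth_map_germ_H_map]])
      (use smooth_germ_eventually[OF smooth_germ_inner[OF \<Psi>D(1)]] H_map_0 in simp)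
  then show ?thesis
  proof eventually_elim
    case (elim x)
    show ?case
    proof
      fix v
      show "dir_deriv v (\<lambda>x. \<Psi> (H_map n x) \<bullet> w) x =
        v $ 1 * dir_deriv (axis 1 1) (\<lambda>z. \<Psi> z \<bullet> w) (H_map n x)
        + (x $ 1 * v $ 2 + x $ 2 * v $ 1 + n * (x $ 2) ^ (n - 1) * v $ 2) * dir_deriv (axis 2 1) (\<lambda>z. \<Psi> z \<bullet> w) (H_map n x)
        + (3 * (x $ 2)\<^sup>2 * v $ 2) * dir_deriv (axis 3 1) (\<lambda>z. \<Psi> z \<bullet> w) (H_map n x)"
        using dir_deriv_compose[OF elim smooth_map_germ_H_map, of v] dir_derivI[OF has_derivative_H_map, of v x]
          dir_deriv_vector3[OF elim] by simp
    qed
  qed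
qed

lemma dir_deriv_height_chart_0: "dir_deriv v (\<lambda>x. \<Psi> (H_map n x) \<bullet> w) 0 = v $ 1 * slope 1 w"
  using eventually_nhds_x_imp_x[OF dir_deriv_height_chart, of w] n
  by (simp add: slope_def H_map_0 dir_deriv_inner[OF \<Psi>D(1)])

lemma dir_deriv2_height_chart:
  "dir_deriv u (dir_deriv v (\<lambda>x. \<Psi> (H_map n x) \<bullet> w)) 0
    = curv w * u $ 1 * v $ 1 + slope 2 w * (u $ 1 * v $ 2 + u $ 2 * v $ 1)"
proof -
  let ?g = "\<lambda>i x. dir_deriv (axis i 1) (\<lambda>z. \<Psi> z \<bullet> w) (H_map n x)"
  have sg: "smooth_germ (dir_deriv (axis i 1) (\<lambda>z. \<Psi> z \<bullet> w)) (H_map n 0)" for i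
    using smooth_germ_dir_deriv[OF smooth_germ_inner[OF \<Psi>D(1)]] by (simp add: H_map_0)
  have s: "smooth_germ (?g i) 0" for i by (rule smooth_germ_compose[OF sg smooth_map_germ_H_map])
  have dH: "dir_deriv u (H_map n) 0 = u $ 1 *\<^sub>R axis 1 1"
    using dir_derivI[OF has_derivative_H_map, of u 0] n by (simp add: vec_eq_iff forall_3 axis_def)
  have d1: "dir_deriv u (?g 1) 0 = u $ 1 * curv w"
  proof -
    have "dir_deriv u (?g 1) 0 = dir_deriv (u $ 1 *\<^sub>R axis 1 1) (dir_deriv (axis 1 1) (\<lambda>z. \<Psi> z \<bullet> w)) 0"
      using dir_deriv_compose[OF sg smooth_map_germ_H_map, of u] dH by (simp add: H_map_0)
    also have "\<dots> = u $ 1 * dir_deriv (axis 1 1) (dir_deriv (axis 1 1) (\<lambda>z. \<Psi> z \<bullet> w)) 0"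
      using linear_cmul[OF linear_dir_deriv[OF sg], of "u $ 1" "axis 1 1"] by (simp add: H_map_0)
    finally show ?thesis by (simp add: curv_def dir_deriv2_inner[OF \<Psi>D(1)])
  qed
  let ?p = "\<lambda>x :: real^2. x $ 1 * v $ 2 + x $ 2 * v $ 1 + n * (x $ 2) ^ (n - 1) * v $ 2"
  let ?r = "\<lambda>x :: real^2. 3 * (x $ 2)\<^sup>2 * v $ 2"
  have nth: "((\<lambda>x :: real^2. x $ i) has_derivative (\<lambda>v. v $ i)) (at 0)" for i
    by (rule bounded_linear_imp_has_derivative[OF bounded_linear_vec_nth])
  have sp: "smooth_germ ?p 0" and sr: "smooth_germ ?r 0"
    by (intro smooth_germ_add smooth_germ_mult smooth_germ_const smooth_germ_power smooth_germ_coord)+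
  have "(?p has_derivative (\<lambda>u. u $ 1 * v $ 2 + u $ 2 * v $ 1)) (at 0)"
    by (auto intro!: derivative_eq_intros nth ext) (use n in \<open>auto simp: algebra_simps\<close>)
  then have dp: "dir_deriv u ?p 0 = u $ 1 * v $ 2 + u $ 2 * v $ 1" by (rule dir_derivI)
  have p0: "?p 0 = 0" using n by simp
  have "(?r has_derivative (\<lambda>u. 0)) (at 0)"
    by (auto intro!: derivative_eq_intros nth)
  then have dr: "dir_deriv u ?r 0 = 0" by (rule dir_derivI)
  have "\<forall>\<^sub>F x in nhds 0. dir_deriv v (\<lambda>x. \<Psi> (H_map n x) \<bullet> w) x = v $ 1 * ?g 1 x + ?p x * ?g 2 x + ?r x * ?g 3 x"
    using dir_deriv_height_chart[of w] by eventually_elim simp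
  from dir_deriv_cong[OF this smooth_germ_dir_deriv[OF smooth_height_chart]]
  have "dir_deriv u (dir_deriv v (\<lambda>x. \<Psi> (H_map n x) \<bullet> w)) 0
      = dir_deriv u (\<lambda>x. v $ 1 * ?g 1 x + ?p x * ?g 2 x + ?r x * ?g 3 x) 0" .
  also have "\<dots> = v $ 1 * dir_deriv u (?g 1) 0 + (?p 0 * dir_deriv u (?g 2) 0 + dir_deriv u ?p 0 * ?g 2 0)
      + (?r 0 * dir_deriv u (?g 3) 0 + dir_deriv u ?r 0 * ?g 3 0)"
    by (simp only: dir_deriv_add dir_deriv_mult smooth_germ_add smooth_germ_mult smooth_germ_const s sp sr dir_deriv_const)
  also have "\<dots> = curv w * u $ 1 * v $ 1 + slope 2 w * (u $ 1 * v $ 2 + u $ 2 * v $ 1)"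
    unfolding d1 dp dr p0 by (simp add: slope_def H_map_0 dir_deriv_inner[OF \<Psi>D(1)])
  finally show ?thesis .
qed

lemma height_eq_chart: "\<forall>\<^sub>F x in nhds 0. \<Psi> (H_map n (\<phi> x)) \<bullet> w = f x \<bullet> w"
proof -
  have "\<forall>\<^sub>F x in nhds 0. f (\<phi>' (\<phi> x)) = \<Psi> (H_map n (\<phi> x))"
    by (rule eventually_nhds_compose[OF _ smooth_map_germ_continuous[OF \<phi>D(1)]]) (use chart \<phi>D in simp)
  with \<phi>D(5) show ?thesis by eventually_elim simp
qed

lemma smooth_height_\<phi>: "smooth_germ (\<lambda>x. \<Psi> (H_map n (\<phi> x)) \<bullet> w) 0"
  by (rule smooth_germ_compose[OF _ \<phi>D(1)]) (use smooth_height_chart \<phi>D in simp)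

lemma dir_deriv_height: "dir_deriv v (\<lambda>x. f x \<bullet> w) 0 = S v $ 1 * slope 1 w"
  using dir_deriv_cong[OF height_eq_chart smooth_height_\<phi>, of v]
    dir_deriv_compose[OF _ \<phi>D(1), of "\<lambda>x. \<Psi> (H_map n x) \<bullet> w" v] smooth_height_chart \<phi>D
  by (simp add: dir_deriv_height_chart_0 S_def)

lemma dir_deriv2_height:
  assumes "slope 1 w = 0"
  shows "dir_deriv u (dir_deriv v (\<lambda>x. f x \<bullet> w)) 0
    = curv w * S u $ 1 * S v $ 1 + slope 2 w * (S u $ 1 * S v $ 2 + S u $ 2 * S v $ 1)"
  using dir_deriv2_cong[OF height_eq_chart smooth_height_\<phi>, of u v]
    dir_deriv2_compose_critical[OF _ \<phi>D(1), of "\<lambda>x. \<Psi> (H_map n x) \<bullet> w" u v] smooth_height_chart \<phi>D assms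
  by (simp add: dir_deriv_height_chart_0 S_def dir_deriv2_height_chart)

lemma dir_deriv_f: "dir_deriv v f 0 = S v $ 1 *\<^sub>R dir_deriv (axis 1 1) \<Psi> 0"
proof (rule vector_eq_ldot[THEN iffD1], intro allI)
  fix w
  show "w \<bullet> dir_deriv v f 0 = w \<bullet> S v $ 1 *\<^sub>R dir_deriv (axis 1 1) \<Psi> 0"
    using dir_deriv_height[of v w] dir_deriv_inner[OF f(1), of v w]
    by (simp add: slope_def inner_commute)
qed

end

section \<open>Principal normal, inflection point and Hessian\<close>

lemma orthogonal_triple_complement:
  fixes u v w r :: "real^3"
  assumes "u \<noteq> 0" "v \<noteq> 0" "w \<noteq> 0" "u \<bullet> v = 0" "u \<bullet> w = 0" "v \<bullet> w = 0"
    "r \<bullet> u = 0" "r \<bullet> v = 0" "r \<bullet> w = 0"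
  shows "r = 0"
proof (rule ccontr)
  assume r: "r \<noteq> 0"
  have ne: "u \<noteq> v" "u \<noteq> w" "v \<noteq> w" "r \<noteq> u" "r \<noteq> v" "r \<noteq> w"
    using assms r by (metis inner_eq_zero_iff)+
  have "pairwise orthogonal {r, u, v, w}"
    using assms by (auto simp: pairwise_def orthogonal_def inner_commute)
  then have "independent {r, u, v, w}"
    by (rule pairwise_orthogonal_independent) (use assms r in auto)
  then have "card {r, u, v, w} \<le> DIM(real^3)" using independent_bound by blast
  then show False using ne by simp
qed

lemma gl2_orbit_eqI:
  assumes "invertible A" "invertible B" and Q: "\<And>x. Q x = B *v P (A *v x)"
  shows "gl2_orbit Q = gl2_orbit P"
proof -
  obtain A' where A': "A ** A' = mat 1" "A' ** A = mat 1" using assms(1) unfolding invertible_def by blast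
  obtain B' where B': "B ** B' = mat 1" "B' ** B = mat 1" using assms(2) unfolding invertible_def by blast
  have inv': "invertible A'" "invertible B'" using A' B' unfolding invertible_def by blast+
  have P: "P x = B' *v Q (A' *v x)" for x
    by (simp add: Q matrix_vector_mul_assoc A' B')
  show ?thesis
  proof
    show "gl2_orbit Q \<subseteq> gl2_orbit P"
    proof
      fix g assume "g \<in> gl2_orbit Q"
      then obtain C D where CD: "g = (\<lambda>x. D *v Q (C *v x))" "invertible C" "invertible D"
        unfolding gl2_orbit_def by blast
      have "g = (\<lambda>x. (D ** B) *v P ((A ** C) *v x))"
        unfolding CD(1) by (simp add: Q matrix_vector_mul_assoc)
      then show "g \<in> gl2_orbit P" unfolding gl2_orbit_def using CD assms invertible_mult by blast
    qed
    show "gl2_orbit P \<subseteq> gl2_orbit Q"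
    proof
      fix g assume "g \<in> gl2_orbit P"
      then obtain C D where CD: "g = (\<lambda>x. D *v P (C *v x))" "invertible C" "invertible D"
        unfolding gl2_orbit_def by blast
      have "g = (\<lambda>x. (D ** B') *v Q ((A' ** C) *v x))"
        unfolding CD(1) by (simp add: P matrix_vector_mul_assoc)
      then show "g \<in> gl2_orbit Q" unfolding gl2_orbit_def using CD inv' invertible_mult by blast
    qed
  qed
qed

lemma invertible_mat_1: "invertible (mat 1 :: real^'n^'n)"
  unfolding invertible_def by (rule exI[of _ "mat 1"]) simp

lemma gl2_orbit_self: "Q \<in> gl2_orbit Q"
  unfolding gl2_orbit_def using invertible_mat_1 by (auto intro!: exI[of _ "mat 1"])

lemma gl2_orbitE:
  assumes "Q \<in> gl2_orbit P"
  obtains A B :: "real^2^2" where "invertible A" "\<And>x. Q x = B *v P (A *v x)"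
  using assms unfolding gl2_orbit_def by blast

context H_chart
begin

abbreviation "E1 \<equiv> axis 1 1 :: real^2"
abbreviation "E2 \<equiv> axis 2 1 :: real^2"

lemma E_nth: "E1 $ 1 = 1" "E1 $ 2 = 0" "E2 $ 1 = 0" "E2 $ 2 = 1"
  by (simp_all add: axis_def)

lemma d\<Psi>_eq_0_iff: "dir_deriv v \<Psi> 0 = 0 \<longleftrightarrow> v = 0"
proof
  assume "dir_deriv v \<Psi> 0 = 0"
  then have "dir_deriv 0 \<Psi>' 0 = v" using inverse_diffeo_germs_derivative[OF \<Psi>, of v] by simp
  then show "v = 0" using linear_0[OF linear_dir_deriv_map[OF \<Psi>D(2)]] by simp
next
  assume "v = 0"
  then show "dir_deriv v \<Psi> 0 = 0" using linear_0[OF linear_dir_deriv_map[OF \<Psi>D(1)]] by simp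
qed

lemma S_eq_0_iff: "S v = 0 \<longleftrightarrow> v = 0"
  using TS linear_0[OF linear_T] linear_0[OF linear_S] by metis

lemma slope_linear: "slope i (x *\<^sub>R v + y *\<^sub>R w) = x * slope i v + y * slope i w"
  by (simp add: slope_def inner_add_right)

lemma curv_linear: "curv (x *\<^sub>R v + y *\<^sub>R w) = x * curv v + y * curv w"
  by (simp add: curv_def inner_add_right)

text \<open>
  The three slopes are the inner products of \<open>w\<close> with the images of the standard basis under the invertible
  derivative of \<open>\<Psi>\<close>, and these images span the space.
\<close>
lemma slopes_nonzero:
  assumes "w \<noteq> 0" "slope 1 w = 0" "slope 2 w = 0"
  shows "slope 3 w \<noteq> 0"
proof
  assume "slope 3 w = 0"
  with assms have s: "slope i w = 0" for i using exhaust_3[of i] by auto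
  have all: "dir_deriv v \<Psi> 0 \<bullet> w = 0" for v
  proof -
    interpret linear "\<lambda>v. dir_deriv v \<Psi> 0" by (rule linear_dir_deriv_map[OF \<Psi>D(1)])
    have "v = (\<Sum>i\<in>UNIV. v $ i *\<^sub>R axis i 1)"
      using basis_expansion[of v] by (simp add: scalar_mult_eq_scaleR)
    then have "dir_deriv v \<Psi> 0 = dir_deriv (\<Sum>i\<in>UNIV. v $ i *\<^sub>R axis i 1) \<Psi> 0" by simp
    also have "\<dots> = (\<Sum>i\<in>UNIV. v $ i *\<^sub>R dir_deriv (axis i 1) \<Psi> 0)" by (simp add: sum scale)
    finally have "dir_deriv v \<Psi> 0 = (\<Sum>i\<in>UNIV. v $ i *\<^sub>R dir_deriv (axis i 1) \<Psi> 0)" .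
    then show ?thesis using s by (simp add: inner_sum_left slope_def)
  qed
  have "dir_deriv (dir_deriv w \<Psi>' 0) \<Psi> 0 = w"
    by (rule inverse_diffeo_germs_derivative[OF inverse_diffeo_germs_sym[OF \<Psi>]])
  with all[of "dir_deriv w \<Psi>' 0"] assms(1) show False by simp
qed

lemma normal_plane_iff: "w \<in> normal_plane f \<longleftrightarrow> slope 1 w = 0"
proof -
  have "w \<in> normal_plane f \<longleftrightarrow> (\<forall>v. w \<bullet> dir_deriv v f 0 = 0)"
    by (simp add: normal_plane_def tangent_line_def f(2) dir_deriv_def)
  also have "\<dots> \<longleftrightarrow> (\<forall>v. S v $ 1 * slope 1 w = 0)"
    by (simp add: dir_deriv_f slope_def inner_commute)
  also have "\<dots> \<longleftrightarrow> slope 1 w = 0"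
  proof
    assume "\<forall>v. S v $ 1 * slope 1 w = 0"
    from this[rule_format, of "T E1"] show "slope 1 w = 0" by (simp add: ST E_nth)
  qed simp
  finally show ?thesis .
qed

lemma null_vector_iff: "null_vector f \<eta> \<longleftrightarrow> \<eta> \<noteq> 0 \<and> S \<eta> $ 1 = 0"
proof -
  have "frechet_derivative f (at 0) \<eta> = S \<eta> $ 1 *\<^sub>R dir_deriv (axis 1 1) \<Psi> 0"
    using dir_deriv_f[of \<eta>] by (simp add: dir_deriv_def)
  then show ?thesis by (auto simp: null_vector_def d\<Psi>_eq_0_iff)
qed

lemma principal_plane_orthogonal_iff:
  "(\<forall>p\<in>principal_plane f \<xi> \<eta>. (p - f 0) \<bullet> w = 0) \<longleftrightarrow>
    dir_deriv \<xi> f 0 \<bullet> w = 0 \<and> dir_deriv \<xi> (dir_deriv \<eta> f) 0 \<bullet> w = 0"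
proof -
  have "(\<forall>p\<in>principal_plane f \<xi> \<eta>. (p - f 0) \<bullet> w = 0) \<longleftrightarrow>
      (\<forall>v \<in> span {dir_deriv \<xi> f 0, dir_deriv \<xi> (dir_deriv \<eta> f) 0}. v \<bullet> w = 0)"
    by (simp add: principal_plane_def f(2))
  also have "\<dots> \<longleftrightarrow> dir_deriv \<xi> f 0 \<bullet> w = 0 \<and> dir_deriv \<xi> (dir_deriv \<eta> f) 0 \<bullet> w = 0"
  proof
    assume *: "dir_deriv \<xi> f 0 \<bullet> w = 0 \<and> dir_deriv \<xi> (dir_deriv \<eta> f) 0 \<bullet> w = 0"
    show "\<forall>v \<in> span {dir_deriv \<xi> f 0, dir_deriv \<xi> (dir_deriv \<eta> f) 0}. v \<bullet> w = 0"
    proof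
      fix v assume "v \<in> span {dir_deriv \<xi> f 0, dir_deriv \<xi> (dir_deriv \<eta> f) 0}"
      then have "orthogonal w v"
        by (rule orthogonal_to_span) (use * in \<open>auto simp: orthogonal_def inner_commute\<close>)
      then show "v \<bullet> w = 0" by (simp add: orthogonal_def inner_commute)
    qed
  qed (simp add: span_base)
  finally show ?thesis .
qed

text \<open>
  In the coordinates of \<open>H\<close> a null vector is a multiple of the second basis vector, and a vector
  \<open>\<xi>\<close> independent of it has nonzero first coordinate. So \<open>\<xi>\<eta>f \<bullet> w\<close> is a nonzero multiple of
  \<open>slope 2 w\<close> once \<open>slope 1 w = 0\<close>.
\<close>
lemma principal_normal_iff: "principal_normal f w \<longleftrightarrow> norm w = 1 \<and> slope 1 w = 0 \<and> slope 2 w = 0"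
proof
  assume "principal_normal f w"
  then obtain \<xi> \<eta> where w: "norm w = 1" and \<eta>: "\<eta> \<noteq> 0" "S \<eta> $ 1 = 0" and "\<xi> \<noteq> \<eta>"
    and ind: "independent {\<xi>, \<eta>}" and d: "dir_deriv \<xi> f 0 \<bullet> w = 0" "dir_deriv \<xi> (dir_deriv \<eta> f) 0 \<bullet> w = 0"
    unfolding principal_normal_def null_vector_iff principal_plane_orthogonal_iff by blast
  have \<eta>2: "S \<eta> $ 2 \<noteq> 0" using S_eq_0_iff[of \<eta>] \<eta> by (auto simp: vector2_eq_iff)
  have \<xi>1: "S \<xi> $ 1 \<noteq> 0"
  proof
    assume "S \<xi> $ 1 = 0"
    then have "S (\<xi> - (S \<xi> $ 2 / S \<eta> $ 2) *\<^sub>R \<eta>) = 0"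
      using \<eta> \<eta>2 by (simp add: vector2_eq_iff linear_diff[OF linear_S] linear_cmul[OF linear_S])
    then have "\<xi> = (S \<xi> $ 2 / S \<eta> $ 2) *\<^sub>R \<eta>" by (simp add: S_eq_0_iff)
    then have "\<xi> \<in> span {\<eta>}" by (metis span_base span_scale singletonI)
    then show False using ind \<open>\<xi> \<noteq> \<eta>\<close> by (simp add: independent_insert)
  qed
  have s1: "slope 1 w = 0" using d(1) \<xi>1 by (simp add: dir_deriv_f slope_def)
  have "slope 2 w = 0"
    using d(2) dir_deriv2_height[OF s1, of \<xi> \<eta>] dir_deriv2_inner[OF f(1), of \<xi> \<eta> w] \<eta> \<xi>1 \<eta>2 by simp
  with w s1 show "norm w = 1 \<and> slope 1 w = 0 \<and> slope 2 w = 0" by simp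
next
  assume *: "norm w = 1 \<and> slope 1 w = 0 \<and> slope 2 w = 0"
  have nz: "T E2 \<noteq> 0" using ST[of E2] S_eq_0_iff[of "T E2"] by (auto simp: E_nth vector2_eq_iff)
  have notin: "T E1 \<notin> span {T E2}"
  proof
    assume "T E1 \<in> span {T E2}"
    then obtain c where "T E1 = c *\<^sub>R T E2" by (auto simp: span_singleton)
    then have "S (T E1) = c *\<^sub>R S (T E2)" by (simp add: linear_cmul[OF linear_S])
    then show False by (simp add: ST vector2_eq_iff E_nth)
  qed
  have "T E1 \<noteq> T E2" using notin span_base by blast
  moreover have "independent {T E1, T E2}" using notin nz by (simp add: independent_insert)
  moreover have "null_vector f (T E2)" by (simp add: null_vector_iff nz ST E_nth)
  moreover have "dir_deriv (T E1) f 0 \<bullet> w = 0" using * by (simp add: dir_deriv_f slope_def)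
  moreover have "dir_deriv (T E1) (dir_deriv (T E2) f) 0 \<bullet> w = 0"
    using * dir_deriv2_height[of w "T E1" "T E2"] dir_deriv2_inner[OF f(1), of "T E1" "T E2" w]
    by (simp add: ST E_nth)
  ultimately show "principal_normal f w"
    unfolding principal_normal_def principal_plane_orthogonal_iff using * by blast
qed

lemma jet2_height:
  assumes "slope 1 w = 0"
  shows "jet2 (\<lambda>x. (f x - f 0) \<bullet> w) x = curv w / 2 * (S x $ 1)\<^sup>2 + slope 2 w * (S x $ 1 * S x $ 2)"
  using dir_deriv_height[of x w] dir_deriv2_height[OF assms, of x x] assms
  by (simp add: jet2_def f(2) power2_eq_square algebra_simps)

lemma mult_vector2_0:
  fixes B :: "real^2^2"
  shows "(B *v vector [p, 0]) $ i = B $ i $ 1 * p"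
  by (simp add: matrix_vector_mult_def sum_2)

text \<open>
  At an inflection point every combination of the two quadratic forms is a multiple of one nondegenerate form.
  The principal normal \<open>w\<close> is a combination of the frame vectors, and the corresponding
  form \<open>curv w / 2 * x^2\<close> has rank at most 1, so it must vanish.
\<close>
lemma inflection_point_imp:
  assumes w: "norm w = 1" "slope 1 w = 0" "slope 2 w = 0" and "inflection_point f"
  shows "curv w = 0"
proof -
  from assms(4) obtain e1 e2 where e: "norm e1 = 1" "norm e2 = 1" "e1 \<bullet> e2 = 0"
    and n: "slope 1 e1 = 0" "slope 1 e2 = 0"
    and orbs: "gl2_orbit (\<lambda>x. vector [jet2 (\<lambda>x. (f x - f 0) \<bullet> e1) x, jet2 (\<lambda>x. (f x - f 0) \<bullet> e2) x])
        = gl2_orbit (\<lambda>x. vector [(x $ 1)\<^sup>2 + (x $ 2)\<^sup>2, 0]) \<or>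
      gl2_orbit (\<lambda>x. vector [jet2 (\<lambda>x. (f x - f 0) \<bullet> e1) x, jet2 (\<lambda>x. (f x - f 0) \<bullet> e2) x])
        = gl2_orbit (\<lambda>x. vector [(x $ 1)\<^sup>2 - (x $ 2)\<^sup>2, 0])"
    unfolding inflection_point_def Let_def f(2) add_0 normal_plane_iff by blast
  from orbs obtain \<sigma> :: real where \<sigma>: "\<sigma> = 1 \<or> \<sigma> = -1"
    and orb: "gl2_orbit (\<lambda>x. vector [jet2 (\<lambda>x. (f x - f 0) \<bullet> e1) x, jet2 (\<lambda>x. (f x - f 0) \<bullet> e2) x])
      = gl2_orbit (\<lambda>x. vector [(x $ 1)\<^sup>2 + \<sigma> * (x $ 2)\<^sup>2, 0])"
  proof
    assume "gl2_orbit (\<lambda>x. vector [jet2 (\<lambda>x. (f x - f 0) \<bullet> e1) x, jet2 (\<lambda>x. (f x - f 0) \<bullet> e2) x])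
        = gl2_orbit (\<lambda>x. vector [(x $ 1)\<^sup>2 + (x $ 2)\<^sup>2, 0])"
    then show thesis by (intro that[of 1]) simp_all
  next
    assume "gl2_orbit (\<lambda>x. vector [jet2 (\<lambda>x. (f x - f 0) \<bullet> e1) x, jet2 (\<lambda>x. (f x - f 0) \<bullet> e2) x])
        = gl2_orbit (\<lambda>x. vector [(x $ 1)\<^sup>2 - (x $ 2)\<^sup>2, 0])"
    then show thesis by (intro that[of "-1"]) simp_all
  qed
  let ?P = "\<lambda>x :: real^2. (x $ 1)\<^sup>2 + \<sigma> * (x $ 2)\<^sup>2"
  have "(\<lambda>x. vector [jet2 (\<lambda>x. (f x - f 0) \<bullet> e1) x, jet2 (\<lambda>x. (f x - f 0) \<bullet> e2) x])
      \<in> gl2_orbit (\<lambda>x. vector [?P x, 0])"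
    unfolding orb[symmetric] by (rule gl2_orbit_self)
  then obtain A B :: "real^2^2" where A: "invertible A"
    and Q: "\<And>x. vector [jet2 (\<lambda>x. (f x - f 0) \<bullet> e1) x, jet2 (\<lambda>x. (f x - f 0) \<bullet> e2) x] = B *v vector [?P (A *v x), 0]"
    by (rule gl2_orbitE) (rule that)
  let ?L = "dir_deriv (axis 1 1) \<Psi> 0"
  have L: "?L \<noteq> 0" by (simp add: d\<Psi>_eq_0_iff)
  have ee: "e1 \<bullet> e1 = 1" "e2 \<bullet> e2 = 1" "e2 \<bullet> e1 = 0"
    using e by (simp_all add: dot_square_norm inner_commute)
  have nL: "e1 \<bullet> ?L = 0" "e2 \<bullet> ?L = 0" "w \<bullet> ?L = 0"
    using n w(2) by (simp_all add: slope_def inner_commute)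
  define s where "s = w \<bullet> e1"
  define t where "t = w \<bullet> e2"
  have "w - (s *\<^sub>R e1 + t *\<^sub>R e2) = 0"
  proof (rule orthogonal_triple_complement[of e1 e2 ?L])
    show "(w - (s *\<^sub>R e1 + t *\<^sub>R e2)) \<bullet> e1 = 0" "(w - (s *\<^sub>R e1 + t *\<^sub>R e2)) \<bullet> e2 = 0"
      by (simp_all add: s_def t_def inner_diff_left inner_add_left ee e(3))
    show "(w - (s *\<^sub>R e1 + t *\<^sub>R e2)) \<bullet> ?L = 0"
      by (simp add: inner_diff_left inner_add_left nL)
  qed (use e nL L in auto)
  then have w_eq: "w = s *\<^sub>R e1 + t *\<^sub>R e2" by simp
  have key: "curv w / 2 * (S x $ 1)\<^sup>2 = (s * B $ 1 $ 1 + t * B $ 2 $ 1) * ?P (A *v x)" for x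
  proof -
    have q1: "curv e1 / 2 * (S x $ 1)\<^sup>2 + slope 2 e1 * (S x $ 1 * S x $ 2) = B $ 1 $ 1 * ?P (A *v x)"
      using arg_cong[OF Q[of x], of "\<lambda>v. v $ 1"] unfolding mult_vector2_0 jet2_height[OF n(1)] by simp
    have q2: "curv e2 / 2 * (S x $ 1)\<^sup>2 + slope 2 e2 * (S x $ 1 * S x $ 2) = B $ 2 $ 1 * ?P (A *v x)"
      using arg_cong[OF Q[of x], of "\<lambda>v. v $ 2"] unfolding mult_vector2_0 jet2_height[OF n(2)] by simp
    have z: "s * slope 2 e1 + t * slope 2 e2 = 0" using w(3) w_eq slope_linear by metis
    have cw: "curv w = s * curv e1 + t * curv e2" using w_eq curv_linear by metis
    have "curv w / 2 * (S x $ 1)\<^sup>2 =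
        s * (curv e1 / 2 * (S x $ 1)\<^sup>2 + slope 2 e1 * (S x $ 1 * S x $ 2))
        + t * (curv e2 / 2 * (S x $ 1)\<^sup>2 + slope 2 e2 * (S x $ 1 * S x $ 2))
        - (s * slope 2 e1 + t * slope 2 e2) * (S x $ 1 * S x $ 2)"
      unfolding cw by (simp add: algebra_simps)
    also have "\<dots> = s * (B $ 1 $ 1 * ?P (A *v x)) + t * (B $ 2 $ 1 * ?P (A *v x))"
      unfolding q1 q2 z by simp
    finally show ?thesis by (simp add: algebra_simps)
  qed
  define \<kappa> where "\<kappa> = s * B $ 1 $ 1 + t * B $ 2 $ 1"
  obtain A' where A': "A ** A' = mat 1" using A unfolding invertible_def by blast
  have AA': "A *v (A' *v y) = y" for y by (simp add: matrix_vector_mul_assoc A')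
  have k: "curv w / 2 * (S (A' *v y) $ 1)\<^sup>2 = \<kappa> * ?P y" for y
    using key[of "A' *v y"] unfolding AA' \<kappa>_def .
  show ?thesis
  proof (rule ccontr)
    assume c: "curv w \<noteq> 0"
    from \<sigma> show False
    proof
      assume \<sigma>: "\<sigma> = 1"
      have "\<kappa> * ?P (A *v T E2) = 0" using key[of "T E2"] by (simp add: \<kappa>_def ST E_nth)
      moreover have "\<kappa> \<noteq> 0"
        using key[of "T E1"] c by (auto simp: \<kappa>_def ST E_nth)
      ultimately have "?P (A *v T E2) = 0" by simp
      then have "A *v T E2 = 0" using \<sigma> by (simp add: vector2_eq_iff sum_power2_eq_zero_iff)
      moreover obtain A'' where "A'' ** A = mat 1" using A unfolding invertible_def by blast
      then have "A'' *v (A *v T E2) = T E2" by (simp add: matrix_vector_mul_assoc)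
      ultimately have "T E2 = 0" by simp
      then show False using ST[of E2] linear_0[OF linear_S] by (metis E_nth(4) zero_index zero_neq_one)
    next
      assume \<sigma>: "\<sigma> = - 1"
      have "curv w / 2 * (S (A' *v E1) $ 1)\<^sup>2 = \<kappa>" "curv w / 2 * (S (A' *v E2) $ 1)\<^sup>2 = - \<kappa>"
        using k[of E1] k[of E2] \<sigma> by (simp_all add: E_nth)
      then have "curv w / 2 * ((S (A' *v E1) $ 1)\<^sup>2 + (S (A' *v E2) $ 1)\<^sup>2) = 0" by (simp add: distrib_left)
      then have z: "S (A' *v E1) $ 1 = 0" using c by (simp add: sum_power2_eq_zero_iff)
      then have "\<kappa> = 0" using k[of E1] \<sigma> by (simp add: E_nth)
      then show False using key[of "T E1"] c by (simp add: \<kappa>_def[symmetric] ST E_nth)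
    qed
  qed
qed

text \<open>
  Take \<open>w\<close> as the second vector of the frame. Its form vanishes, and the form of the other vector \<open>e1\<close> is
  \<open>x * (\<alpha> * x + \<beta> * y)\<close>; here \<open>\<beta> = slope 2 e1 \<noteq> 0\<close>, because \<open>slope 2\<close> vanishes at \<open>w\<close> and cannot
  vanish on the whole normal plane. This is a difference of two squares.
\<close>
lemma inflection_pointI:
  assumes w: "norm w = 1" "slope 1 w = 0" "slope 2 w = 0" and c: "curv w = 0"
  shows "inflection_point f"
proof -
  let ?L = "\<lambda>i. dir_deriv (axis i 1) \<Psi> 0"
  have "dim {?L 1, w} \<le> card {?L 1, w}" by (rule dim_le_card) (auto simp: span_base)
  also have "\<dots> \<le> 2" by (simp add: card_insert_if)
  also have "(2::nat) < DIM(real^3)" by simp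
  finally obtain e where e: "e \<noteq> 0" "\<And>y. y \<in> span {?L 1, w} \<Longrightarrow> orthogonal e y"
    using orthogonal_to_subspace_exists by blast
  define e1 where "e1 = e /\<^sub>R norm e"
  have e1: "norm e1 = 1" "e1 \<bullet> w = 0" "slope 1 e1 = 0"
    using e(1) e(2)[of w] e(2)[of "?L 1"]
    by (simp_all add: e1_def slope_def orthogonal_def span_base inner_commute)
  have b: "slope 2 e1 \<noteq> 0"
  proof
    assume b0: "slope 2 e1 = 0"
    \<comment> \<open>Otherwise \<open>?L 2\<close> is orthogonal to \<open>w\<close> and \<open>e1\<close>, as \<open>?L 1\<close> is, and its component orthogonal to \<open>?L 1\<close> vanishes.\<close>
    define m where "m = (?L 2 \<bullet> ?L 1) / (?L 1 \<bullet> ?L 1)"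
    have L1: "?L 1 \<noteq> 0" by (simp add: d\<Psi>_eq_0_iff)
    have "?L 2 - m *\<^sub>R ?L 1 = 0"
    proof (rule orthogonal_triple_complement[of "?L 1" w e1])
      show "(?L 2 - m *\<^sub>R ?L 1) \<bullet> ?L 1 = 0" using L1 by (simp add: m_def inner_diff_left)
      show "(?L 2 - m *\<^sub>R ?L 1) \<bullet> w = 0" "(?L 2 - m *\<^sub>R ?L 1) \<bullet> e1 = 0"
        using w e1 b0 by (simp_all add: slope_def inner_diff_left)
    qed (use w e1 L1 in \<open>auto simp: slope_def inner_commute\<close>)
    then have "dir_deriv (axis 2 1 - m *\<^sub>R axis 1 1) \<Psi> 0 = 0"
      using linear_diff[OF linear_dir_deriv_map[OF \<Psi>D(1)]] linear_cmul[OF linear_dir_deriv_map[OF \<Psi>D(1)]] by simp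
    then have "axis 2 1 - m *\<^sub>R axis 1 1 = (0 :: real^3)" by (simp add: d\<Psi>_eq_0_iff)
    from arg_cong[OF this, of "\<lambda>v. v $ 2"] show False by (simp add: axis_def)
  qed
  define \<alpha> where "\<alpha> = curv e1 / 2"
  define \<beta> where "\<beta> = slope 2 e1"
  have \<beta>: "\<beta> \<noteq> 0" using b by (simp add: \<beta>_def)
  \<comment> \<open>Half the sum and half the difference of the two linear factors.\<close>
  let ?M = "\<lambda>x. vector [(S x $ 1 + \<alpha> * S x $ 1 + \<beta> * S x $ 2) / 2,
      (S x $ 1 - \<alpha> * S x $ 1 - \<beta> * S x $ 2) / 2] :: real^2"
  have linM: "linear ?M"
    by (rule linearI)
      (simp_all add: vector2_eq_iff linear_add[OF linear_S] linear_cmul[OF linear_S] field_simps)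
  have injM: "inj ?M"
  proof (rule linear_injective_0[OF linM, THEN iffD2], intro allI impI)
    fix x assume "?M x = 0"
    then have "(S x $ 1 + \<alpha> * S x $ 1 + \<beta> * S x $ 2) / 2 = 0" "(S x $ 1 - \<alpha> * S x $ 1 - \<beta> * S x $ 2) / 2 = 0"
      by (simp_all add: vector2_eq_iff)
    then have "S x $ 1 = 0" "\<beta> * S x $ 2 = 0" by (auto simp: field_simps)
    then have "S x = 0" using \<beta> by (simp add: vector2_eq_iff)
    then show "x = 0" by (simp add: S_eq_0_iff)
  qed
  have M: "matrix ?M *v x = ?M x" for x using matrix_works linM by (simp add: linear_matrix_vector_mul_eq matrix_vector_mul(1))
  have invM: "invertible (matrix ?M)"
  proof -
    have "(*v) (matrix ?M) = ?M" by (rule ext) (rule M)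
    then show ?thesis
      using injM unfolding invertible_left_inverse matrix_left_invertible_injective by simp
  qed
  let ?P = "\<lambda>x :: real^2. vector [(x $ 1)\<^sup>2 - (x $ 2)\<^sup>2, 0] :: real^2"
  let ?Q = "\<lambda>x. vector [jet2 (\<lambda>x. (f x - f 0) \<bullet> e1) x, jet2 (\<lambda>x. (f x - f 0) \<bullet> w) x] :: real^2"
  have "?Q x = mat 1 *v ?P (matrix ?M *v x)" for x
  proof -
    have "\<alpha> * (S x $ 1)\<^sup>2 + \<beta> * (S x $ 1 * S x $ 2) = (?M x $ 1)\<^sup>2 - (?M x $ 2)\<^sup>2"
      by (simp add: field_simps power2_eq_square)
    then show ?thesis
      unfolding M jet2_height[OF e1(3)] jet2_height[OF w(2)] using w(3) c by (simp add: \<alpha>_def \<beta>_def)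
  qed
  then have "gl2_orbit ?Q = gl2_orbit ?P" by (rule gl2_orbit_eqI[OF invM invertible_mat_1])
  moreover have "f 0 + e1 \<in> normal_plane f" "f 0 + w \<in> normal_plane f"
    using e1 w by (simp_all add: f(2) normal_plane_iff)
  ultimately show ?thesis unfolding inflection_point_def Let_def using e1 w by blast
qed

lemma inflection_point_iff:
  assumes "principal_normal f w"
  shows "inflection_point f \<longleftrightarrow> curv w = 0"
  using assms inflection_point_imp inflection_pointI unfolding principal_normal_iff by blast

lemma singular_germ_height_iff: "singular_germ (\<lambda>x. f x \<bullet> w) \<longleftrightarrow> slope 1 w = 0"
proof
  assume "singular_germ (\<lambda>x. f x \<bullet> w)"
  then have "dir_deriv (T E1) (\<lambda>x. f x \<bullet> w) 0 = 0" unfolding singular_germ_def by (rule dir_derivI)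
  then show "slope 1 w = 0" by (simp add: dir_deriv_height ST E_nth)
next
  assume s: "slope 1 w = 0"
  have "((\<lambda>x. f x \<bullet> w) has_derivative (\<lambda>v. dir_deriv v (\<lambda>x. f x \<bullet> w) 0)) (at 0)"
    by (rule smooth_germ_has_derivative[OF smooth_germ_inner[OF f(1)]])
  then show "singular_germ (\<lambda>x. f x \<bullet> w)" unfolding singular_germ_def by (simp add: dir_deriv_height s)
qed

lemma hessian_mult:
  assumes "slope 1 w = 0"
  shows "u \<bullet> (hessian (\<lambda>x. f x \<bullet> w) *v v) =
    curv w * S u $ 1 * S v $ 1 + slope 2 w * (S u $ 1 * S v $ 2 + S u $ 2 * S v $ 1)"
proof -
  let ?D = "\<lambda>u v. curv w * S u $ 1 * S v $ 1 + slope 2 w * (S u $ 1 * S v $ 2 + S u $ 2 * S v $ 1)"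
  have Sv: "S v = v $ 1 *\<^sub>R S E1 + v $ 2 *\<^sub>R S E2" for v
  proof -
    have "v = v $ 1 *\<^sub>R E1 + v $ 2 *\<^sub>R E2" by (simp add: vector2_eq_iff E_nth)
    then have "S v = S (v $ 1 *\<^sub>R E1 + v $ 2 *\<^sub>R E2)" by simp
    then show ?thesis by (simp add: linear_add[OF linear_S] linear_cmul[OF linear_S])
  qed
  have gen: "u \<bullet> (A *v v) = (\<Sum>i\<in>UNIV. \<Sum>j\<in>UNIV. u $ i * (A $ i $ j * v $ j))" for A :: "real^2^2"
    by (simp add: inner_vec_def matrix_vector_mult_def sum_distrib_left)
  have H: "hessian (\<lambda>x. f x \<bullet> w) $ i $ j = ?D (axis i 1) (axis j 1)" for i j
    by (simp add: hessian_def dir_deriv2_height[OF assms])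
  have "u \<bullet> (hessian (\<lambda>x. f x \<bullet> w) *v v) = (\<Sum>i\<in>UNIV. \<Sum>j\<in>UNIV. u $ i * (?D (axis i 1) (axis j 1) * v $ j))"
    unfolding gen H ..
  also have "\<dots> = ?D u v"
    unfolding Sv[of u] Sv[of v] by (simp add: sum_2 algebra_simps)
  finally show ?thesis .
qed

lemma hessian_height_eq_0_iff:
  assumes "slope 1 w = 0"
  shows "hessian (\<lambda>x. f x \<bullet> w) = 0 \<longleftrightarrow> slope 2 w = 0 \<and> curv w = 0"
proof
  assume "hessian (\<lambda>x. f x \<bullet> w) = 0"
  then show "slope 2 w = 0 \<and> curv w = 0"
    using hessian_mult[OF assms, of "T E1" "T E1"] hessian_mult[OF assms, of "T E1" "T E2"]
    by (simp add: ST E_nth)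
next
  assume "slope 2 w = 0 \<and> curv w = 0"
  then show "hessian (\<lambda>x. f x \<bullet> w) = 0"
    by (simp add: hessian_def dir_deriv2_height[OF assms] vec_eq_iff)
qed

lemma rank_hessian_1_imp:
  assumes s: "slope 1 w = 0" and r: "rank (hessian (\<lambda>x. f x \<bullet> w)) = 1"
  shows "slope 2 w = 0" "curv w \<noteq> 0"
proof -
  let ?H = "hessian (\<lambda>x. f x \<bullet> w)"
  show s2: "slope 2 w = 0"
  proof (rule ccontr)
    assume b: "slope 2 w \<noteq> 0"
    have "inj ((*v) ?H)"
    proof (rule linear_injective_0[OF matrix_vector_mul_linear, THEN iffD2], intro allI impI)
      fix v assume v: "?H *v v = 0"
      have "S v $ 1 = 0" using hessian_mult[OF s, of "T E2" v] v b by (simp add: ST E_nth)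
      moreover have "S v $ 2 = 0"
        using hessian_mult[OF s, of "T E1" v] v b calculation by (simp add: ST E_nth)
      ultimately show "v = 0" using S_eq_0_iff[of v] by (simp add: vector2_eq_iff)
    qed
    then have "rank ?H = CARD(2)" using full_rank_injective by blast
    then show False using r by simp
  qed
  show "curv w \<noteq> 0"
  proof
    assume "curv w = 0"
    then have "?H = 0" using hessian_height_eq_0_iff[OF s] s2 by simp
    then have "rank ?H = 0" by (simp add: rank_dim_range image_constant_conv)
    then show False using r by simp
  qed
qed

end

section \<open>Singularity types: Hessian conditions and the Morse case\<close>

lemma A_germ_derivatives:
  fixes \<sigma> :: real and k :: nat
  defines "g \<equiv> (\<lambda>x :: real^2. (x $ 1)\<^sup>2 + \<sigma> * (x $ 2) ^ (k + 1))"
  assumes "k \<ge> 1"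
  shows "dir_deriv v g 0 = 0"
    "dir_deriv u (dir_deriv v g) 0 = 2 * u $ 1 * v $ 1 + \<sigma> * (k + 1) * k * 0 ^ (k - 1) * u $ 2 * v $ 2"
proof -
  have nth: "((\<lambda>x :: real^2. x $ i) has_derivative (\<lambda>v. v $ i)) (at y)" for i y
    by (rule bounded_linear_imp_has_derivative[OF bounded_linear_vec_nth])
  have pow: "((\<lambda>x :: real^2. (x $ 2) ^ (k + 1)) has_derivative (\<lambda>v. (k + 1) * (x $ 2) ^ k * v $ 2)) (at x)" for x
    by (rule has_derivative_eq_rhs[OF has_derivative_power[OF nth]]) (auto simp: algebra_simps)
  have "(g has_derivative (\<lambda>v. 2 * x $ 1 * v $ 1 + \<sigma> * (k + 1) * (x $ 2) ^ k * v $ 2)) (at x)" for x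
    unfolding g_def
    by (rule has_derivative_eq_rhs[OF has_derivative_add[OF has_derivative_power[OF nth] has_derivative_mult[OF has_derivative_const pow]]])
      (auto simp: algebra_simps)
  then have d: "dir_deriv v g = (\<lambda>x. 2 * x $ 1 * v $ 1 + \<sigma> * (k + 1) * (x $ 2) ^ k * v $ 2)"
    by (intro ext dir_derivI)
  show "dir_deriv v g 0 = 0" using assms(2) by (simp add: d)
  have "((\<lambda>x :: real^2. 2 * x $ 1 * v $ 1 + \<sigma> * (k + 1) * (x $ 2) ^ k * v $ 2) has_derivative
      (\<lambda>u. 2 * u $ 1 * v $ 1 + \<sigma> * (k + 1) * k * 0 ^ (k - 1) * u $ 2 * v $ 2)) (at 0)"
    by (auto intro!: derivative_eq_intros nth simp: algebra_simps)
  then show "dir_deriv u (dir_deriv v g) 0 = 2 * u $ 1 * v $ 1 + \<sigma> * (k + 1) * k * 0 ^ (k - 1) * u $ 2 * v $ 2"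
    unfolding d by (rule dir_derivI)
qed

lemma A_singularity_K_equivalent:
  assumes "A_singularity k h"
  obtains \<sigma> :: real where "k \<ge> 1" "\<sigma> = 1 \<or> \<sigma> = -1" "K_equivalent h (\<lambda>x. (x $ 1)\<^sup>2 + \<sigma> * (x $ 2) ^ (k + 1))"
proof -
  from assms consider "K_equivalent h (\<lambda>x. (x $ 1)\<^sup>2 + (x $ 2) ^ (k + 1))"
    | "K_equivalent h (\<lambda>x. (x $ 1)\<^sup>2 - (x $ 2) ^ (k + 1))"
    unfolding A_singularity_def by blast
  then show ?thesis
  proof cases
    case 1
    then show ?thesis using assms by (intro that[of 1]) (simp_all add: A_singularity_def)
  next
    case 2
    then show ?thesis using assms by (intro that[of "-1"]) (simp_all add: A_singularity_def)
  qed
qed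

lemma A_singularityI:
  assumes "K_equivalent h (\<lambda>x. (x $ 1)\<^sup>2 + \<sigma> * (x $ 2) ^ (k + 1))" "k \<ge> 1" "\<sigma> = 1 \<or> \<sigma> = -1"
  shows "A_singularity k h"
  using assms unfolding A_singularity_def by auto

lemma bounded_linear_vector2:
  fixes f :: "'a::real_normed_vector \<Rightarrow> real^2"
  assumes "bounded_linear (\<lambda>x. f x $ 1)" "bounded_linear (\<lambda>x. f x $ 2)"
  shows "bounded_linear f"
proof -
  have "f x = f x $ 1 *\<^sub>R axis 1 1 + f x $ 2 *\<^sub>R axis 2 1" for x
    by (simp add: vector2_eq_iff axis_def)
  have "bounded_linear (\<lambda>x. f x $ 1 *\<^sub>R axis 1 1 + f x $ 2 *\<^sub>R (axis 2 1 :: real^2))"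
    by (intro bounded_linear_add bounded_linear_compose[OF bounded_linear_scaleR_left] assms)
  moreover have "f = (\<lambda>x. f x $ 1 *\<^sub>R axis 1 1 + f x $ 2 *\<^sub>R axis 2 1)" by (rule ext) fact
  ultimately show ?thesis by (rule ssubst[rotated])
qed

text \<open>
  The pair of space coordinates is written as \<open>(fst x, fst (snd x))\<close>, the form in which a square is split off in
  one variable after the other. First and second derivatives in space directions at 0 involve only the member
  with parameter 0.
\<close>
lemma family_product_form:
  fixes G :: "(real^2) \<times> 'p::real_normed_vector \<Rightarrow> real"
  assumes G: "smooth_germ G 0" and r: "\<forall>\<^sub>F x in nhds 0. G (x, 0) = r x"
  defines "G' \<equiv> (\<lambda>x :: real \<times> real \<times> 'p. G (vector [fst x, fst (snd x)], snd (snd x)))"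
  shows "smooth_germ G' 0"
    "dir_deriv (v $ 1, v $ 2, 0) G' 0 = dir_deriv v r 0"
    "dir_deriv (u $ 1, u $ 2, 0) (dir_deriv (v $ 1, v $ 2, 0) G') 0 = dir_deriv u (dir_deriv v r) 0"
proof -
  have m: "smooth_map_germ (\<lambda>x :: real \<times> real \<times> 'p. (vector [fst x, fst (snd x)] :: real^2, snd (snd x))) 0"
    by (intro smooth_map_germ_Pair smooth_map_germ_vector2 smooth_germ_fst
        smooth_germ_compose[OF smooth_germ_fst smooth_map_germ_snd]
        smooth_map_germ_compose[OF smooth_map_germ_snd smooth_map_germ_snd])
  have z: "(vector [0, 0] :: real^2) = 0" by (simp add: vector2_eq_iff)
  show s: "smooth_germ G' 0" unfolding G'_def
    by (rule smooth_germ_compose[OF _ m]) (use G in \<open>simp add: z Pair_zero_eq_zero\<close>)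
  let ?\<iota> = "\<lambda>x :: real^2. (x $ 1, x $ 2, 0 :: 'p)"
  have \<iota>: "bounded_linear ?\<iota>"
    by (intro bounded_linear_Pair bounded_linear_vec_nth bounded_linear_zero)
  have "(vector [x $ 1, x $ 2] :: real^2) = x" for x by (simp add: vector2_eq_iff)
  then have ev: "\<forall>\<^sub>F x in nhds 0. G' (?\<iota> x) = r x" using r by (simp add: G'_def)
  have s': "smooth_germ G' (?\<iota> 0)" using s by (simp add: Pair_zero_eq_zero)
  have sc: "smooth_germ (\<lambda>x. G' (?\<iota> x)) 0"
    by (rule smooth_germ_compose[OF s' smooth_map_germ_bounded_linear[OF \<iota>]])
  show "dir_deriv (v $ 1, v $ 2, 0) G' 0 = dir_deriv v r 0"
    using dir_deriv_cong[OF ev sc, of v] dir_deriv_compose[OF s' smooth_map_germ_bounded_linear[OF \<iota>], of v]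
      dir_deriv_bounded_linear[OF \<iota>] by (simp add: Pair_zero_eq_zero)
  show "dir_deriv (u $ 1, u $ 2, 0) (dir_deriv (v $ 1, v $ 2, 0) G') 0 = dir_deriv u (dir_deriv v r) 0"
    using dir_deriv2_cong[OF ev sc, of u v] dir_deriv2_linear[OF \<iota> s', of u v] by (simp add: Pair_zero_eq_zero)
qed

text \<open>
  Substituting the truncated parameter turns any solution of a problem with \<open>s\<close> parameters into one that
  depends on the first \<open>s\<close> coordinates only.
\<close>
definition truncate :: "nat \<Rightarrow> params \<Rightarrow> params"
  where "truncate s t = (\<Sum>i<s. Poly_Mapping.lookup t i *\<^sub>R Poly_Mapping.single i 1)"

lemma lookup_sum_finite: "finite I \<Longrightarrow> Poly_Mapping.lookup (\<Sum>i\<in>I. F i :: params) j = (\<Sum>i\<in>I. Poly_Mapping.lookup (F i) j)"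
  by (induct I rule: finite_induct) (simp_all add: lookup_add)

lemma lookup_truncate: "Poly_Mapping.lookup (truncate s t) j = (if j < s then Poly_Mapping.lookup t j else 0)"
proof -
  have "Poly_Mapping.lookup (truncate s t) j = (\<Sum>i<s. Poly_Mapping.lookup t i * (if i = j then 1 else 0))"
    by (simp add: truncate_def lookup_sum_finite lookup_scaleR lookup_single when_def)
  also have "\<dots> = (if j < s then Poly_Mapping.lookup t j else 0)"
    by (simp add: if_distrib[of "\<lambda>c. _ * c"] cong: if_cong)
  finally show ?thesis .
qed

lemma bounded_linear_truncate: "bounded_linear (truncate s)"
  unfolding truncate_def[abs_def]
  by (intro bounded_linear_sum bounded_linear_compose[OF bounded_linear_scaleR_left bounded_linear_lookup])

lemma truncate_cong: "\<forall>i<s. Poly_Mapping.lookup t i = Poly_Mapping.lookup t' i \<Longrightarrow> truncate s t = truncate s t'"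
  by (simp add: truncate_def)

context H_chart
begin

lemma T_E2_nonzero: "T E2 \<noteq> 0"
  using ST[of E2] linear_0[OF linear_S] by (metis E_nth(4) zero_index zero_neq_one)

lemma critical_height_imp_slope_1:
  assumes "\<And>v. dir_deriv v (\<lambda>x. f x \<bullet> w) 0 = 0"
  shows "slope 1 w = 0"
  using assms[of "T E1"] by (simp add: dir_deriv_height ST E_nth)

text \<open>
  If \<open>slope 2 w = 0\<close>, the vector \<open>T E2\<close> is in the kernel of the Hessian of the height function, but the Hessian of
  \<open>x^2 \<plusminus> y^2\<close> has no kernel.
\<close>
lemma A1_singularity_imp:
  assumes "A_singularity 1 (\<lambda>x. f x \<bullet> w)"
  shows "slope 1 w = 0" "slope 2 w \<noteq> 0"
proof -
  from assms obtain \<sigma> :: real where \<sigma>: "\<sigma> = 1 \<or> \<sigma> = -1"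
    and K: "K_equivalent (\<lambda>x. f x \<bullet> w) (\<lambda>x. (x $ 1)\<^sup>2 + \<sigma> * (x $ 2) ^ (1 + 1))"
    by (rule A_singularity_K_equivalent)
  have n0: "((0 :: real^2) $ 1)\<^sup>2 + \<sigma> * (0 :: real^2) $ 2 ^ (1 + 1) = 0" by simp
  note D = A_germ_derivatives[where k = 1 and \<sigma> = \<sigma>, OF order_refl]
  obtain A A' c where A: "linear A" "\<And>v. A (A' v) = v" "\<And>v. A' (A v) = v" "c \<noteq> 0"
    and d: "\<And>v. dir_deriv v (\<lambda>x. f x \<bullet> w) 0 = 0"
    and D2: "\<And>u v. dir_deriv u (dir_deriv v (\<lambda>x :: real^2. (x $ 1)\<^sup>2 + \<sigma> * (x $ 2) ^ (1 + 1))) 0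
      = c * dir_deriv (A u) (dir_deriv (A v) (\<lambda>x. f x \<bullet> w)) 0"
    by (rule K_equivalent_hessian[OF K smooth_germ_inner[OF f(1)] n0 D(1)]) (rule that)
  show s1: "slope 1 w = 0" by (rule critical_height_imp_slope_1[OF d])
  show "slope 2 w \<noteq> 0"
  proof
    assume s2: "slope 2 w = 0"
    define v where "v = A' (T E2)"
    have "2 * u $ 1 * v $ 1 + \<sigma> * 2 * u $ 2 * v $ 2 = 0" for u :: "real^2"
      using D2[of u v] D(2)[of u v] dir_deriv2_height[OF s1, of "A u" "T E2"] s2
      by (simp add: v_def A ST E_nth)
    from this[of E1] this[of E2] have "v = 0" using \<sigma> by (auto simp: vector2_eq_iff E_nth)
    then have "T E2 = 0" using A(2)[of "T E2"] linear_0[OF A(1)] by (simp add: v_def)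
    then show False using T_E2_nonzero by simp
  qed
qed

text \<open>
  The Hessian of \<open>x^2 \<plusminus> y^3\<close> has rank 1: its kernel contains \<open>E2\<close>, which forces \<open>slope 2 w = 0\<close>, and it is not zero,
  which forces \<open>curv w \<noteq> 0\<close>.
\<close>
lemma A2_singularity_imp:
  assumes "A_singularity 2 (\<lambda>x. f x \<bullet> w)"
  shows "slope 1 w = 0" "slope 2 w = 0" "curv w \<noteq> 0"
proof -
  from assms obtain \<sigma> :: real where \<sigma>: "\<sigma> = 1 \<or> \<sigma> = -1"
    and K: "K_equivalent (\<lambda>x. f x \<bullet> w) (\<lambda>x. (x $ 1)\<^sup>2 + \<sigma> * (x $ 2) ^ (2 + 1))"
    by (rule A_singularity_K_equivalent)
  have n0: "((0 :: real^2) $ 1)\<^sup>2 + \<sigma> * (0 :: real^2) $ 2 ^ (2 + 1) = 0" by simp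
  note D = A_germ_derivatives[where k = 2 and \<sigma> = \<sigma>, OF one_le_numeral]
  obtain A A' c where A: "linear A" "\<And>v. A (A' v) = v" "\<And>v. A' (A v) = v" "c \<noteq> 0"
    and d: "\<And>v. dir_deriv v (\<lambda>x. f x \<bullet> w) 0 = 0"
    and D2: "\<And>u v. dir_deriv u (dir_deriv v (\<lambda>x :: real^2. (x $ 1)\<^sup>2 + \<sigma> * (x $ 2) ^ (2 + 1))) 0
      = c * dir_deriv (A u) (dir_deriv (A v) (\<lambda>x. f x \<bullet> w)) 0"
    by (rule K_equivalent_hessian[OF K smooth_germ_inner[OF f(1)] n0 D(1)]) (rule that)
  show s1: "slope 1 w = 0" by (rule critical_height_imp_slope_1[OF d])
  have D2': "2 * u $ 1 * v $ 1 = c * (curv w * S (A u) $ 1 * S (A v) $ 1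
      + slope 2 w * (S (A u) $ 1 * S (A v) $ 2 + S (A u) $ 2 * S (A v) $ 1))" for u v :: "real^2"
    using D2[of u v] D(2)[of u v] dir_deriv2_height[OF s1, of "A u" "A v"] by simp
  show s2: "slope 2 w = 0"
  proof (rule ccontr)
    assume b: "slope 2 w \<noteq> 0"
    define y where "y = S (A E2)"
    have *: "curv w * z $ 1 * y $ 1 + slope 2 w * (z $ 1 * y $ 2 + z $ 2 * y $ 1) = 0" for z :: "real^2"
      using D2'[of "A' (T z)" E2] A by (simp add: ST E_nth y_def)
    from *[of E2] b have "y $ 1 = 0" by (simp add: E_nth)
    moreover from *[of E1] b this have "y $ 2 = 0" by (simp add: E_nth)
    ultimately have "A E2 = 0" using S_eq_0_iff[of "A E2"] by (simp add: y_def vector2_eq_iff)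
    then have "E2 = 0" using A(3)[of E2] A(3)[of 0] linear_0[OF A(1)] by simp
    then show False by (metis E_nth(4) zero_index zero_neq_one)
  qed
  show "curv w \<noteq> 0" using D2'[of E1 E1] s2 by (auto simp: E_nth)
qed

text \<open>
  A linear change that turns the quadratic part \<open>curv w / 2 * x^2 + slope 2 w * xy\<close> into
  \<open>slope 2 w * (x^2 - y^2)\<close>. In particular the Morse singularities that occur are always saddles.
\<close>
lemma morse_chart:
  assumes s1: "slope 1 w = 0" and b: "slope 2 w \<noteq> 0"
  obtains \<theta> \<theta>' where "inverse_diffeo_germs \<theta> \<theta>'" "smooth_germ (\<lambda>x. f (\<theta> x) \<bullet> w) 0"
    "\<And>v. dir_deriv v (\<lambda>x. f (\<theta> x) \<bullet> w) 0 = 0"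
    "\<And>u v. dir_deriv u (dir_deriv v (\<lambda>x. f (\<theta> x) \<bullet> w)) 0 = 2 * slope 2 w * (u $ 1 * v $ 1 - u $ 2 * v $ 2)"
proof -
  \<comment> \<open>The shear by \<open>\<kappa>\<close> removes the square, and \<open>xy\<close> becomes \<open>x^2 - y^2\<close> in the coordinates rotated by 45 degrees.\<close>
  define \<kappa> where "\<kappa> = curv w / (2 * slope 2 w)"
  define M where "M x = (vector [x $ 1 + x $ 2, (x $ 1 - x $ 2) - \<kappa> * (x $ 1 + x $ 2)] :: real^2)" for x :: "real^2"
  define M' where "M' x = (vector [(x $ 1 + x $ 2 + \<kappa> * x $ 1) / 2, (x $ 1 - x $ 2 - \<kappa> * x $ 1) / 2] :: real^2)" for x :: "real^2"
  have lin: "linear M" "linear M'"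
    by (rule linearI; simp add: M_def M'_def vector2_eq_iff field_simps)+
  then have bl: "bounded_linear M" "bounded_linear M'" by (simp_all add: linear_conv_bounded_linear)
  have MM: "M (M' x) = x" "M' (M x) = x" for x
    by (simp_all add: M_def M'_def vector2_eq_iff field_simps)
  have "inverse_diffeo_germs M M'"
    by (rule inverse_diffeo_germsI)
      (use MM lin in \<open>simp_all add: smooth_map_germ_bounded_linear bl linear_0\<close>)
  from inverse_diffeo_germs_compose[OF inverse_diffeo_germs_sym[OF \<phi>] this]
  have \<theta>: "inverse_diffeo_germs (\<lambda>x. \<phi>' (M x)) (\<lambda>x. M' (\<phi> x))" .
  note \<theta>D = inverse_diffeo_germsD[OF \<theta>]
  have d\<theta>: "dir_deriv u (\<lambda>x. \<phi>' (M x)) 0 = T (M u)" for u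
  proof -
    have "((\<lambda>x. \<phi>' (M x)) has_derivative (\<lambda>u. dir_deriv (M u) \<phi>' 0)) (at 0)"
      by (rule has_derivative_compose[OF bounded_linear_imp_has_derivative[OF bl(1)]])
        (use smooth_map_germ_has_derivative[OF \<phi>D(2)] linear_0[OF lin(1)] in simp)
    then show ?thesis unfolding T_def by (rule dir_derivI)
  qed
  let ?h = "\<lambda>x. f x \<bullet> w"
  have h: "smooth_germ ?h (\<phi>' (M 0))" using smooth_germ_inner[OF f(1)] \<theta>D(3) by simp
  have crit: "dir_deriv v ?h (\<phi>' (M 0)) = 0" for v
    using dir_deriv_height[of v w] s1 \<theta>D(3) by simp
  show ?thesis
  proof (rule that[OF \<theta>])
    show "smooth_germ (\<lambda>x. f (\<phi>' (M x)) \<bullet> w) 0" by (rule smooth_germ_compose[OF h \<theta>D(1)])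
    show "dir_deriv v (\<lambda>x. f (\<phi>' (M x)) \<bullet> w) 0 = 0" for v
      using dir_deriv_compose[OF h \<theta>D(1)] crit by simp
    have k: "2 * slope 2 w * \<kappa> = curv w" using b by (simp add: \<kappa>_def)
    show "dir_deriv u (dir_deriv v (\<lambda>x. f (\<phi>' (M x)) \<bullet> w)) 0 = 2 * slope 2 w * (u $ 1 * v $ 1 - u $ 2 * v $ 2)" for u v
    proof -
      have "dir_deriv u (dir_deriv v (\<lambda>x. f (\<phi>' (M x)) \<bullet> w)) 0
          = dir_deriv (T (M u)) (dir_deriv (T (M v)) ?h) 0"
        using dir_deriv2_compose_critical[OF h \<theta>D(1) crit, of u v] \<theta>D(3) by (simp add: d\<theta>)
      also have "\<dots> = 2 * slope 2 w * \<kappa> * M u $ 1 * M v $ 1 + slope 2 w * (M u $ 1 * M v $ 2 + M u $ 2 * M v $ 1)"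
        by (simp add: dir_deriv2_height[OF s1] ST k)
      also have "\<dots> = 2 * slope 2 w * (u $ 1 * v $ 1 - u $ 2 * v $ 2)"
        by (simp add: M_def algebra_simps)
      finally show ?thesis .
    qed
  qed
qed

lemma family_morse_conditions:
  fixes G :: "(real^2) \<times> 'p::real_normed_vector \<Rightarrow> real"
  assumes b: "slope 2 w \<noteq> 0"
    and \<theta>: "inverse_diffeo_germs \<theta> \<theta>'" "\<And>v. dir_deriv v (\<lambda>x. f (\<theta> x) \<bullet> w) 0 = 0"
    "\<And>u v. dir_deriv u (dir_deriv v (\<lambda>x. f (\<theta> x) \<bullet> w)) 0 = 2 * slope 2 w * (u $ 1 * v $ 1 - u $ 2 * v $ 2)"
    and G: "smooth_germ G 0" "\<forall>\<^sub>F x in nhds 0. G (x, 0) = f x \<bullet> w"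
  defines "G' \<equiv> (\<lambda>x :: real \<times> real \<times> 'p. G (\<theta> (vector [fst x, fst (snd x)]), snd (snd x)))"
  shows "smooth_germ G' 0" "dir_deriv (1, 0, 0) G' 0 = 0" "dir_deriv (0, 1, 0) G' 0 = 0"
    "dir_deriv (1, 0, 0) (dir_deriv (1, 0, 0) G') 0 = 2 * slope 2 w"
    "dir_deriv (0, 1, 0) (dir_deriv (1, 0, 0) G') 0 = 0"
    "dir_deriv (0, 1, 0) (dir_deriv (0, 1, 0) G') 0 = - 2 * slope 2 w"
proof -
  note \<theta>D = inverse_diffeo_germsD[OF \<theta>(1)]
  have m: "smooth_map_germ (\<lambda>x :: (real^2) \<times> 'p. (\<theta> (fst x), snd x)) 0"
    by (intro smooth_map_germ_Pair smooth_map_germ_compose[OF _ smooth_map_germ_fst] smooth_map_germ_snd)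
      (use \<theta>D in simp)
  have "smooth_germ (\<lambda>x :: (real^2) \<times> 'p. G (\<theta> (fst x), snd x)) 0"
    by (rule smooth_germ_compose[OF _ m]) (use G \<theta>D in \<open>simp add: Pair_zero_eq_zero\<close>)
  moreover have "\<forall>\<^sub>F x in nhds 0. G (\<theta> (fst (x, 0 :: 'p)), snd (x, 0)) = f (\<theta> x) \<bullet> w"
    using eventually_nhds_compose[OF _ smooth_map_germ_continuous[OF \<theta>D(1)], of "\<lambda>x. G (x, 0) = f x \<bullet> w"] G(2) \<theta>D
    by simp
  ultimately have *: "smooth_germ G' 0"
    "dir_deriv (v $ 1, v $ 2, 0) G' 0 = dir_deriv v (\<lambda>x. f (\<theta> x) \<bullet> w) 0"
    "dir_deriv (u $ 1, u $ 2, 0) (dir_deriv (v $ 1, v $ 2, 0) G') 0 = dir_deriv u (dir_deriv v (\<lambda>x. f (\<theta> x) \<bullet> w)) 0"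
    for u v
    using family_product_form[of "\<lambda>x. G (\<theta> (fst x), snd x)" "\<lambda>x. f (\<theta> x) \<bullet> w"] by (simp_all add: G'_def)
  show "smooth_germ G' 0" by (rule *(1))
  show "dir_deriv (1, 0, 0) G' 0 = 0" "dir_deriv (0, 1, 0) G' 0 = 0"
    using *(2)[of E1] *(2)[of E2] \<theta>(2) by (simp_all add: E_nth)
  show "dir_deriv (1, 0, 0) (dir_deriv (1, 0, 0) G') 0 = 2 * slope 2 w"
    "dir_deriv (0, 1, 0) (dir_deriv (1, 0, 0) G') 0 = 0"
    "dir_deriv (0, 1, 0) (dir_deriv (0, 1, 0) G') 0 = - 2 * slope 2 w"
    using *(3)[of E1 E1] *(3)[of E2 E1] *(3)[of E2 E2] \<theta>(3) by (simp_all add: E_nth)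
qed

lemma A1_singularityI:
  assumes s1: "slope 1 w = 0" and b: "slope 2 w \<noteq> 0"
  shows "A_singularity 1 (\<lambda>x. f x \<bullet> w)"
proof -
  obtain \<theta> \<theta>' where \<theta>: "inverse_diffeo_germs \<theta> \<theta>'" "smooth_germ (\<lambda>x. f (\<theta> x) \<bullet> w) 0"
    "\<And>v. dir_deriv v (\<lambda>x. f (\<theta> x) \<bullet> w) 0 = 0"
    "\<And>u v. dir_deriv u (dir_deriv v (\<lambda>x. f (\<theta> x) \<bullet> w)) 0 = 2 * slope 2 w * (u $ 1 * v $ 1 - u $ 2 * v $ 2)"
    using morse_chart[OF s1 b] by blast
  note \<theta>D = inverse_diffeo_germsD[OF \<theta>(1)]
  have "smooth_germ (\<lambda>x :: (real^2) \<times> real. f (fst x) \<bullet> w) 0"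
    by (rule smooth_germ_compose[OF _ smooth_map_germ_fst, of "\<lambda>x. f x \<bullet> w"]) (use smooth_germ_inner[OF f(1)] in simp)
  note G = family_morse_conditions[OF b \<theta>(1,3,4) this, simplified]
  let ?G = "\<lambda>x :: real \<times> real \<times> real. f (\<theta> (vector [fst x, fst (snd x)])) \<bullet> w"
  obtain Y1 Y2 c where Y: "smooth_germ Y1 0" "Y1 0 = 0" "dir_deriv (1, 0, 0) Y1 0 \<noteq> 0"
    "smooth_germ Y2 0" "Y2 0 = 0" "dir_deriv (1, 0) Y2 0 \<noteq> 0"
    "smooth_germ c 0" "c 0 = ?G 0"
    and ev: "\<forall>\<^sub>F x in nhds 0. ?G x = sgn (dir_deriv (1, 0, 0) (dir_deriv (1, 0, 0) ?G) 0) * (Y1 x)\<^sup>2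
      + sgn (dir_deriv (0, 1, 0) (dir_deriv (0, 1, 0) ?G) 0) * (Y2 (snd x))\<^sup>2 + c (snd (snd x))"
    by (rule morse_family[of ?G]) (use G b in simp_all)
  define \<epsilon> where "\<epsilon> = sgn (slope 2 w)"
  have \<epsilon>: "\<epsilon> * \<epsilon> = 1" using b by (simp add: \<epsilon>_def sgn_if)
  have sg: "sgn (dir_deriv (1, 0, 0) (dir_deriv (1, 0, 0) ?G) 0) = \<epsilon>"
    "sgn (dir_deriv (0, 1, 0) (dir_deriv (0, 1, 0) ?G) 0) = - \<epsilon>"
    using G by (simp_all add: \<epsilon>_def sgn_if)
  have z: "(vector [0, 0] :: real^2) = 0" by (simp add: vector2_eq_iff)
  have c0: "c 0 = 0" using Y(8) f(2) \<theta>D(3) by (simp add: z)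
  let ?\<iota> = "\<lambda>x :: real \<times> real. (fst x, snd x, 0 :: real)"
  have \<iota>: "bounded_linear ?\<iota>" by (intro bounded_linear_Pair bounded_linear_fst bounded_linear_snd bounded_linear_zero)
  note s\<iota> = smooth_map_germ_bounded_linear[OF \<iota>]
  let ?j = "\<lambda>y::real. (y, 0::real)"
  note j = bounded_linear_Pair0(1)[where 'a = real and 'b = real]
  note sj = smooth_map_germ_bounded_linear[OF j]
  have "K_equivalent (\<lambda>x. f x \<bullet> w) (\<lambda>x. (x $ 1)\<^sup>2 + \<epsilon> * (- \<epsilon>) * (x $ 2) ^ 2)"
  proof (rule K_equivalent_normal_form[OF \<theta>(1), where Y = "\<lambda>x. Y1 (?\<iota> x)" and V = "\<lambda>y. Y2 (?j y)"])
    have Y1': "smooth_germ Y1 (?\<iota> 0)" using Y by (simp add: Pair_zero_eq_zero)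
    have Y2': "smooth_germ Y2 (?j 0)" using Y by (simp add: Pair_zero_eq_zero)
    show "smooth_germ (\<lambda>x. Y1 (?\<iota> x)) 0" by (rule smooth_germ_compose[OF Y1' s\<iota>])
    show "smooth_germ (\<lambda>y. Y2 (?j y)) 0" by (rule smooth_germ_compose[OF Y2' sj])
    show "Y1 (?\<iota> 0) = 0" "Y2 (?j 0) = 0" using Y by (simp_all add: Pair_zero_eq_zero)
    show "dir_deriv (1, 0) (\<lambda>x. Y1 (?\<iota> x)) 0 \<noteq> 0"
      using dir_deriv_compose[OF Y1' s\<iota>, of "(1, 0)"] dir_deriv_bounded_linear[OF \<iota>] Y by (simp add: Pair_zero_eq_zero)
    show "dir_deriv 1 (\<lambda>y. Y2 (?j y)) 0 \<noteq> 0"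
      using dir_deriv_compose[OF Y2' sj, of 1] dir_deriv_bounded_linear[OF j] Y by (simp add: Pair_zero_eq_zero)
    show "\<epsilon> * \<epsilon> = 1" by (rule \<epsilon>)
    have \<mu>: "bounded_linear (\<lambda>x :: real^2. (x $ 1, x $ 2, 0 :: real))"
      by (intro bounded_linear_Pair bounded_linear_vec_nth bounded_linear_zero)
    have v: "(vector [x $ 1, x $ 2] :: real^2) = x" for x by (simp add: vector2_eq_iff)
    from eventually_nhds_compose[OF _ smooth_map_germ_continuous[OF smooth_map_germ_bounded_linear[OF \<mu>]],
        of "\<lambda>x. ?G x = \<epsilon> * (Y1 x)\<^sup>2 + (- \<epsilon>) * (Y2 (snd x))\<^sup>2 + c (snd (snd x))" 0] ev[unfolded sg]
    show "\<forall>\<^sub>F x in nhds 0. f (\<theta> x) \<bullet> w = \<epsilon> * (Y1 (?\<iota> (x $ 1, x $ 2)))\<^sup>2 + - \<epsilon> * (Y2 (?j (x $ 2)))\<^sup>2"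
      by (simp add: Pair_zero_eq_zero v c0)
  qed
  then have "K_equivalent (\<lambda>x. f x \<bullet> w) (\<lambda>x. (x $ 1)\<^sup>2 + (- 1) * (x $ 2) ^ (1 + 1))"
    using \<epsilon> by (simp add: numeral_2_eq_2)
  then show ?thesis by (rule A_singularityI) simp_all
qed

end

section \<open>Versality of the height functions\<close>

lemma vector2_zero: "(vector [0, 0] :: real^2) = 0"
  by (simp add: vector2_eq_iff)

lemma smooth_at_differentiable:
  assumes "smooth_at f a"
  shows "\<forall>\<^sub>F x in nhds a. f differentiable (at x)" "\<forall>\<^sub>F x in nhds a. dir_deriv v f differentiable (at x)"
proof -
  from assms obtain U where U: "open U" "a \<in> U" "\<And>k. Ck_on k U f" unfolding smooth_at_def by blast
  from U(3)[of "Suc (Suc 0)"] have "\<forall>x\<in>U. f differentiable (at x) \<and> dir_deriv v f differentiable (at x)"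
    by simp
  with U show "\<forall>\<^sub>F x in nhds a. f differentiable (at x)" "\<forall>\<^sub>F x in nhds a. dir_deriv v f differentiable (at x)"
    unfolding eventually_nhds by blast+
qed

lemma differentiable_has_dir_deriv:
  "f differentiable (at x) \<Longrightarrow> (f has_derivative (\<lambda>v. dir_deriv v f x)) (at x)"
  unfolding dir_deriv_def frechet_derivative_works .

context H_chart
begin

lemma height_family_smooth: "smooth_at (\<lambda>(x, p). height f x p) (0, w)"
proof -
  have "smooth_germ (\<lambda>x. \<Sum>b\<in>Basis. (f (fst x) \<bullet> b) * (snd x \<bullet> b)) (0, w)"
  proof (intro smooth_germ_sum smooth_germ_mult finite_Basis)
    fix b :: "real^3"
    show "smooth_germ (\<lambda>x :: (real^2) \<times> (real^3). f (fst x) \<bullet> b) (0, w)"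
      by (rule smooth_germ_compose[OF _ smooth_map_germ_fst, of "\<lambda>x. f x \<bullet> b"]) (use smooth_germ_inner[OF f(1)] in simp)
    show "smooth_germ (\<lambda>x :: (real^2) \<times> (real^3). snd x \<bullet> b) (0, w)"
      by (rule smooth_germ_bounded_linear[OF bounded_linear_compose[OF bounded_linear_inner_left bounded_linear_snd]])
  qed
  then have "smooth_germ (\<lambda>x. f (fst x) \<bullet> snd x) (0, w)" by (simp add: euclidean_inner[symmetric])
  from smooth_map_germ_imp_smooth_at[OF smooth_map_germ_realI[OF this]]
  show ?thesis by (simp add: height_def case_prod_unfold)
qed

text \<open>
  The family of coordinate changes is \<open>\<theta> \<circ> (\<phi>1, \<phi>2) \<circ> \<theta>'\<close>, where \<open>\<theta>\<close> diagonalizes the Hessian and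
  \<open>(\<phi>1, \<phi>2)\<close> comes from \<open>morse_trivialization\<close>; the map of the parameters into the sphere is constant.
\<close>
lemma morse_height_versal:
  assumes s1: "slope 1 w = 0" and b: "slope 2 w \<noteq> 0" and w: "w \<in> sphere 0 1"
  shows "R_plus_versal (sphere 0 1) w (\<lambda>x. f x \<bullet> w) (height f)"
  unfolding R_plus_versal_def
proof (intro conjI allI impI)
  show "w \<in> sphere 0 1" by (rule w)
  show "smooth_at (\<lambda>(x, p). height f x p) (0, w)" by (rule height_family_smooth)
  show "\<forall>\<^sub>F x in nhds 0. height f x w = f x \<bullet> w" by (simp add: height_def)
  fix s and G :: "real^2 \<Rightarrow> params \<Rightarrow> real"
  assume "unfolding_of s (\<lambda>x. f x \<bullet> w) G"
  then have dep: "depends_on_first s (\<lambda>t x. G x t)" and smG: "smooth_at (\<lambda>(x, t). G x t) (0, 0)"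
    and G0: "\<forall>\<^sub>F x in nhds 0. G x 0 = f x \<bullet> w"
    unfolding unfolding_of_def by auto
  let ?G = "\<lambda>x. G (fst x) (snd x)"
  have G: "smooth_germ ?G 0"
    using smooth_at_imp_smooth_germ_params[of ?G "(0, 0)" s] smG dep by (simp add: case_prod_unfold Pair_zero_eq_zero)
  obtain \<theta> \<theta>' where \<theta>: "inverse_diffeo_germs \<theta> \<theta>'" "smooth_germ (\<lambda>x. f (\<theta> x) \<bullet> w) 0"
    "\<And>v. dir_deriv v (\<lambda>x. f (\<theta> x) \<bullet> w) 0 = 0"
    "\<And>u v. dir_deriv u (dir_deriv v (\<lambda>x. f (\<theta> x) \<bullet> w)) 0 = 2 * slope 2 w * (u $ 1 * v $ 1 - u $ 2 * v $ 2)"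
    using morse_chart[OF s1 b] by blast
  note \<theta>D = inverse_diffeo_germsD[OF \<theta>(1)]
  define G' where "G' x = G (\<theta> (vector [fst x, fst (snd x)])) (snd (snd x))" for x :: "real \<times> real \<times> params"
  have "\<forall>\<^sub>F x in nhds 0. ?G (x, 0) = f x \<bullet> w" using G0 by simp
  from family_morse_conditions[OF b \<theta>(1,3,4) G this]
  have G': "smooth_germ G' 0" "dir_deriv (1, 0, 0) G' 0 = 0" "dir_deriv (0, 1, 0) G' 0 = 0"
    "dir_deriv (1, 0, 0) (dir_deriv (1, 0, 0) G') 0 = 2 * slope 2 w"
    "dir_deriv (0, 1, 0) (dir_deriv (1, 0, 0) G') 0 = 0"
    "dir_deriv (0, 1, 0) (dir_deriv (0, 1, 0) G') 0 = - 2 * slope 2 w"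
    by (simp_all add: G'_def[abs_def])
  obtain \<phi>1 \<phi>2 c where \<phi>12: "smooth_germ \<phi>1 0" "smooth_germ \<phi>2 0" "\<phi>1 0 = 0" "\<phi>2 0 = 0"
    "\<forall>\<^sub>F x in nhds 0. \<phi>1 (fst x, snd x, 0) = fst x" "\<forall>\<^sub>F y in nhds 0. \<phi>2 (y, 0) = y"
    "smooth_germ c 0"
    "\<forall>\<^sub>F x in nhds 0. G' x = G' (\<phi>1 x, \<phi>2 (snd x), 0) + c (snd (snd x))"
    by (rule morse_trivialization[of G']) (use G' b in simp_all)
  define \<pi> where "\<pi> = truncate s"
  have \<pi>: "bounded_linear \<pi>" unfolding \<pi>_def by (rule bounded_linear_truncate)
  have \<pi>0: "\<pi> 0 = 0" using linear_0[OF bounded_linear.linear[OF \<pi>]] .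
  have \<pi>_cong: "\<pi> t = \<pi> t'" if "\<forall>i<s. Poly_Mapping.lookup t i = Poly_Mapping.lookup t' i" for t t'
    using truncate_cong[OF that] by (simp add: \<pi>_def)
  have G\<pi>: "G x (\<pi> t) = G x t" for x t
  proof -
    have "(\<lambda>x. G x (\<pi> t)) = (\<lambda>x. G x t)"
      by (rule dep[unfolded depends_on_first_def, rule_format]) (simp add: \<pi>_def lookup_truncate)
    then show ?thesis by metis
  qed
  define m where "m x = (\<theta>' (fst x) $ 1, \<theta>' (fst x) $ 2, \<pi> (snd x))" for x :: "(real^2) \<times> params"
  have m0: "m 0 = 0" by (simp add: m_def \<theta>D \<pi>0 Pair_zero_eq_zero)
  have c\<theta>': "smooth_germ (\<lambda>x :: (real^2) \<times> params. \<theta>' (fst x) $ i) 0" for i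
    by (rule smooth_map_germ_imp_germ[OF smooth_map_germ_compose[OF _ smooth_map_germ_fst] bounded_linear_vec_nth])
      (use \<theta>D in simp)
  have m: "smooth_map_germ m 0" unfolding m_def[abs_def]
    by (intro smooth_map_germ_Pair_realI c\<theta>' smooth_map_germ_bounded_linear bounded_linear_compose[OF \<pi> bounded_linear_snd])
  define \<Theta> where "\<Theta> x = \<theta> (vector [\<phi>1 (m x), \<phi>2 (snd (m x))])" for x
  have s\<phi>: "smooth_germ (\<lambda>x. \<phi>1 (m x)) 0" "smooth_germ (\<lambda>x. \<phi>2 (snd (m x))) 0"
  proof -
    show "smooth_germ (\<lambda>x. \<phi>1 (m x)) 0" by (rule smooth_germ_compose[OF _ m]) (use \<phi>12 m0 in simp)
    show "smooth_germ (\<lambda>x. \<phi>2 (snd (m x))) 0"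
      by (rule smooth_germ_compose[OF _ smooth_map_germ_compose[OF smooth_map_germ_snd m]]) (use \<phi>12 m0 in simp)
  qed
  have sv: "smooth_map_germ (\<lambda>x. vector [\<phi>1 (m x), \<phi>2 (snd (m x))] :: real^2) 0"
    by (rule smooth_map_germ_vector2[OF s\<phi>])
  have s\<Theta>: "smooth_map_germ \<Theta> 0" unfolding \<Theta>_def[abs_def]
    by (rule smooth_map_germ_compose[OF _ sv]) (use \<theta>D \<phi>12 m0 in \<open>simp add: vector2_zero\<close>)
  show "\<exists>(\<phi> :: real^2 \<Rightarrow> params \<Rightarrow> real^2) (\<psi> :: params \<Rightarrow> real^3) (c :: params \<Rightarrow> real).
        depends_on_first s (\<lambda>t x. \<phi> x t) \<and> depends_on_first s \<psi> \<and> depends_on_first s c \<and>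
        smooth_at (\<lambda>(x, t). \<phi> x t) (0, 0) \<and> smooth_at \<psi> 0 \<and> smooth_at c 0 \<and>
        (\<forall>\<^sub>F x in nhds 0. \<phi> x 0 = x) \<and>
        \<psi> 0 = w \<and> (\<forall>\<^sub>F t in nhds 0. \<psi> t \<in> sphere 0 1) \<and>
        (\<forall>\<^sub>F (x, t) in nhds (0, 0). G x t = height f (\<phi> x t) (\<psi> t) + c t)"
  proof (intro exI conjI)
    show "depends_on_first s (\<lambda>t x. \<Theta> (x, t))"
      unfolding depends_on_first_def
    proof (intro allI impI ext)
      fix t t' :: params and x
      assume "\<forall>i<s. Poly_Mapping.lookup t i = Poly_Mapping.lookup t' i"
      from \<pi>_cong[OF this] show "\<Theta> (x, t) = \<Theta> (x, t')" by (simp add: \<Theta>_def m_def)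
    qed
    show "depends_on_first s (\<lambda>t. w)" by (simp add: depends_on_first_def)
    show "depends_on_first s (\<lambda>t. c (\<pi> t))" unfolding depends_on_first_def using \<pi>_cong by metis
    show "smooth_at (\<lambda>(x, t). \<Theta> (x, t)) (0, 0)"
      using smooth_map_germ_imp_smooth_at[OF s\<Theta>] by (simp add: Pair_zero_eq_zero)
    show "smooth_at (\<lambda>t :: params. w) 0" by (rule smooth_map_germ_imp_smooth_at[OF smooth_map_germ_const])
    have "smooth_germ (\<lambda>t. c (\<pi> t)) 0"
      by (rule smooth_germ_compose[OF _ smooth_map_germ_bounded_linear[OF \<pi>]]) (use \<phi>12 \<pi>0 in simp)
    then show "smooth_at (\<lambda>t. c (\<pi> t)) 0"
      by (rule smooth_map_germ_imp_smooth_at[OF smooth_map_germ_realI])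
    have c1: "\<forall>\<^sub>F x in nhds 0. \<phi>1 (\<theta>' x $ 1, \<theta>' x $ 2, 0) = \<theta>' x $ 1"
      using eventually_nhds_compose[OF _ smooth_map_germ_continuous[OF smooth_map_germ_compose[OF
            smooth_map_germ_bounded_linear[OF bounded_linear_coords] \<theta>D(2)]], of "\<lambda>x. \<phi>1 (fst x, snd x, 0) = fst x"] \<phi>12(5) \<theta>D
      by (simp add: Pair_zero_eq_zero)
    have c2: "\<forall>\<^sub>F x in nhds 0. \<phi>2 (\<theta>' x $ 2, 0) = \<theta>' x $ 2"
      using eventually_nhds_compose[OF _ smooth_map_germ_continuous[OF smooth_map_germ_compose[OF
            smooth_map_germ_bounded_linear[OF bounded_linear_vec_nth] \<theta>D(2)]], of "\<lambda>y. \<phi>2 (y, 0) = y" 2] \<phi>12(6) \<theta>D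
      by simp
    have vec: "(vector [x $ 1, x $ 2] :: real^2) = x" for x by (simp add: vector2_eq_iff)
    from c1 c2 \<theta>D(6) show "\<forall>\<^sub>F x in nhds 0. \<Theta> (x, 0) = x"
      by eventually_elim (simp add: \<Theta>_def m_def \<pi>0 vec)
    show "w = w" ..
    show "\<forall>\<^sub>F t in nhds 0. w \<in> sphere 0 1" using w by simp
    have e1: "\<forall>\<^sub>F x in nhds 0. G' (m x) = G' (\<phi>1 (m x), \<phi>2 (snd (m x)), 0) + c (snd (snd (m x)))"
      by (rule eventually_nhds_compose[OF _ smooth_map_germ_continuous[OF m]]) (use \<phi>12 m0 in simp)
    have e2: "\<forall>\<^sub>F x :: (real^2) \<times> params in nhds 0. \<theta> (\<theta>' (fst x)) = fst x"
      by (rule eventually_nhds_compose[OF _ smooth_map_germ_continuous[OF smooth_map_germ_fst]]) (use \<theta>D in simp)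
    have e3: "\<forall>\<^sub>F x in nhds 0. G (\<Theta> x) 0 = f (\<Theta> x) \<bullet> w"
      by (rule eventually_nhds_compose[OF _ smooth_map_germ_continuous[OF s\<Theta>]])
        (use G0 \<theta>D \<phi>12 m0 in \<open>simp add: \<Theta>_def vector2_zero\<close>)
    from e1 e2 e3 have "\<forall>\<^sub>F x in nhds 0. G (fst x) (snd x) = height f (\<Theta> x) w + c (\<pi> (snd x))"
    proof eventually_elim
      case (elim x)
      have "G' (m x) = G (fst x) (snd x)"
        using elim(2) by (simp add: G'_def m_def vec G\<pi>)
      moreover have "G' (\<phi>1 (m x), \<phi>2 (snd (m x)), 0) = G (\<Theta> x) 0" by (simp add: G'_def \<Theta>_def)
      ultimately show ?case using elim(1,3) by (simp add: height_def m_def)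
    qed
    then show "\<forall>\<^sub>F (x, t) in nhds (0, 0). G x t = height f (\<Theta> (x, t)) w + c (\<pi> t)"
      by (simp add: Pair_zero_eq_zero case_prod_unfold)
  qed
qed

text \<open>
  Suppose \<open>h x + t * (x \<bullet> \<eta>) = f (\<Theta> x t) \<bullet> \<psi> t + c t\<close>, where \<open>\<eta>\<close> is a null vector. Apply the mixed derivative
  along \<open>\<eta>\<close> and \<open>t\<close> at 0. The left-hand side gives \<open>\<eta> \<bullet> \<eta>\<close>. On the right-hand side each term
  contains the derivative of \<open>h\<close> at 0, the Hessian of \<open>h\<close> applied to \<open>\<eta>\<close>, or the derivative of
  \<open>f\<close> along \<open>\<eta>\<close>, and all of these vanish.
\<close>
lemma degenerate_height_not_versal:
  assumes s1: "slope 1 w = 0" and s2: "slope 2 w = 0"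
  shows "\<not> R_plus_versal (sphere 0 1) w (\<lambda>x. f x \<bullet> w) (height f)"
proof
  let ?h = "\<lambda>x. f x \<bullet> w"
  assume V: "R_plus_versal (sphere 0 1) w ?h (height f)"
  define \<eta> where "\<eta> = T E2"
  have \<eta>: "\<eta> \<noteq> 0" "S \<eta> $ 1 = 0" using T_E2_nonzero by (simp_all add: \<eta>_def ST E_nth)
  have df\<eta>: "dir_deriv \<eta> f 0 = 0" by (simp add: dir_deriv_f \<eta>)
  have dh: "dir_deriv v ?h 0 = 0" for v by (simp add: dir_deriv_height s1)
  have d2h: "dir_deriv u (dir_deriv \<eta> ?h) 0 = 0" for u by (simp add: dir_deriv2_height[OF s1] \<eta> s2)
  define G where "G x t = f x \<bullet> w + Poly_Mapping.lookup t 0 * (x \<bullet> \<eta>)" for x and t :: params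
  have "unfolding_of 1 ?h G"
    unfolding unfolding_of_def
  proof (intro conjI)
    show "depends_on_first 1 (\<lambda>t x. G x t)" by (auto simp: depends_on_first_def G_def)
    have "smooth_germ (\<lambda>x :: (real^2) \<times> params. f (fst x) \<bullet> w + Poly_Mapping.lookup (snd x) 0 * (fst x \<bullet> \<eta>)) (0, 0)"
    proof (intro smooth_germ_add smooth_germ_mult)
      show "smooth_germ (\<lambda>x :: (real^2) \<times> params. f (fst x) \<bullet> w) (0, 0)"
        by (rule smooth_germ_compose[OF _ smooth_map_germ_fst, of "\<lambda>x. f x \<bullet> w"]) (use smooth_germ_inner[OF f(1)] in simp)
      show "smooth_germ (\<lambda>x :: (real^2) \<times> params. Poly_Mapping.lookup (snd x) 0) (0, 0)"
        by (rule smooth_germ_bounded_linear[OF bounded_linear_compose[OF bounded_linear_lookup bounded_linear_snd]])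
      show "smooth_germ (\<lambda>x :: (real^2) \<times> params. fst x \<bullet> \<eta>) (0, 0)"
        by (rule smooth_germ_bounded_linear[OF bounded_linear_compose[OF bounded_linear_inner_left bounded_linear_fst]])
    qed
    from smooth_map_germ_imp_smooth_at[OF smooth_map_germ_realI[OF this]]
    show "smooth_at (\<lambda>(x, t). G x t) (0, 0)" by (simp add: G_def case_prod_unfold)
    show "\<forall>\<^sub>F x in nhds 0. G x 0 = f x \<bullet> w" by (simp add: G_def)
  qed
  with V obtain \<Theta> \<psi> c where sm: "smooth_at (\<lambda>(x, t). \<Theta> x t :: real^2) (0, 0 :: params)" "smooth_at \<psi> 0"
    and init: "\<forall>\<^sub>F x in nhds 0. \<Theta> x 0 = x" "\<psi> 0 = w"
    and eq: "\<forall>\<^sub>F (x, t) in nhds (0, 0). G x t = height f (\<Theta> x t) (\<psi> t) + c t"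
    unfolding R_plus_versal_def by blast
  define \<Xi> where "\<Xi> = (\<lambda>(x, t). \<Theta> x t)"
  have \<Xi>: "smooth_at \<Xi> (0, 0)" using sm by (simp add: \<Xi>_def)
  define e :: params where "e = Poly_Mapping.single 0 1"
  let ?j = "\<lambda>\<tau>::real. (0 :: real^2, \<tau> *\<^sub>R e)"
  have j: "bounded_linear ?j"
    by (intro bounded_linear_Pair bounded_linear_zero bounded_linear_scaleR_left)
  have dj: "(?j has_derivative ?j) (at \<tau>)" for \<tau> by (rule bounded_linear_imp_has_derivative[OF j])
  have line: "((\<lambda>\<sigma>::real. \<sigma> *\<^sub>R v) has_derivative (\<lambda>\<sigma>. \<sigma> *\<^sub>R v)) (at 0)"
    for v :: "'v::real_normed_vector"
    by (rule bounded_linear_imp_has_derivative[OF bounded_linear_scaleR_left])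
  have cj: "isCont ?j 0" using dj has_derivative_continuous by blast
  have \<Xi>0: "\<Xi> (0, 0) = 0" using eventually_nhds_x_imp_x[OF init(1)] by (simp add: \<Xi>_def)
  have d\<Xi>0: "(\<Xi> has_derivative (\<lambda>v. dir_deriv v \<Xi> (0, 0))) (at (0, 0))"
    by (rule differentiable_has_dir_deriv) (use eventually_nhds_x_imp_x[OF smooth_at_differentiable(1)[OF \<Xi>]] in simp)
  have \<Xi>\<eta>: "dir_deriv (\<eta>, 0) \<Xi> (0, 0) = \<eta>"
  proof -
    have "((\<lambda>x :: real^2. (x, 0 :: params)) has_derivative (\<lambda>v. (v, 0))) (at 0)"
      by (rule bounded_linear_imp_has_derivative[OF bounded_linear_Pair0(1)])
    from has_derivative_compose[OF this d\<Xi>0]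
    have a: "((\<lambda>x. \<Xi> (x, 0)) has_derivative (\<lambda>v. dir_deriv (v, 0) \<Xi> (0, 0))) (at 0)" .
    from init(1) obtain U where U: "open U" "0 \<in> U" "\<And>x. x \<in> U \<Longrightarrow> \<Theta> x 0 = x"
      unfolding eventually_nhds by auto
    have "((\<lambda>x. x) has_derivative (\<lambda>v. dir_deriv (v, 0) \<Xi> (0, 0))) (at 0)"
      by (rule has_derivative_transform_within_open[OF a U(1,2)]) (simp add: \<Xi>_def U(3))
    from has_derivative_unique[OF this has_derivative_ident] show ?thesis by metis
  qed
  let ?A = "\<lambda>b \<tau>. dir_deriv (\<eta>, 0) \<Xi> (?j \<tau>) \<bullet> b"
  let ?B = "\<lambda>b \<tau>. dir_deriv b f (\<Xi> (?j \<tau>)) \<bullet> \<psi> (\<tau> *\<^sub>R e)"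
  \<comment> \<open>The derivative along \<open>\<eta>\<close> at the origin of the identity between the two unfoldings, as a function of the
    single parameter \<open>\<tau>\<close>; it involves \<open>\<psi>\<close> only through its values and \<open>c\<close> not at all.\<close>
  have key: "\<forall>\<^sub>F \<tau> in nhds 0. \<tau> * (\<eta> \<bullet> \<eta>) = (\<Sum>b\<in>Basis. ?A b \<tau> * ?B b \<tau>)"
  proof -
    have isc: "isCont \<Xi> (0, 0)" using d\<Xi>0 has_derivative_continuous by blast
    have "\<forall>\<^sub>F y in nhds (0, 0). smooth_map_germ f (\<Xi> y)"
      by (rule eventually_nhds_compose[OF _ isc]) (use smooth_map_germ_eventually[OF f(1)] \<Xi>0 in simp)
    with smooth_at_differentiable(1)[OF \<Xi>] iffD2[OF eventually_eventually eq]
    have "\<forall>\<^sub>F y in nhds (0, 0). \<Xi> differentiable (at y) \<and>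
        (\<forall>\<^sub>F (x, t) in nhds y. G x t = height f (\<Theta> x t) (\<psi> t) + c t) \<and> smooth_map_germ f (\<Xi> y)"
      by eventually_elim blast
    then have "\<forall>\<^sub>F \<tau> in nhds 0. \<Xi> differentiable (at (?j \<tau>)) \<and>
        (\<forall>\<^sub>F (x, t) in nhds (?j \<tau>). G x t = height f (\<Theta> x t) (\<psi> t) + c t) \<and> smooth_map_germ f (\<Xi> (?j \<tau>))"
      by (intro eventually_nhds_compose[OF _ cj]) simp
    then show ?thesis
    proof eventually_elim
      case (elim \<tau>)
      let ?i = "\<lambda>\<sigma>::real. (\<sigma> *\<^sub>R \<eta>, \<tau> *\<^sub>R e)"
      have di: "(?i has_derivative (\<lambda>\<sigma>. (\<sigma> *\<^sub>R \<eta>, 0))) (at 0)"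
        by (auto intro!: derivative_eq_intros)
      have d1: "(\<Xi> has_derivative (\<lambda>v. dir_deriv v \<Xi> (?j \<tau>))) (at (?i 0))"
        using differentiable_has_dir_deriv[OF conjunct1[OF elim]] by simp
      have d2: "(f has_derivative (\<lambda>v. dir_deriv v f (\<Xi> (?j \<tau>)))) (at (\<Xi> (?i 0)))"
        using smooth_map_germ_has_derivative[OF conjunct2[OF conjunct2[OF elim]]] by simp
      from has_derivative_compose[OF has_derivative_compose[OF di d1] d2]
      have "((\<lambda>\<sigma>. f (\<Xi> (?i \<sigma>)) \<bullet> \<psi> (\<tau> *\<^sub>R e) + c (\<tau> *\<^sub>R e)) has_derivative
          (\<lambda>\<sigma>. dir_deriv (dir_deriv (\<sigma> *\<^sub>R \<eta>, 0) \<Xi> (?j \<tau>)) f (\<Xi> (?j \<tau>)) \<bullet> \<psi> (\<tau> *\<^sub>R e))) (at 0)"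
        by (auto intro!: derivative_eq_intros)
      moreover have "((\<lambda>\<sigma>. f (\<Xi> (?i \<sigma>)) \<bullet> \<psi> (\<tau> *\<^sub>R e) + c (\<tau> *\<^sub>R e)) has_derivative
          (\<lambda>\<sigma>. \<sigma> * (\<tau> * (\<eta> \<bullet> \<eta>)))) (at 0)"
      proof -
        have "(?h has_derivative (\<lambda>v. 0)) (at (0 *\<^sub>R \<eta>))"
          using smooth_germ_has_derivative[OF smooth_germ_inner[OF f(1), of w]] dh by simp
        from has_derivative_compose[OF line this]
        have "((\<lambda>\<sigma>. ?h (\<sigma> *\<^sub>R \<eta>)) has_derivative (\<lambda>\<sigma>. 0)) (at 0)" .
        moreover have "((\<lambda>\<sigma>. \<tau> * (\<sigma> *\<^sub>R \<eta> \<bullet> \<eta>)) has_derivative (\<lambda>\<sigma>. \<tau> * (\<sigma> *\<^sub>R \<eta> \<bullet> \<eta>))) (at 0)"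
          by (auto intro!: derivative_eq_intros)
        ultimately have "((\<lambda>\<sigma>. ?h (\<sigma> *\<^sub>R \<eta>) + \<tau> * (\<sigma> *\<^sub>R \<eta> \<bullet> \<eta>)) has_derivative (\<lambda>\<sigma>. 0 + \<tau> * (\<sigma> *\<^sub>R \<eta> \<bullet> \<eta>))) (at 0)"
          by (rule has_derivative_add)
        then have "((\<lambda>\<sigma>. ?h (\<sigma> *\<^sub>R \<eta>) + \<tau> * (\<sigma> *\<^sub>R \<eta> \<bullet> \<eta>)) has_derivative (\<lambda>\<sigma>. \<sigma> * (\<tau> * (\<eta> \<bullet> \<eta>)))) (at 0)"
          by (simp add: algebra_simps)
        moreover have "\<forall>\<^sub>F \<sigma> in nhds 0. ?h (\<sigma> *\<^sub>R \<eta>) + \<tau> * (\<sigma> *\<^sub>R \<eta> \<bullet> \<eta>) = f (\<Xi> (?i \<sigma>)) \<bullet> \<psi> (\<tau> *\<^sub>R e) + c (\<tau> *\<^sub>R e)"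
        proof -
          have "isCont ?i 0" using di has_derivative_continuous by blast
          from eventually_nhds_compose[OF _ this, of "\<lambda>(x, t). G x t = height f (\<Theta> x t) (\<psi> t) + c t"] elim
          have "\<forall>\<^sub>F \<sigma> in nhds 0. G (\<sigma> *\<^sub>R \<eta>) (\<tau> *\<^sub>R e) = height f (\<Theta> (\<sigma> *\<^sub>R \<eta>) (\<tau> *\<^sub>R e)) (\<psi> (\<tau> *\<^sub>R e)) + c (\<tau> *\<^sub>R e)"
            by simp
          then show ?thesis
            by (simp add: G_def height_def \<Xi>_def lookup_scaleR e_def lookup_single)
        qed
        then obtain W where "open W" "0 \<in> W"
          "\<And>\<sigma>. \<sigma> \<in> W \<Longrightarrow> ?h (\<sigma> *\<^sub>R \<eta>) + \<tau> * (\<sigma> *\<^sub>R \<eta> \<bullet> \<eta>) = f (\<Xi> (?i \<sigma>)) \<bullet> \<psi> (\<tau> *\<^sub>R e) + c (\<tau> *\<^sub>R e)"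
          unfolding eventually_nhds by auto
        ultimately show ?thesis by (rule has_derivative_transform_within_open)
      qed
      ultimately have "(\<lambda>\<sigma>. dir_deriv (dir_deriv (\<sigma> *\<^sub>R \<eta>, 0) \<Xi> (?j \<tau>)) f (\<Xi> (?j \<tau>)) \<bullet> \<psi> (\<tau> *\<^sub>R e))
          = (\<lambda>\<sigma>. \<sigma> * (\<tau> * (\<eta> \<bullet> \<eta>)))" by (rule has_derivative_unique)
      from fun_cong[OF this, of 1]
      have "\<tau> * (\<eta> \<bullet> \<eta>) = dir_deriv (dir_deriv (\<eta>, 0) \<Xi> (?j \<tau>)) f (\<Xi> (?j \<tau>)) \<bullet> \<psi> (\<tau> *\<^sub>R e)" by simp
      also have "\<dots> = dir_deriv (dir_deriv (\<eta>, 0) \<Xi> (?j \<tau>)) (\<lambda>x. f x \<bullet> \<psi> (\<tau> *\<^sub>R e)) (\<Xi> (?j \<tau>))"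
        by (rule dir_deriv_inner[OF conjunct2[OF conjunct2[OF elim]], symmetric])
      also have "\<dots> = (\<Sum>b\<in>Basis. ?A b \<tau> * dir_deriv b (\<lambda>x. f x \<bullet> \<psi> (\<tau> *\<^sub>R e)) (\<Xi> (?j \<tau>)))"
        by (rule dir_deriv_Basis[OF smooth_germ_inner[OF conjunct2[OF conjunct2[OF elim]]]])
      also have "\<dots> = (\<Sum>b\<in>Basis. ?A b \<tau> * ?B b \<tau>)"
        by (simp add: dir_deriv_inner[OF conjunct2[OF conjunct2[OF elim]]])
      finally show ?case .
    qed
  qed
  define \<xi> where "\<xi> = dir_deriv (0, e) \<Xi> (0, 0)"
  define \<psi>' where "\<psi>' = dir_deriv e \<psi> 0"
  have dA: "\<exists>a. (?A b has_derivative a) (at 0)" for b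
  proof -
    have "(dir_deriv (\<eta>, 0) \<Xi> has_derivative (\<lambda>v. dir_deriv v (dir_deriv (\<eta>, 0) \<Xi>) (0, 0))) (at (?j 0))"
      using differentiable_has_dir_deriv[OF eventually_nhds_x_imp_x[OF smooth_at_differentiable(2)[OF \<Xi>]]] by simp
    from has_derivative_inner_left[OF has_derivative_compose[OF dj this], of b] show ?thesis by blast
  qed
  then obtain a where dA: "\<And>b. (?A b has_derivative a b) (at 0)" by metis
  have dB: "(?B b has_derivative (\<lambda>\<tau>. \<tau> * (dir_deriv \<xi> (dir_deriv b ?h) 0 + dir_deriv b f 0 \<bullet> \<psi>'))) (at 0)" for b
  proof -
    have "(\<Xi> has_derivative (\<lambda>v. dir_deriv v \<Xi> (0, 0))) (at (?j 0))" using d\<Xi>0 by simp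
    from has_derivative_compose[OF dj this]
    have d1: "((\<lambda>\<tau>. \<Xi> (?j \<tau>)) has_derivative (\<lambda>\<tau>. dir_deriv (?j \<tau>) \<Xi> (0, 0))) (at 0)" .
    have "(dir_deriv b f has_derivative (\<lambda>v. dir_deriv v (dir_deriv b f) 0)) (at (\<Xi> (?j 0)))"
      using smooth_map_germ_has_derivative[OF smooth_map_germ_dir_deriv[OF f(1)]] \<Xi>0 by simp
    from has_derivative_compose[OF d1 this]
    have d2: "((\<lambda>\<tau>. dir_deriv b f (\<Xi> (?j \<tau>))) has_derivative (\<lambda>\<tau>. dir_deriv (dir_deriv (?j \<tau>) \<Xi> (0, 0)) (dir_deriv b f) 0)) (at 0)" .
    have "(\<psi> has_derivative (\<lambda>v. dir_deriv v \<psi> 0)) (at (0 *\<^sub>R e))"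
      using differentiable_has_dir_deriv[OF eventually_nhds_x_imp_x[OF smooth_at_differentiable(1)[OF sm(2)]]] by simp
    from has_derivative_compose[OF line this]
    have d3: "((\<lambda>\<tau>. \<psi> (\<tau> *\<^sub>R e)) has_derivative (\<lambda>\<tau>. dir_deriv (\<tau> *\<^sub>R e) \<psi> 0)) (at 0)" .
    have lin1: "dir_deriv (?j \<tau>) \<Xi> (0, 0) = \<tau> *\<^sub>R \<xi>" for \<tau>
      using linear_cmul[OF has_derivative_linear[OF d\<Xi>0], of \<tau> "(0, e)"] by (simp add: \<xi>_def)
    have lin2: "dir_deriv (\<tau> *\<^sub>R \<xi>) (dir_deriv b f) 0 = \<tau> *\<^sub>R dir_deriv \<xi> (dir_deriv b f) 0" for \<tau>
      by (rule linear_cmul[OF linear_dir_deriv_map[OF smooth_map_germ_dir_deriv[OF f(1)]]])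
    have lin3: "dir_deriv (\<tau> *\<^sub>R e) \<psi> 0 = \<tau> *\<^sub>R \<psi>'" for \<tau>
      using linear_cmul[OF has_derivative_linear[OF differentiable_has_dir_deriv], of \<psi> 0 \<tau> e]
        eventually_nhds_x_imp_x[OF smooth_at_differentiable(1)[OF sm(2)]] by (simp add: \<psi>'_def)
    from has_derivative_inner[OF d2 d3]
    have "(?B b has_derivative (\<lambda>\<tau>. dir_deriv b f (\<Xi> (?j 0)) \<bullet> dir_deriv (\<tau> *\<^sub>R e) \<psi> 0
        + dir_deriv (dir_deriv (?j \<tau>) \<Xi> (0, 0)) (dir_deriv b f) 0 \<bullet> \<psi> (0 *\<^sub>R e))) (at 0)" .
    moreover have "dir_deriv \<xi> (dir_deriv b f) 0 \<bullet> w = dir_deriv \<xi> (dir_deriv b ?h) 0"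
      by (simp add: dir_deriv2_inner[OF f(1)])
    ultimately show ?thesis
      by (simp add: lin1 lin2 lin3 \<Xi>0 init(2) algebra_simps)
  qed
  have B0: "?B b 0 = 0" for b
    using dh[of b] dir_deriv_inner[OF f(1), of b w] \<Xi>0 init(2) by simp
  have "((\<lambda>\<tau>. \<Sum>b\<in>Basis. ?A b \<tau> * ?B b \<tau>) has_derivative
      (\<lambda>\<tau>. \<Sum>b\<in>Basis. ?A b 0 * (\<tau> * (dir_deriv \<xi> (dir_deriv b ?h) 0 + dir_deriv b f 0 \<bullet> \<psi>')) + a b \<tau> * ?B b 0)) (at 0)"
    by (intro has_derivative_sum has_derivative_mult dA dB)
  then have R: "((\<lambda>\<tau>. \<Sum>b\<in>Basis. ?A b \<tau> * ?B b \<tau>) has_derivative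
      (\<lambda>\<tau>. \<Sum>b\<in>Basis. (\<eta> \<bullet> b) * (\<tau> * (dir_deriv \<xi> (dir_deriv b ?h) 0 + dir_deriv b f 0 \<bullet> \<psi>')))) (at 0)"
    by (simp only: B0) (simp add: \<Xi>\<eta>)
  from key obtain W where W: "open W" "0 \<in> W" "\<And>\<tau>. \<tau> \<in> W \<Longrightarrow> \<tau> * (\<eta> \<bullet> \<eta>) = (\<Sum>b\<in>Basis. ?A b \<tau> * ?B b \<tau>)"
    unfolding eventually_nhds by auto
  have L: "((\<lambda>\<tau>. \<Sum>b\<in>Basis. ?A b \<tau> * ?B b \<tau>) has_derivative (\<lambda>\<tau>. \<tau> * (\<eta> \<bullet> \<eta>))) (at 0)"
    by (rule has_derivative_transform_within_open[OF _ W]) (auto intro!: derivative_eq_intros)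
  from fun_cong[OF has_derivative_unique[OF L R], of 1]
  have "\<eta> \<bullet> \<eta> = (\<Sum>b\<in>Basis. (\<eta> \<bullet> b) * dir_deriv \<xi> (dir_deriv b ?h) 0) + (\<Sum>b\<in>Basis. (\<eta> \<bullet> b) * (dir_deriv b f 0 \<bullet> \<psi>'))"
    by (simp add: distrib_left sum.distrib)
  also have "(\<Sum>b\<in>Basis. (\<eta> \<bullet> b) * dir_deriv \<xi> (dir_deriv b ?h) 0) = dir_deriv \<xi> (dir_deriv \<eta> ?h) 0"
    by (rule dir_deriv2_Basis[OF smooth_germ_inner[OF f(1)], symmetric])
  also have "(\<Sum>b\<in>Basis. (\<eta> \<bullet> b) * (dir_deriv b f 0 \<bullet> \<psi>')) = dir_deriv \<eta> f 0 \<bullet> \<psi>'"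
    using dir_deriv_Basis[OF smooth_germ_inner[OF f(1)], of \<eta> \<psi>'] by (simp add: dir_deriv_inner[OF f(1)])
  finally show False using d2h df\<eta> \<eta> by simp
qed

end

section \<open>The cusp case and the classification\<close>

context H_chart
begin

text \<open>
  Splitting off the square in \<open>x\<close> leaves \<open>c y = \<gamma> (H (q y, y))\<close>, where \<open>q\<close> vanishes to second order because the
  quadratic part has no mixed term. Hence \<open>H (q y, y) = y^2 * \<rho> y\<close> with \<open>\<rho> 0\<close> on the first axis.
  The first-order part of \<open>\<gamma>\<close> is \<open>slope 3 w\<close> times the third coordinate, so \<open>c y = slope 3 w * y^3 + O(y^4)\<close>, which is
  a cube in a suitable coordinate.
\<close>
lemma A2_singularityI:
  assumes s1: "slope 1 w = 0" and s2: "slope 2 w = 0" and c: "curv w \<noteq> 0" and w: "w \<noteq> 0"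
  shows "A_singularity 2 (\<lambda>x. f x \<bullet> w)"
proof -
  note [simp] = Pair_zero_eq_zero vector2_zero
  let ?\<gamma> = "\<lambda>z. \<Psi> z \<bullet> w"
  let ?l = "\<lambda>x. vector [fst x, snd x] :: real^2"
  have l: "bounded_linear ?l"
    by (rule bounded_linear_vector2) (simp_all add: bounded_linear_fst bounded_linear_snd)
  have lE: "?l (1, 0) = E1" "?l (0, 1) = E2" by (simp_all add: vector2_eq_iff E_nth)
  define g where "g x = ?\<gamma> (H_map n (?l x))" for x :: "real \<times> real"
  have h0: "smooth_germ (\<lambda>x. ?\<gamma> (H_map n x)) (?l 0)" using smooth_height_chart by simp
  have g: "smooth_germ g 0" unfolding g_def[abs_def]
    by (rule smooth_germ_compose[OF h0 smooth_map_germ_bounded_linear[OF l]])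
  have dg: "dir_deriv v g 0 = 0" for v
    using dir_deriv_compose[OF h0 smooth_map_germ_bounded_linear[OF l], of v]
    by (simp add: g_def[abs_def] dir_deriv_height_chart_0 s1)
  have d2g: "dir_deriv u (dir_deriv v g) 0 = curv w * fst u * fst v" for u v
    using dir_deriv2_linear[OF l h0, of u v] by (simp add: g_def[abs_def] dir_deriv2_height_chart s2)
  obtain Y q c where Y: "smooth_germ Y (0, 0)" "Y (0, 0) = 0" "dir_deriv (1, 0) Y (0, 0) \<noteq> 0"
    and q: "smooth_germ q 0" "q 0 = 0" and cs: "smooth_germ c 0" and cdef: "\<And>p. c p = g (q p, p)"
    and gY: "\<forall>\<^sub>F x in nhds (0, 0). g x = sgn (dir_deriv (1, 0) (dir_deriv (1, 0) g) (0, 0)) * (Y x)\<^sup>2 + c (snd x)"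
    and dcg: "\<And>w. dir_deriv w c 0 = dir_deriv (0, w) g (0, 0)"
    and dq: "\<And>w. dir_deriv (0, w) (dir_deriv (1, 0) g) (0, 0) = 0 \<Longrightarrow> dir_deriv w q 0 = 0"
    and d2c: "\<And>w. dir_deriv (0, w) (dir_deriv (1, 0) g) (0, 0) = 0 \<Longrightarrow>
      dir_deriv w (dir_deriv w c) 0 = dir_deriv (0, w) (dir_deriv (0, w) g) (0, 0)"
    by (rule split_off_square[of g]) (use g dg d2g c in simp_all)
  define \<epsilon> where "\<epsilon> = sgn (curv w)"
  have \<epsilon>: "\<epsilon> * \<epsilon> = 1" using assms(3) by (simp add: \<epsilon>_def sgn_if)
  have gY': "\<forall>\<^sub>F x in nhds 0. g x = \<epsilon> * (Y x)\<^sup>2 + c (snd x)" using gY by (simp add: d2g \<epsilon>_def)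
  have dq0: "dir_deriv 1 q 0 = 0" by (rule dq) (simp add: d2g)
  obtain q1 where q1: "smooth_germ q1 0" "\<forall>\<^sub>F y in nhds 0. q y = y * q1 y"
    using hadamard_factor_real[OF q] by blast
  have "dir_deriv 1 q 0 = dir_deriv 1 (\<lambda>y. y * q1 y) 0" by (rule dir_deriv_cong[OF q1(2) q(1)])
  then have "q1 0 = 0"
    using dq0 by (simp add: dir_deriv_mult[OF smooth_germ_real_ident q1(1)] dir_deriv_bounded_linear[OF bounded_linear_ident])
  then obtain q2 where q2: "smooth_germ q2 0" "\<forall>\<^sub>F y in nhds 0. q1 y = y * q2 y"
    using hadamard_factor_real[OF q1(1)] by blast
  define \<rho> where "\<rho> y = (vector [q2 y, y * q2 y + y ^ (n - 2), y] :: real^3)" for y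
  have \<rho>: "smooth_map_germ \<rho> 0" unfolding \<rho>_def[abs_def]
    by (intro smooth_map_germ_vector3 smooth_germ_add smooth_germ_mult smooth_germ_power smooth_germ_real_ident q2)
  \<comment> \<open>The factor \<open>y^2\<close> is replaced by an independent variable, and Hadamard's lemma expands in it.\<close>
  define M where "M x = ?\<gamma> (fst x *\<^sub>R \<rho> (snd x))" for x :: "real \<times> real"
  have s\<gamma>: "smooth_germ ?\<gamma> 0" by (rule smooth_germ_inner[OF \<Psi>D(1)])
  have m\<rho>: "smooth_map_germ (\<lambda>x :: real \<times> real. fst x *\<^sub>R \<rho> (snd x)) (0, 0)"
  proof (rule smooth_map_germ_euclideanI)
    fix b :: "real^3"
    have "smooth_germ (\<lambda>x :: real \<times> real. \<rho> (snd x) \<bullet> b) (0, 0)"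
      by (rule smooth_germ_compose[OF _ smooth_map_germ_snd, of "\<lambda>y. \<rho> y \<bullet> b"]) (use smooth_germ_inner[OF \<rho>] in simp)
    then show "smooth_germ (\<lambda>x :: real \<times> real. (fst x *\<^sub>R \<rho> (snd x)) \<bullet> b) (0, 0)"
      by (simp add: smooth_germ_mult smooth_germ_fst)
  qed
  have M: "smooth_germ M (0, 0)" unfolding M_def[abs_def]
    by (rule smooth_germ_compose[OF _ m\<rho>]) (use s\<gamma> in simp)
  have "\<forall>\<^sub>F y in nhds 0. M (0, y) = 0" by (simp add: M_def \<Psi>D)
  then obtain K where K: "smooth_germ K (0, 0)" "\<forall>\<^sub>F x in nhds (0, 0). M x = fst x * K x"
    by (rule hadamard_factor[OF M])
  have m0: "smooth_map_germ (\<lambda>y::real. (0::real, y)) 0"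
    by (intro smooth_map_germ_Pair_realI smooth_germ_const smooth_map_germ_ident)
  have K0: "\<forall>\<^sub>F y in nhds 0. K (0, y) = slope 3 w * y"
  proof -
    have "\<forall>\<^sub>F x in nhds (0, 0). (\<forall>\<^sub>F x in nhds x. M x = fst x * K x) \<and> smooth_germ M x \<and> smooth_germ K x"
      using iffD2[OF eventually_eventually K(2)] smooth_germ_eventually[OF M] smooth_germ_eventually[OF K(1)]
      by eventually_elim blast
    then have "\<forall>\<^sub>F y in nhds 0. (\<forall>\<^sub>F x in nhds (0, y). M x = fst x * K x) \<and> smooth_germ M (0, y) \<and> smooth_germ K (0, y)"
      by (intro eventually_nhds_compose[OF _ smooth_map_germ_continuous[OF m0]]) simp
    then show ?thesis
    proof eventually_elim
      case (elim y)
      have "dir_deriv (1, 0) M (0, y) = dir_deriv (1, 0) (\<lambda>x. fst x * K x) (0, y)"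
        by (rule dir_deriv_cong[OF conjunct1[OF elim] conjunct1[OF conjunct2[OF elim]]])
      also have "\<dots> = K (0, y)"
        using elim by (subst dir_deriv_mult[OF smooth_germ_fst])
          (simp_all add: dir_deriv_bounded_linear[OF bounded_linear_fst])
      finally have KM: "K (0, y) = dir_deriv (1, 0) M (0, y)" ..
      have "((\<lambda>s. M (s, y)) has_real_derivative dir_deriv (1, 0) M (0, y)) (at 0)"
        by (rule has_derivative_fst_line[OF smooth_germ_has_derivative[OF conjunct1[OF conjunct2[OF elim]]]])
      moreover have "((\<lambda>s. M (s, y)) has_real_derivative dir_deriv (\<rho> y) ?\<gamma> 0) (at 0)"
      proof -
        have "((\<lambda>s::real. s *\<^sub>R \<rho> y) has_derivative (\<lambda>s. s *\<^sub>R \<rho> y)) (at 0)"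
          by (rule bounded_linear_imp_has_derivative[OF bounded_linear_scaleR_left])
        moreover have "(?\<gamma> has_derivative (\<lambda>v. dir_deriv v ?\<gamma> 0)) (at (0 *\<^sub>R \<rho> y))"
          using smooth_germ_has_derivative[OF s\<gamma>] by simp
        ultimately have "((\<lambda>s. ?\<gamma> (s *\<^sub>R \<rho> y)) has_derivative (\<lambda>s. dir_deriv (s *\<^sub>R \<rho> y) ?\<gamma> 0)) (at 0)"
          by (rule has_derivative_compose)
        moreover have "(\<lambda>s. dir_deriv (s *\<^sub>R \<rho> y) ?\<gamma> 0) = (*) (dir_deriv (\<rho> y) ?\<gamma> 0)"
          using linear_cmul[OF linear_dir_deriv[OF s\<gamma>]] by (auto simp: mult.commute)
        ultimately show ?thesis unfolding has_field_derivative_def M_def by simp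
      qed
      ultimately have "dir_deriv (1, 0) M (0, y) = dir_deriv (\<rho> y) ?\<gamma> 0" by (rule DERIV_unique)
      also have "\<dots> = slope 3 w * y"
        using s1 s2 unfolding \<rho>_def dir_deriv_vector3[OF s\<gamma>]
        by (simp add: slope_def dir_deriv_inner[OF \<Psi>D(1)])
      finally show ?case using KM by simp
    qed
  qed
  have sd: "smooth_germ (\<lambda>x :: real \<times> real. K x - slope 3 w * snd x) (0, 0)"
    by (intro smooth_germ_diff K smooth_germ_mult smooth_germ_const smooth_germ_bounded_linear bounded_linear_snd)
  have "\<forall>\<^sub>F y in nhds 0. K (0, y) - slope 3 w * snd (0 :: real, y) = 0" using K0 by eventually_elim simp
  then obtain L where L: "smooth_germ L (0, 0)" "\<forall>\<^sub>F x in nhds (0, 0). K x - slope 3 w * snd x = fst x * L x"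
    by (rule hadamard_factor[OF sd])
  define u where "u y = slope 3 w + y * L (y\<^sup>2, y)" for y
  have msq: "smooth_map_germ (\<lambda>y::real. (y\<^sup>2, y)) 0"
    by (intro smooth_map_germ_Pair_realI smooth_germ_power smooth_germ_real_ident smooth_map_germ_ident)
  have su: "smooth_germ u 0" unfolding u_def[abs_def]
    by (intro smooth_germ_add smooth_germ_mult smooth_germ_const smooth_germ_real_ident smooth_germ_compose[OF _ msq])
      (use L in simp)
  have u0: "u 0 \<noteq> 0" using slopes_nonzero[OF w s1 s2] by (simp add: u_def)
  have "\<forall>\<^sub>F y in nhds 0. c y = y ^ 3 * u y"
  proof -
    have a: "\<forall>\<^sub>F y in nhds 0. M (y\<^sup>2, y) = y\<^sup>2 * K (y\<^sup>2, y)"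
      using eventually_nhds_compose[OF _ smooth_map_germ_continuous[OF msq], of "\<lambda>x. M x = fst x * K x"] K(2) by simp
    have b: "\<forall>\<^sub>F y in nhds 0. K (y\<^sup>2, y) - slope 3 w * y = y\<^sup>2 * L (y\<^sup>2, y)"
      using eventually_nhds_compose[OF _ smooth_map_germ_continuous[OF msq],
          of "\<lambda>x. K x - slope 3 w * snd x = fst x * L x"] L(2) by simp
    from a b q1(2) q2(2) show ?thesis
    proof eventually_elim
      case (elim y)
      have "n = 2 + (n - 2)" using n by simp
      then have pn: "y ^ n = y\<^sup>2 * y ^ (n - 2)" by (metis power_add)
      have "H_map n (?l (q y, y)) = y\<^sup>2 *\<^sub>R \<rho> y"
        using elim(3,4) pn
        by (simp add: H_map_def \<rho>_def vec_eq_iff forall_3 power2_eq_square power3_eq_cube algebra_simps)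
      then have "c y = M (y\<^sup>2, y)" unfolding cdef g_def M_def by simp
      also have "\<dots> = y\<^sup>2 * (slope 3 w * y + y\<^sup>2 * L (y\<^sup>2, y))" using elim(1,2) by simp
      also have "\<dots> = y ^ 3 * u y" by (simp add: u_def power2_eq_square power3_eq_cube algebra_simps)
      finally show ?case .
    qed
  qed
  then obtain V where V: "smooth_germ V 0" "V 0 = 0" "dir_deriv 1 V 0 \<noteq> 0"
    "\<forall>\<^sub>F y in nhds 0. c y = sgn (u 0) * V y ^ 3"
    by (rule cube_root_form[OF su u0])
  have "K_equivalent (\<lambda>x. f x \<bullet> w) (\<lambda>x. (x $ 1)\<^sup>2 + \<epsilon> * sgn (u 0) * (x $ 2) ^ 3)"
  proof (rule K_equivalent_normal_form[OF inverse_diffeo_germs_sym[OF \<phi>] _ _ _ V(1-3) \<epsilon>])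
    show "smooth_germ Y 0" "Y 0 = 0" "dir_deriv (1, 0) Y 0 \<noteq> 0" using Y by simp_all
    have "\<forall>\<^sub>F x :: real^2 in nhds 0. g (x $ 1, x $ 2) = \<epsilon> * (Y (x $ 1, x $ 2))\<^sup>2 + c (snd (x $ 1, x $ 2))"
      by (rule eventually_coords[OF gY'])
    moreover have "\<forall>\<^sub>F x :: real^2 in nhds 0. c (x $ 2) = sgn (u 0) * V (x $ 2) ^ 3" by (rule eventually_nth[OF V(4)])
    ultimately show "\<forall>\<^sub>F x in nhds 0. f (\<phi>' x) \<bullet> w = \<epsilon> * (Y (x $ 1, x $ 2))\<^sup>2 + sgn (u 0) * V (x $ 2) ^ 3"
      using chart
    proof eventually_elim
      case (elim x)
      have "(vector [x $ 1, x $ 2] :: real^2) = x" by (simp add: vector2_eq_iff)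
      then show ?case using elim by (simp add: g_def)
    qed
  qed
  moreover have "\<epsilon> * sgn (u 0) = 1 \<or> \<epsilon> * sgn (u 0) = -1" using assms(3) u0 by (simp add: \<epsilon>_def sgn_if)
  ultimately show ?thesis by (intro A_singularityI[of _ "\<epsilon> * sgn (u 0)"]) simp_all
qed

lemma A1_singularity_iff: "A_singularity 1 (\<lambda>x. f x \<bullet> w) \<longleftrightarrow> slope 1 w = 0 \<and> slope 2 w \<noteq> 0"
  using A1_singularity_imp A1_singularityI by blast

lemma A2_singularity_iff:
  "w \<noteq> 0 \<Longrightarrow> A_singularity 2 (\<lambda>x. f x \<bullet> w) \<longleftrightarrow> slope 1 w = 0 \<and> slope 2 w = 0 \<and> curv w \<noteq> 0"
  using A2_singularity_imp A2_singularityI by blast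

lemma D4_or_worse_iff: "D4_or_worse (\<lambda>x. f x \<bullet> w) \<longleftrightarrow> slope 1 w = 0 \<and> slope 2 w = 0 \<and> curv w = 0"
  unfolding D4_or_worse_def singular_germ_height_iff using hessian_height_eq_0_iff by blast

text \<open>
  A critical height function whose Hessian has rank 1 is already an \<open>A_2\<close>.
\<close>
lemma not_A_ge_3_singularity:
  assumes "w \<noteq> 0"
  shows "\<not> A_ge_singularity 3 (\<lambda>x. f x \<bullet> w)"
proof
  assume "A_ge_singularity 3 (\<lambda>x. f x \<bullet> w)"
  then have "slope 1 w = 0" "rank (hessian (\<lambda>x. f x \<bullet> w)) = 1" "\<not> A_singularity 2 (\<lambda>x. f x \<bullet> w)"
    unfolding A_ge_singularity_def singular_germ_height_iff by auto
  then show False using rank_hessian_1_imp A2_singularity_iff[OF assms] by blast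
qed

end

lemma A_equivalent_H_germ_chart:
  assumes "k \<ge> 2" "smooth_at f 0" "f 0 = 0" "A_equivalent f (H_germ k)"
  obtains \<phi> \<phi>' \<Psi> \<Psi>' where "H_chart f \<phi> \<phi>' \<Psi> \<Psi>' (3 * k - 1)"
proof -
  from assms(4) obtain \<phi> \<phi>' \<Phi> \<Psi> where \<phi>: "inverse_diffeo_germs \<phi> \<phi>'" and \<Phi>: "inverse_diffeo_germs \<Phi> \<Psi>"
    and ev: "\<forall>\<^sub>F x in nhds 0. H_germ k x = \<Phi> (f (\<phi>' x))"
    unfolding A_equivalent_def diffeo_germ_def by blast
  note * = inverse_diffeo_germsD[OF \<phi>] inverse_diffeo_germsD[OF \<Phi>]
  have f: "smooth_map_germ f 0" by (rule smooth_at_imp_smooth_map_germ[OF assms(2)])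
  have "isCont (\<lambda>x. f (\<phi>' x)) 0"
    by (rule smooth_map_germ_continuous[OF smooth_map_germ_compose[OF _ *(2)]]) (use f * in simp)
  from eventually_nhds_compose[OF _ this, of "\<lambda>y. \<Psi> (\<Phi> y) = y"]
  have "\<forall>\<^sub>F x in nhds 0. \<Psi> (\<Phi> (f (\<phi>' x))) = f (\<phi>' x)" using * assms(3) by simp
  with ev have "\<forall>\<^sub>F x in nhds 0. f (\<phi>' x) = \<Psi> (H_map (3 * k - 1) x)"
    by eventually_elim (simp add: H_germ_def H_map_def Let_def)
  then have "H_chart f \<phi> \<phi>' \<Psi> \<Phi> (3 * k - 1)"
    using assms(1,3) by unfold_locales (simp_all add: \<phi> inverse_diffeo_germs_sym[OF \<Phi>] f)
  then show ?thesis by (rule that)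
qed

theorem theorem3p1:
  fixes k :: nat and f :: "real^2 \<Rightarrow> real^3" and w\<^sub>0 :: "real^3"
  defines "h \<equiv> (\<lambda>x. height f x w\<^sub>0)"
  assumes "k \<ge> 2"
    and "smooth_at f 0" and "f 0 = 0"
    and "A_equivalent f (H_germ k)"
    and "w\<^sub>0 \<in> sphere 0 1"
  shows "(A_singularity 1 h \<longleftrightarrow> w\<^sub>0 \<in> normal_plane f \<and> \<not> principal_normal f w\<^sub>0) \<and>
         (A_singularity 1 h \<longrightarrow> R_plus_versal (sphere 0 1) w\<^sub>0 h (height f)) \<and>
         (A_singularity 2 h \<longleftrightarrow> principal_normal f w\<^sub>0 \<and> \<not> inflection_point f) \<and>
         (A_singularity 2 h \<longrightarrow> \<not> R_plus_versal (sphere 0 1) w\<^sub>0 h (height f)) \<and>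
         \<not> A_ge_singularity 3 h \<and>
         (D4_or_worse h \<longleftrightarrow> principal_normal f w\<^sub>0 \<and> inflection_point f) \<and>
         (D4_or_worse h \<longrightarrow> \<not> R_plus_versal (sphere 0 1) w\<^sub>0 h (height f))"
proof -
  obtain \<phi> \<phi>' \<Psi> \<Psi>' where "H_chart f \<phi> \<phi>' \<Psi> \<Psi>' (3 * k - 1)"
    using A_equivalent_H_germ_chart[OF assms(2-5)] by blast
  then interpret H_chart f \<phi> \<phi>' \<Psi> \<Psi>' "3 * k - 1" .
  have h: "h = (\<lambda>x. f x \<bullet> w\<^sub>0)" by (simp add: h_def height_def)
  have w: "norm w\<^sub>0 = 1" "w\<^sub>0 \<noteq> 0" using assms(6) by auto
  note pn = principal_normal_iff[of w\<^sub>0]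
  have ip: "principal_normal f w\<^sub>0 \<Longrightarrow> inflection_point f \<longleftrightarrow> curv w\<^sub>0 = 0" by (rule inflection_point_iff)
  show ?thesis
    unfolding h A1_singularity_iff A2_singularity_iff[OF w(2)] D4_or_worse_iff normal_plane_iff
    using pn w(1) ip not_A_ge_3_singularity[OF w(2)] morse_height_versal[OF _ _ assms(6)] degenerate_height_not_versal[of w\<^sub>0] by blast
qed

end
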